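(* Assume the continuum hypothesis $\aleph_1=2^{\aleph_0}$. Let $G$ be a connected separable Banach-Lie group and denote by $\mathfrak{z}$ the center of the Lie algebra of $G$. Then $G$ contains a connected pseudo-discrete normal nontrivial subgroup if and only if $\dim\mathfrak{z}>1$.
   Context: Banach-Lie groups are real. A pseudo-discrete subgroup of a Banach-Lie group $G$ is any subgroup $H\subseteq G$ such that, for every open interval $D\subseteq\mathbb{R}$ and every smooth ($C^\infty$) map $\gamma\colon D\to G$ with $\gamma(D)\subseteq H$, the map $\gamma$ is constant. Connectedness of a subgroup refers to the topology induced from $G$; nontrivial means different from $\{\mathbf 1\}$. *)

theory Defs
  imports "HOL-Analysis.Analysis" "HOL-Algebra.Coset"
begin

section \<open>Smooth maps between normed spaces\<close>

text \<open>
  Bounded \<open>k\<close>-linear maps are encoded as functions on lists of length \<open>k\<close>; their values on lists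
  of other lengths are irrelevant.
\<close>

definition bounded_multilinear ::
  "nat \<Rightarrow> ('a::real_normed_vector list \<Rightarrow> 'b::real_normed_vector) \<Rightarrow> bool"
  where "bounded_multilinear k m \<longleftrightarrow>
    (\<forall>us ws. Suc (length us + length ws) = k \<longrightarrow> linear (\<lambda>v. m (us @ v # ws))) \<and>
    (\<exists>C. \<forall>vs. length vs = k \<longrightarrow> norm (m vs) \<le> C * prod_list (map norm vs))"

text \<open>
  Smoothness is Frechet smoothness. The witness \<open>D x\<close>, restricted to lists of length \<open>k\<close>, is the
  \<open>k\<close>-th Frechet derivative of \<open>f\<close> at \<open>x\<close>; the last conjunct says that \<open>D y\<close> on lists of length
  \<open>k\<close> is Frechet differentiable in \<open>y\<close> at \<open>x\<close> with respect to the operator norm on bounded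
  \<open>k\<close>-linear maps, the derivative in direction \<open>h\<close> being \<open>\<lambda>vs. D x (h # vs)\<close>.
\<close>

definition smooth_on ::
  "'a::real_normed_vector set \<Rightarrow> ('a \<Rightarrow> 'b::real_normed_vector) \<Rightarrow> bool"
  where "smooth_on S f \<longleftrightarrow> open S \<and>
    (\<exists>D :: 'a \<Rightarrow> 'a list \<Rightarrow> 'b. \<forall>x\<in>S. D x [] = f x \<and>
      (\<forall>k. bounded_multilinear k (D x) \<and>
        (\<forall>e>0. \<forall>\<^sub>F y in nhds x. \<forall>vs. length vs = k \<longrightarrow>
          norm (D y vs - D x vs - D x ((y - x) # vs))
            \<le> e * norm (y - x) * prod_list (map norm vs))))"


section \<open>Banach manifolds\<close>

text \<open>A chart is a pair of its domain and the coordinate map.\<close>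

type_synonym ('m, 'e) chart = "'m set \<times> ('m \<Rightarrow> 'e)"

definition banach_atlas :: "'m topology \<Rightarrow> ('m, 'e::banach) chart set \<Rightarrow> bool"
  where "banach_atlas T A \<longleftrightarrow>
    (\<Union>(U, \<phi>)\<in>A. U) = topspace T \<and>
    (\<forall>(U, \<phi>)\<in>A. openin T U \<and> open (\<phi> ` U) \<and>
       homeomorphic_map (subtopology T U) (top_of_set (\<phi> ` U)) \<phi>) \<and>
    (\<forall>(U, \<phi>)\<in>A. \<forall>(V, \<psi>)\<in>A. smooth_on (\<phi> ` (U \<inter> V)) (\<psi> \<circ> inv_into U \<phi>))"

definition smooth_map ::
  "'m topology \<Rightarrow> ('m, 'e::real_normed_vector) chart set \<Rightarrow>
   'n topology \<Rightarrow> ('n, 'f::real_normed_vector) chart set \<Rightarrow> ('m \<Rightarrow> 'n) \<Rightarrow> bool"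
  where "smooth_map T A T' B f \<longleftrightarrow> continuous_map T T' f \<and>
    (\<forall>(U, \<phi>)\<in>A. \<forall>(V, \<psi>)\<in>B.
       smooth_on (\<phi> ` {x \<in> U. f x \<in> V}) (\<psi> \<circ> f \<circ> inv_into U \<phi>))"

definition prod_atlas ::
  "('m, 'e) chart set \<Rightarrow> ('n, 'f) chart set \<Rightarrow> ('m \<times> 'n, 'e \<times> 'f) chart set"
  where "prod_atlas A B = (\<lambda>((U, \<phi>), (V, \<psi>)). (U \<times> V, map_prod \<phi> \<psi>)) ` (A \<times> B)"


section \<open>Banach-Lie groups\<close>

locale banach_lie_group = group G
  for G :: "('g, 'r) monoid_scheme" (structure)
    and T :: "'g topology"
    and A :: "('g, 'e::banach) chart set" +
  assumes topspace_eq: "topspace T = carrier G"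
    and Hausdorff: "Hausdorff_space T"
    and atlas: "banach_atlas T A"
    and smooth_mult:
      "smooth_map (prod_topology T T) (prod_atlas A A) T A (\<lambda>(x, y). x \<otimes> y)"
    and smooth_inv: "smooth_map T A T A (\<lambda>x. inv x)"

definition separable_topology :: "'g topology \<Rightarrow> bool"
  where "separable_topology T \<longleftrightarrow>
    (\<exists>C. countable C \<and> C \<subseteq> topspace T \<and> T closure_of C = topspace T)"

definition pseudo_discrete ::
  "('g, 'r) monoid_scheme \<Rightarrow> 'g topology \<Rightarrow> ('g, 'e::banach) chart set \<Rightarrow> 'g set \<Rightarrow> bool"
  where "pseudo_discrete G T A H \<longleftrightarrow> subgroup H G \<and>
    (\<forall>(I :: real set) \<gamma>. open I \<and> is_interval I \<and>
       smooth_map (top_of_set I) {(I, \<lambda>t. t)} T A \<gamma> \<and> \<gamma> ` I \<subseteq> H \<longrightarrow> \<gamma> constant_on I)"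


section \<open>The Lie algebra\<close>

text \<open>
  A chart \<open>(U, \<phi>)\<close> around the unit identifies the tangent space of \<open>G\<close> at the unit with the model
  space \<open>'e\<close>. In this chart, \<open>left_invariant_field\<close> is the local representative of the
  left-invariant vector field \<open>g \<mapsto> d(L\<^sub>g) v\<close>, where \<open>L\<^sub>g\<close> is left translation by \<open>g\<close> and the
  differential is taken at the unit, and \<open>lie_bracket\<close> is the value at the unit of the bracket
  \<open>[X, Y](p) = DY(p)(X(p)) - DX(p)(Y(p))\<close> of two such fields. All derivatives depend only on
  points near \<open>\<phi> \<one>\<close> in the open set \<open>\<phi> ` U\<close>.
\<close>

definition left_invariant_field ::
  "('g, 'r) monoid_scheme \<Rightarrow> ('g, 'e::banach) chart \<Rightarrow> 'e \<Rightarrow> 'e \<Rightarrow> 'e"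
  where "left_invariant_field G = (\<lambda>(U, \<phi>) v p.
    frechet_derivative (\<lambda>q. \<phi> (inv_into U \<phi> p \<otimes>\<^bsub>G\<^esub> inv_into U \<phi> q)) (at (\<phi> \<one>\<^bsub>G\<^esub>)) v)"

definition lie_bracket ::
  "('g, 'r) monoid_scheme \<Rightarrow> ('g, 'e::banach) chart \<Rightarrow> 'e \<Rightarrow> 'e \<Rightarrow> 'e"
  where "lie_bracket G c v w =
    (let X = left_invariant_field G c v; Y = left_invariant_field G c w; p = snd c \<one>\<^bsub>G\<^esub>
     in frechet_derivative Y (at p) (X p) - frechet_derivative X (at p) (Y p))"

definition lie_center :: "('g, 'r) monoid_scheme \<Rightarrow> ('g, 'e::banach) chart \<Rightarrow> 'e set"
  where "lie_center G c = {v. \<forall>w. lie_bracket G c v w = 0}"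

text \<open>
  The function \<open>dim\<close> is natural-number valued and returns \<open>0\<close> on infinite-dimensional spaces; here
  infinite dimension counts as larger than every natural number.
\<close>

definition dim_greater :: "'e::real_vector set \<Rightarrow> nat \<Rightarrow> bool"
  where "dim_greater V n \<longleftrightarrow>
    (\<exists>B. B \<subseteq> V \<and> independent B \<and> V \<subseteq> span B \<and> (infinite B \<or> n < card B))"


section \<open>The continuum hypothesis\<close>

definition continuum_hypothesis :: bool
  where "continuum_hypothesis \<longleftrightarrow>
    (cardSuc natLeq, BNF_Cardinal_Arithmetic.cexp BNF_Cardinal_Arithmetic.ctwo natLeq) \<in> ordIso"

end

theory Submission
  imports Defs "HOL-Algebra.Generated_Groups"
begin

text \<open>
  Let \<open>N\<close> be pseudo-discrete and normal. The smooth curves \<open>t \<mapsto> c t n (c t)\<^sup>-\<^sup>1\<close> stay in \<open>N\<close>, hence are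
  constant, so \<open>N\<close> is central. Near the unit the center of \<open>G\<close> is the exponential image of the
  center of the Lie algebra; if the latter has dimension at most one, a connected subgroup of it is
  trivial or contains an arc of a one-parameter subgroup.

  Conversely, two independent central elements of the Lie algebra span a continuous homomorphism
  \<open>F\<close> from the plane into the center of \<open>G\<close> with countable kernel. A transfinite construction of
  Bernstein type gives an additive subgroup \<open>H\<close> of the plane that meets every uncountable closed
  set, and so is connected, while \<open>H + ker F\<close> contains no uncountable closed set. A nonconstant
  curve in \<open>F H\<close> would produce one, namely the preimage of a compact arc.

  No general theory of Banach-Lie groups is needed: one-parameter subgroups and the local logarithm
  both come from Picard iteration for \<open>c' = L (c) v\<close> in a single chart, where \<open>L (x) v\<close> is the
  left-invariant field, and centrality is read off from the derivative of \<open>Ad\<close> along \<open>c\<close>.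
\<close>

section \<open>Smooth maps\<close>

lemma has_vector_derivative_iff_quotient:
  "(f has_vector_derivative f') (at t within S) \<longleftrightarrow>
    ((\<lambda>s. (f s - f t) /\<^sub>R (s - t)) \<longlongrightarrow> f') (at t within S)"
proof -
  have "norm ((f s - f t) - (s - t) *\<^sub>R f') / norm (s - t) = norm ((f s - f t) /\<^sub>R (s - t) - f')"
    if "s \<noteq> t" for s
  proof -
    have "(f s - f t) /\<^sub>R (s - t) - f' = ((f s - f t) - (s - t) *\<^sub>R f') /\<^sub>R (s - t)"
      using that by (simp add: scaleR_diff_right)
    then show ?thesis by (simp add: divide_inverse)
  qed
  then have "((\<lambda>s. norm ((f s - f t) - (s - t) *\<^sub>R f') / norm (s - t)) \<longlongrightarrow> 0) (at t within S) \<longleftrightarrow>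
      ((\<lambda>s. norm ((f s - f t) /\<^sub>R (s - t) - f')) \<longlongrightarrow> 0) (at t within S)"
    by (intro filterlim_cong) (auto simp: eventually_at_filter)
  then show ?thesis
    by (simp add: has_vector_derivative_def has_derivative_iff_norm tendsto_norm_zero_iff
        bounded_linear_scaleR_left LIM_zero_iff)
qed

lemma bounded_multilinear_linear:
  "bounded_multilinear k m \<Longrightarrow> Suc (length us + length ws) = k \<Longrightarrow> linear (\<lambda>v. m (us @ v # ws))"
  unfolding bounded_multilinear_def by (elim conjE) simp

lemma bounded_multilinear_ex_bound:
  "bounded_multilinear k m \<Longrightarrow> \<exists>C. \<forall>vs. length vs = k \<longrightarrow> norm (m vs) \<le> C * prod_list (map norm vs)"
  unfolding bounded_multilinear_def by (elim conjE)

lemma bounded_multilinear_Cons: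
  assumes "bounded_multilinear (Suc k) m"
  shows "bounded_multilinear k (\<lambda>vs. m (v # vs))"
proof -
  obtain C where C: "\<And>vs. length vs = Suc k \<Longrightarrow> norm (m vs) \<le> C * prod_list (map norm vs)"
    using bounded_multilinear_ex_bound[OF assms] by auto
  have "linear (\<lambda>x. m (v # us @ x # ws))" if "Suc (length us + length ws) = k" for us ws
    using bounded_multilinear_linear[OF assms, of "v # us" ws] that by simp
  moreover have "norm (m (v # vs)) \<le> (C * norm v) * prod_list (map norm vs)" if "length vs = k" for vs
    using C[of "v # vs"] that by (simp add: mult.assoc)
  ultimately show ?thesis
    unfolding bounded_multilinear_def by (intro conjI exI[of _ "C * norm v"]) auto
qed

lemma bounded_multilinear_linear_Cons:
  assumes "bounded_multilinear (Suc k) m" "length vs = k"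
  shows "linear (\<lambda>v. m (v # vs))"
  using bounded_multilinear_linear[OF assms(1), of "[]" vs] assms(2) by simp

lemma prod_list_norm_nonneg: "prod_list (map norm vs) \<ge> 0"
  by (induction vs) auto

lemma bounded_multilinear_bound:
  assumes "bounded_multilinear k m"
  obtains C where "C \<ge> 0" "\<And>vs. length vs = k \<Longrightarrow> norm (m vs) \<le> C * prod_list (map norm vs)"
proof -
  obtain C where C: "\<And>vs. length vs = k \<Longrightarrow> norm (m vs) \<le> C * prod_list (map norm vs)"
    using bounded_multilinear_ex_bound[OF assms] by auto
  have "norm (m vs) \<le> \<bar>C\<bar> * prod_list (map norm vs)" if "length vs = k" for vs
    using C[OF that] mult_right_mono[OF abs_ge_self prod_list_norm_nonneg, of C vs] by linarith
  then show thesis using that[of "\<bar>C\<bar>"] by auto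
qed

lemma tendsto_prod_list_map:
  fixes ul :: "('b \<Rightarrow> 'a::real_normed_vector) \<Rightarrow> 'a"
  assumes "\<And>u. u \<in> set us \<Longrightarrow> (u \<longlongrightarrow> ul u) F"
  shows "((\<lambda>t. prod_list (map norm (map (\<lambda>u. u t) us))) \<longlongrightarrow> prod_list (map norm (map ul us))) F"
  using assms by (induction us) (auto intro!: tendsto_intros)

lemma bounded_multilinear_tendsto_Cons:
  fixes m :: "'a::real_normed_vector list \<Rightarrow> 'b::real_normed_vector"
  assumes m: "bounded_multilinear (Suc (length us)) m"
    and q: "(q \<longlongrightarrow> ql) F"
    and us: "\<And>u. u \<in> set us \<Longrightarrow> (u \<longlongrightarrow> ul u) F"
    and tail: "((\<lambda>t. m (ql # map (\<lambda>u. u t) us)) \<longlongrightarrow> l) F"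
  shows "((\<lambda>t. m (q t # map (\<lambda>u. u t) us)) \<longlongrightarrow> l) F"
proof -
  obtain C where C: "C \<ge> 0" "\<And>vs. length vs = Suc (length us) \<Longrightarrow> norm (m vs) \<le> C * prod_list (map norm vs)"
    using bounded_multilinear_bound[OF m] by blast
  have lin: "linear (\<lambda>v. m (v # map (\<lambda>u. u t) us))" for t
    by (rule bounded_multilinear_linear_Cons[OF m]) simp
  have diff: "m (q t # map (\<lambda>u. u t) us) - m (ql # map (\<lambda>u. u t) us) = m ((q t - ql) # map (\<lambda>u. u t) us)" for t
    using linear_diff[OF lin] by simp
  have "((\<lambda>t. C * (norm (q t - ql) * prod_list (map norm (map (\<lambda>u. u t) us)))) \<longlongrightarrow>
      C * (norm (ql - ql) * prod_list (map norm (map ul us)))) F"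
    by (intro tendsto_intros q tendsto_prod_list_map us)
  then have "((\<lambda>t. C * (norm (q t - ql) * prod_list (map norm (map (\<lambda>u. u t) us)))) \<longlongrightarrow> 0) F"
    by simp
  then have "((\<lambda>t. m ((q t - ql) # map (\<lambda>u. u t) us)) \<longlongrightarrow> 0) F"
  proof (rule Lim_null_comparison[rotated])
    show "\<forall>\<^sub>F t in F. norm (m ((q t - ql) # map (\<lambda>u. u t) us))
        \<le> C * (norm (q t - ql) * prod_list (map norm (map (\<lambda>u. u t) us)))"
      using C(2)[of "(q _ - ql) # map (\<lambda>u. u _) us"] by (auto simp: o_def)
  qed
  from tendsto_add[OF this tail] show ?thesis
    unfolding diff[symmetric] by simp
qed

lemma bounded_multilinear_tendsto:
  fixes m :: "'a::real_normed_vector list \<Rightarrow> 'b::real_normed_vector"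
  assumes "bounded_multilinear (length us) m"
    and "\<And>u. u \<in> set us \<Longrightarrow> (u \<longlongrightarrow> ul u) F"
  shows "((\<lambda>t. m (map (\<lambda>u. u t) us)) \<longlongrightarrow> m (map ul us)) F"
  using assms
proof (induction us arbitrary: m)
  case Nil
  then show ?case by simp
next
  case (Cons u us)
  have "((\<lambda>t. m (ul u # map (\<lambda>u. u t) us)) \<longlongrightarrow> m (ul u # map ul us)) F"
    using Cons.prems by (intro Cons.IH[of "\<lambda>vs. m (ul u # vs)"] bounded_multilinear_Cons) auto
  then show ?case
    using Cons.prems bounded_multilinear_tendsto_Cons[where ul=ul and m=m and us=us and q=u and ql="ul u" and F=F
      and l="m (ul u # map ul us)"]
    by simp
qed

lemma bounded_multilinear_has_vector_derivative:
  fixes m :: "'a::real_normed_vector list \<Rightarrow> 'b::real_normed_vector"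
  assumes "bounded_multilinear (length us) m"
    and "\<And>u. u \<in> set us \<Longrightarrow> (u has_vector_derivative d u t) (at t)"
  shows "((\<lambda>t. m (map (\<lambda>u. u t) us)) has_vector_derivative
    (\<Sum>i<length us. m (map (\<lambda>u. u t) (us[i := d (us ! i)])))) (at t)"
  using assms
proof (induction us arbitrary: m)
  case Nil
  then show ?case by simp
next
  case (Cons u us)
  have m: "bounded_multilinear (Suc (length us)) m"
    using Cons.prems(1) by simp
  have lin: "linear (\<lambda>v. m (v # map (\<lambda>u. u s) us))" for s
    by (rule bounded_multilinear_linear_Cons[OF m]) simp
  let ?S = "\<Sum>i<length us. m (u t # map (\<lambda>u. u t) (us[i := d (us ! i)]))"
  have IH: "((\<lambda>s. m (u t # map (\<lambda>u. u s) us)) has_vector_derivative ?S) (at t)"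
    using Cons.prems by (intro Cons.IH[of "\<lambda>vs. m (u t # vs)"] bounded_multilinear_Cons) auto
  have cont: "(u' \<longlongrightarrow> u' t) (at t)" if "u' \<in> set (u # us)" for u'
    using has_vector_derivative_continuous[OF Cons.prems(2)[OF that]] by (simp add: isCont_def)
  have tail: "((\<lambda>s. m (d u t # map (\<lambda>u. u s) us)) \<longlongrightarrow> m (d u t # map (\<lambda>u. u t) us)) (at t)"
    using Cons.prems cont
    by (intro bounded_multilinear_tendsto[of us "\<lambda>vs. m (d u t # vs)" "\<lambda>u. u t"] bounded_multilinear_Cons) auto
  have "((\<lambda>s. (u s - u t) /\<^sub>R (s - t)) \<longlongrightarrow> d u t) (at t)"
    using Cons.prems(2)[of u] by (simp add: has_vector_derivative_iff_quotient)
  note quot = this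
  have q: "((\<lambda>s. m (((u s - u t) /\<^sub>R (s - t)) # map (\<lambda>u. u s) us)) \<longlongrightarrow> m (d u t # map (\<lambda>u. u t) us)) (at t)"
    by (rule bounded_multilinear_tendsto_Cons[where ul="\<lambda>u. u t", OF m quot _ tail]) (simp add: cont)
  have "((\<lambda>s. m ((u s - u t) # map (\<lambda>u. u s) us)) has_vector_derivative m (d u t # map (\<lambda>u. u t) us)) (at t)"
    unfolding has_vector_derivative_iff_quotient
    using q linear_0[OF lin] by (simp add: linear_scale[OF lin])
  from has_vector_derivative_add[OF this IH]
  have "((\<lambda>s. m (u s # map (\<lambda>u. u s) us)) has_vector_derivative
      (m (d u t # map (\<lambda>u. u t) us) + ?S)) (at t)"
    by (simp add: linear_diff[OF lin])
  then show ?case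
    by (simp add: sum.lessThan_Suc_shift del: sum.lessThan_Suc)
qed

definition jet_on :: "'a::real_normed_vector set \<Rightarrow> ('a \<Rightarrow> 'a list \<Rightarrow> 'b::real_normed_vector) \<Rightarrow> bool"
  where "jet_on S D \<longleftrightarrow> (\<forall>x\<in>S. \<forall>k. bounded_multilinear k (D x) \<and>
        (\<forall>e>0. \<forall>\<^sub>F y in nhds x. \<forall>vs. length vs = k \<longrightarrow>
          norm (D y vs - D x vs - D x ((y - x) # vs))
            \<le> e * norm (y - x) * prod_list (map norm vs)))"

lemma smooth_on_iff_jet:
  "smooth_on S f \<longleftrightarrow> open S \<and> (\<exists>D. jet_on S D \<and> (\<forall>x\<in>S. D x [] = f x))"
proof -
  have "(\<forall>x\<in>S. D x [] = f x \<and> Q D x) \<longleftrightarrow> (\<forall>x\<in>S. Q D x) \<and> (\<forall>x\<in>S. D x [] = f x)"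
    for D :: "'a \<Rightarrow> 'a list \<Rightarrow> 'b" and Q
    by blast
  note * = this
  show ?thesis
    unfolding smooth_on_def jet_on_def
    by (rule arg_cong2[where f="(\<and>)", OF refl], rule arg_cong[where f=Ex], rule ext, rule *)
qed

lemma smooth_onE:
  assumes "smooth_on S f"
  obtains D where "open S" "jet_on S D" "\<And>x. x \<in> S \<Longrightarrow> D x [] = f x"
proof -
  from assms obtain D where "open S" "jet_on S D" "\<forall>x\<in>S. D x [] = f x"
    unfolding smooth_on_iff_jet by (elim conjE exE)
  with that[of D] show thesis by simp
qed

lemma smooth_on_open: "smooth_on S f \<Longrightarrow> open S"
  by (erule smooth_onE)

lemma smooth_onI:
  assumes "open S" "jet_on S D" "\<And>x. x \<in> S \<Longrightarrow> D x [] = f x"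
  shows "smooth_on S f"
  unfolding smooth_on_iff_jet using assms by (intro conjI exI[of _ D]) simp_all

lemma jet_on_multilinear: "jet_on S D \<Longrightarrow> x \<in> S \<Longrightarrow> bounded_multilinear k (D x)"
  by (simp add: jet_on_def)

lemma jet_on_approx:
  assumes "jet_on S D" "x \<in> S" "e > 0"
  shows "\<forall>\<^sub>F y in nhds x. \<forall>vs. length vs = k \<longrightarrow>
          norm (D y vs - D x vs - D x ((y - x) # vs)) \<le> e * norm (y - x) * prod_list (map norm vs)"
  using assms by (simp add: jet_on_def)

lemma jet_on_has_derivative:
  assumes "jet_on S D" "x \<in> S"
  shows "((\<lambda>y. D y vs) has_derivative (\<lambda>h. D x (h # vs))) (at x)"
proof -
  obtain C where C: "C \<ge> 0" "\<And>ws. length ws = Suc (length vs) \<Longrightarrow> norm (D x ws) \<le> C * prod_list (map norm ws)"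
    using bounded_multilinear_bound[OF jet_on_multilinear[OF assms]] by metis
  have "linear (\<lambda>h. D x (h # vs))"
    by (rule bounded_multilinear_linear_Cons[OF jet_on_multilinear[OF assms]]) simp
  then have bl: "bounded_linear (\<lambda>h. D x (h # vs))"
  proof (rule bounded_linear.intro)
    have "norm (D x (h # vs)) \<le> norm h * (C * prod_list (map norm vs))" for h
      using C(2)[of "h # vs"] by (simp add: algebra_simps)
    then show "bounded_linear_axioms (\<lambda>h. D x (h # vs))"
      unfolding bounded_linear_axioms_def by blast
  qed
  show ?thesis
    unfolding has_derivative_within_alt2
  proof (intro conjI bl allI impI)
    fix e :: real assume e: "e > 0"
    let ?P = "prod_list (map norm vs)"
    have P: "?P \<ge> 0" by (rule prod_list_norm_nonneg)
    have "\<forall>\<^sub>F y in nhds x. norm (D y vs - D x vs - D x ((y - x) # vs)) \<le> e / (?P + 1) * norm (y - x) * ?P"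
      using jet_on_approx[OF assms, of "e / (?P + 1)" "length vs"] e P
      by (auto elim!: eventually_mono)
    then have "\<forall>\<^sub>F y in nhds x. norm (D y vs - D x vs - D x ((y - x) # vs)) \<le> e * norm (y - x)"
    proof (rule eventually_mono)
      fix y assume *: "norm (D y vs - D x vs - D x ((y - x) # vs)) \<le> e / (?P + 1) * norm (y - x) * ?P"
      have "e / (?P + 1) * norm (y - x) * ?P = e * norm (y - x) * (?P / (?P + 1))"
        by simp
      also have "\<dots> \<le> e * norm (y - x) * 1"
        using e P by (intro mult_left_mono) auto
      finally show "norm (D y vs - D x vs - D x ((y - x) # vs)) \<le> e * norm (y - x)"
        using * by simp
    qed
    then show "\<forall>\<^sub>F y in at x. norm (D y vs - D x vs - D x ((y - x) # vs)) \<le> e * norm (y - x)"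
      by (simp add: eventually_at_filter eventually_mono)
  qed
qed

lemma jet_on_curve_has_vector_derivative:
  fixes \<gamma> :: "real \<Rightarrow> 'a::real_normed_vector"
  assumes D: "jet_on S D" "\<gamma> t \<in> S"
    and \<gamma>: "(\<gamma> has_vector_derivative \<gamma>' t) (at t)"
    and us: "\<And>u. u \<in> set us \<Longrightarrow> (u has_vector_derivative d u t) (at t)"
  shows "((\<lambda>t. D (\<gamma> t) (map (\<lambda>u. u t) us)) has_vector_derivative
    (D (\<gamma> t) (map (\<lambda>u. u t) (\<gamma>' # us)) + (\<Sum>i<length us. D (\<gamma> t) (map (\<lambda>u. u t) (us[i := d (us ! i)]))))) (at t)"
proof -
  let ?us = "\<lambda>s. map (\<lambda>u. u s) us"
  have ml: "bounded_multilinear k (D (\<gamma> t))" for k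
    by (rule jet_on_multilinear[OF D])
  have lin: "linear (\<lambda>v. D (\<gamma> t) (v # ?us s))" for s
    by (rule bounded_multilinear_linear_Cons[OF ml]) simp
  have cont: "(u \<longlongrightarrow> u t) (at t)" if "u \<in> set us" for u
    using has_vector_derivative_continuous[OF us[OF that]] by (simp add: isCont_def)
  have \<gamma>q: "((\<lambda>s. (\<gamma> s - \<gamma> t) /\<^sub>R (s - t)) \<longlongrightarrow> \<gamma>' t) (at t)"
    using \<gamma> by (simp add: has_vector_derivative_iff_quotient)
  have \<gamma>c: "(\<gamma> \<longlongrightarrow> \<gamma> t) (at t)"
    using has_vector_derivative_continuous[OF \<gamma>] by (simp add: isCont_def)
  have "((\<lambda>s. D (\<gamma> t) (((\<gamma> s - \<gamma> t) /\<^sub>R (s - t)) # ?us s)) \<longlongrightarrow> D (\<gamma> t) (\<gamma>' t # ?us t)) (at t)"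
  proof (rule bounded_multilinear_tendsto_Cons[where ul="\<lambda>u. u t", OF ml \<gamma>q])
    show "((\<lambda>s. D (\<gamma> t) (\<gamma>' t # ?us s)) \<longlongrightarrow> D (\<gamma> t) (\<gamma>' t # ?us t)) (at t)"
      by (rule bounded_multilinear_tendsto[where m="\<lambda>vs. D (\<gamma> t) (\<gamma>' t # vs)" and ul="\<lambda>u. u t",
            OF bounded_multilinear_Cons[OF ml] cont])
  qed (rule cont)
  then have 1: "((\<lambda>s. D (\<gamma> t) ((\<gamma> s - \<gamma> t) # ?us s)) has_vector_derivative D (\<gamma> t) (\<gamma>' t # ?us t)) (at t)"
    unfolding has_vector_derivative_iff_quotient
    using linear_0[OF lin] by (simp add: linear_scale[OF lin])
  have 2: "((\<lambda>s. D (\<gamma> t) (?us s)) has_vector_derivative (\<Sum>i<length us. D (\<gamma> t) (map (\<lambda>u. u t) (us[i := d (us ! i)])))) (at t)"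
    by (rule bounded_multilinear_has_vector_derivative[where d=d and t=t, OF ml]) (rule us)
  let ?r = "\<lambda>s. D (\<gamma> s) (?us s) - D (\<gamma> t) (?us s) - D (\<gamma> t) ((\<gamma> s - \<gamma> t) # ?us s)"
  let ?B = "norm (\<gamma>' t) * prod_list (map norm (?us t)) + 1"
  have "((\<lambda>s. norm ((\<gamma> s - \<gamma> t) /\<^sub>R (s - t)) * prod_list (map norm (?us s))) \<longlongrightarrow> norm (\<gamma>' t) * prod_list (map norm (?us t))) (at t)"
    by (intro tendsto_intros \<gamma>q tendsto_prod_list_map cont)
  then have bd: "\<forall>\<^sub>F s in at t. norm ((\<gamma> s - \<gamma> t) /\<^sub>R (s - t)) * prod_list (map norm (?us s)) < ?B"
    by (rule order_tendstoD) simp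
  have B: "?B > 0"
    using mult_nonneg_nonneg[OF norm_ge_zero prod_list_norm_nonneg] by (smt (verit))
  have "((\<lambda>s. (?r s - ?r t) /\<^sub>R (s - t)) \<longlongrightarrow> 0) (at t)"
  proof (rule tendstoI)
    fix e :: real assume e: "e > 0"
    have "\<forall>\<^sub>F y in nhds (\<gamma> t). \<forall>vs. length vs = length us \<longrightarrow>
          norm (D y vs - D (\<gamma> t) vs - D (\<gamma> t) ((y - \<gamma> t) # vs)) \<le> e / ?B * norm (y - \<gamma> t) * prod_list (map norm vs)"
      using e B by (intro jet_on_approx[OF D]) simp
    then have "\<forall>\<^sub>F s in at t. norm (?r s) \<le> e / ?B * norm (\<gamma> s - \<gamma> t) * prod_list (map norm (?us s))"
      by (rule eventually_mono[OF eventually_compose_filterlim[OF _ \<gamma>c]]) (erule allE, erule mp, simp)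
    then show "\<forall>\<^sub>F s in at t. dist ((?r s - ?r t) /\<^sub>R (s - t)) 0 < e"
      using bd eventually_neq_at_within[of t t]
    proof eventually_elim
      case (elim s)
      have "?r t = 0" using linear_0[OF lin] by simp
      then have "dist ((?r s - ?r t) /\<^sub>R (s - t)) 0 = norm (?r s) / \<bar>s - t\<bar>"
        by (simp add: divide_inverse)
      also have "\<dots> \<le> (e / ?B * norm (\<gamma> s - \<gamma> t) * prod_list (map norm (?us s))) / \<bar>s - t\<bar>"
        using elim by (intro divide_right_mono) auto
      also have "\<dots> = e / ?B * (norm ((\<gamma> s - \<gamma> t) /\<^sub>R (s - t)) * prod_list (map norm (?us s)))"
        by (simp add: divide_inverse)
      also have "\<dots> < e / ?B * ?B"
        using elim e B by (intro mult_strict_left_mono) auto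
      finally show ?case using B by simp
    qed
  qed
  then have 3: "(?r has_vector_derivative 0) (at t)"
    by (simp add: has_vector_derivative_iff_quotient)
  from has_vector_derivative_add[OF has_vector_derivative_add[OF 3 1] 2] show ?thesis
    by (simp add: algebra_simps)
qed

lemma linear_prod_list_middle: "linear (\<lambda>v::real. prod_list (us @ v # ws) *\<^sub>R x)"
  by (rule linearI) (auto simp: algebra_simps)

lemma norm_prod_list: "norm (prod_list vs :: real) = prod_list (map norm vs)"
  by (induction vs) (auto simp: abs_mult)

lemma smooth_on_real_iff:
  fixes f :: "real \<Rightarrow> 'b::real_normed_vector"
  shows "smooth_on I f \<longleftrightarrow> open I \<and>
    (\<exists>F. (\<forall>t\<in>I. F 0 t = f t) \<and> (\<forall>n. \<forall>t\<in>I. (F n has_vector_derivative F (Suc n) t) (at t)))"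
    (is "?L \<longleftrightarrow> open I \<and> ?R")
proof
  assume ?L
  then obtain D where "open I" and D: "jet_on I D" "\<And>t. t \<in> I \<Longrightarrow> D t [] = f t"
    by (rule smooth_onE) (use that in auto)
  have "((\<lambda>t. D t (replicate n 1)) has_vector_derivative D t (replicate (Suc n) 1)) (at t)" if "t \<in> I" for n t
  proof -
    have "linear (\<lambda>h. D t (h # replicate n 1))"
      by (rule bounded_multilinear_linear_Cons[OF jet_on_multilinear[OF D(1) that]]) simp
    then have "D t (h # replicate n 1) = h *\<^sub>R D t (replicate (Suc n) 1)" for h
      using linear_scale[of "\<lambda>h. D t (h # replicate n 1)" h 1] by simp
    then have "(\<lambda>h. D t (h # replicate n 1)) = (\<lambda>h. h *\<^sub>R D t (replicate (Suc n) 1))"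
      by (rule ext)
    with jet_on_has_derivative[OF D(1) that, of "replicate n 1"] show ?thesis
      unfolding has_vector_derivative_def by (simp only:)
  qed
  then have ?R
    by (intro exI[of _ "\<lambda>n t. D t (replicate n 1)"]) (simp add: D(2) del: replicate_Suc)
  then show "open I \<and> ?R" using \<open>open I\<close> by blast
next
  assume "open I \<and> ?R"
  then obtain F where I: "open I" and F0: "\<And>t. t \<in> I \<Longrightarrow> F 0 t = f t"
    and F: "\<And>n t. t \<in> I \<Longrightarrow> (F n has_vector_derivative F (Suc n) t) (at t)" by blast
  let ?D = "\<lambda>t vs. prod_list vs *\<^sub>R F (length vs) t"
  have "jet_on I ?D"
    unfolding jet_on_def
  proof (intro ballI allI conjI impI)
    fix t k assume t: "t \<in> I"
    show "bounded_multilinear k (?D t)"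
      unfolding bounded_multilinear_def
    proof (intro conjI allI impI exI)
      fix us ws :: "real list"
      show "linear (\<lambda>v. ?D t (us @ v # ws))"
        using linear_prod_list_middle[of us ws] by simp
    next
      fix vs :: "real list" assume "length vs = k"
      then show "norm (?D t vs) \<le> norm (F k t) * prod_list (map norm vs)"
        by (simp add: norm_prod_list flip: real_norm_def)
    qed
    fix e :: real assume "e > 0"
    have "(F k has_derivative (\<lambda>h. h *\<^sub>R F (Suc k) t)) (at t)"
      using F[OF t] by (simp add: has_vector_derivative_def)
    then obtain d where d: "d > 0" "\<And>s. norm (s - t) < d \<Longrightarrow> norm (F k s - F k t - (s - t) *\<^sub>R F (Suc k) t) \<le> e * norm (s - t)"
      using \<open>e > 0\<close> unfolding has_derivative_at_alt by blast
    have "norm (?D s vs - ?D t vs - ?D t ((s - t) # vs)) \<le> e * norm (s - t) * prod_list (map norm vs)"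
      if "norm (s - t) < d" "length vs = k" for s vs
    proof -
      have "?D s vs - ?D t vs - ?D t ((s - t) # vs) = prod_list vs *\<^sub>R (F k s - F k t - (s - t) *\<^sub>R F (Suc k) t)"
        using that by (simp add: algebra_simps)
      then have "norm (?D s vs - ?D t vs - ?D t ((s - t) # vs)) = prod_list (map norm vs) * norm (F k s - F k t - (s - t) *\<^sub>R F (Suc k) t)"
        by (simp add: norm_prod_list flip: real_norm_def)
      also have "\<dots> \<le> prod_list (map norm vs) * (e * norm (s - t))"
        using d(2)[OF that(1)] by (intro mult_left_mono prod_list_norm_nonneg)
      finally show ?thesis by (simp add: algebra_simps)
    qed
    then show "\<forall>\<^sub>F s in nhds t. \<forall>vs. length vs = k \<longrightarrow>
       norm (?D s vs - ?D t vs - ?D t ((s - t) # vs)) \<le> e * norm (s - t) * prod_list (map norm vs)"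
      unfolding eventually_nhds_metric using d(1) by (auto simp: dist_norm)
  qed
  then show ?L
    by (rule smooth_onI[OF I]) (simp add: F0)
qed

lemma smooth_on_realE:
  fixes f :: "real \<Rightarrow> 'b::real_normed_vector"
  assumes "smooth_on I f"
  obtains F where "open I" "\<And>t. t \<in> I \<Longrightarrow> F 0 t = f t"
    "\<And>n t. t \<in> I \<Longrightarrow> (F n has_vector_derivative F (Suc n) t) (at t)"
proof -
  from assms obtain F where "open I" "\<forall>t\<in>I. F 0 t = f t"
    "\<forall>n. \<forall>t\<in>I. (F n has_vector_derivative F (Suc n) t) (at t)"
    unfolding smooth_on_real_iff by (elim conjE exE)
  with that[of F] show thesis by simp
qed

lemma smooth_on_realI:
  fixes f :: "real \<Rightarrow> 'b::real_normed_vector"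
  assumes "open I" "\<And>t. t \<in> I \<Longrightarrow> F 0 t = f t"
    "\<And>n t. t \<in> I \<Longrightarrow> (F n has_vector_derivative F (Suc n) t) (at t)"
  shows "smooth_on I f"
  unfolding smooth_on_real_iff using assms by (intro conjI exI[of _ F]) simp_all

lemma smooth_on_derivative_closed:
  fixes f :: "real \<Rightarrow> 'b::real_normed_vector"
  assumes "open I" "f \<in> K"
    and step: "\<And>g. g \<in> K \<Longrightarrow> \<exists>g'\<in>K. \<forall>t\<in>I. (g has_vector_derivative g' t) (at t)"
  shows "smooth_on I f"
proof -
  obtain d where d: "\<And>g. g \<in> K \<Longrightarrow> d g \<in> K \<and> (\<forall>t\<in>I. (g has_vector_derivative d g t) (at t))"
    using step by metis
  have "(d ^^ n) f \<in> K" for n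
    using assms(2) d by (induction n) auto
  then show ?thesis
    by (intro smooth_on_realI[where F="\<lambda>n. (d ^^ n) f"] assms(1)) (use d in auto)
qed

lemma smooth_on_cong:
  fixes f g :: "'a::real_normed_vector \<Rightarrow> 'b::real_normed_vector"
  assumes "\<And>x. x \<in> S \<Longrightarrow> f x = g x"
  shows "smooth_on S f \<longleftrightarrow> smooth_on S g"
proof -
  have "smooth_on S g" if fg: "smooth_on S f" "\<And>x. x \<in> S \<Longrightarrow> f x = g x" for f g :: "'a \<Rightarrow> 'b"
  proof -
    obtain D where "open S" "jet_on S D" "\<And>x. x \<in> S \<Longrightarrow> D x [] = f x"
      using smooth_onE[OF fg(1)] by metis
    then show ?thesis
      by (intro smooth_onI[of _ D]) (simp_all add: fg(2))
  qed
  from this[of f g] this[of g f] show ?thesis using assms by auto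
qed

lemma smooth_on_subset:
  assumes "smooth_on S f" "open T" "T \<subseteq> S"
  shows "smooth_on T f"
proof -
  obtain D where "jet_on S D" "\<And>x. x \<in> S \<Longrightarrow> D x [] = f x"
    using smooth_onE[OF assms(1)] by metis
  moreover from this(1) have "jet_on T D"
    using assms(3) by (simp add: jet_on_def subset_iff)
  ultimately show ?thesis
    using assms(2,3) by (intro smooth_onI[of _ D]) auto
qed

lemma smooth_on_imp_continuous_on:
  assumes "smooth_on S f" shows "continuous_on S f"
proof -
  obtain D where S: "open S" and D: "jet_on S D" "\<And>t. t \<in> S \<Longrightarrow> D t [] = f t"
    using smooth_onE[OF assms] by metis
  have "continuous_on S (\<lambda>x. D x [])"
    by (rule continuous_at_imp_continuous_on)
      (metis D(1) jet_on_has_derivative has_derivative_continuous)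
  then show ?thesis using D(2) by (simp cong: continuous_on_cong)
qed

lemma smooth_on_locally:
  fixes f :: "real \<Rightarrow> 'b::real_normed_vector"
  assumes "\<And>t. t \<in> I \<Longrightarrow> \<exists>J. t \<in> J \<and> J \<subseteq> I \<and> smooth_on J f"
  shows "smooth_on I f"
proof -
  define F where "F n = ((\<lambda>g t. vector_derivative g (at t)) ^^ n) f" for n
  have *: "(F n has_vector_derivative F (Suc n) t) (at t)" if t: "t \<in> I" for n t
  proof -
    obtain J H where J: "t \<in> J" "open J" and H0: "\<And>s. s \<in> J \<Longrightarrow> H 0 s = f s"
      and H: "\<And>n s. s \<in> J \<Longrightarrow> (H n has_vector_derivative H (Suc n) s) (at s)"
      using assms[OF t] smooth_on_realE by metis
    have FH: "F k s = H k s" if "s \<in> J" for k s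
      using that
    proof (induction k arbitrary: s)
      case 0
      then show ?case using H0 by (simp add: F_def)
    next
      case (Suc k)
      have "(F k has_vector_derivative H (Suc k) s) (at s)"
        using has_vector_derivative_transform_within_open[OF H[OF Suc.prems] J(2) Suc.prems] Suc.IH by metis
      then show ?case by (simp add: F_def vector_derivative_at)
    qed
    show ?thesis
      using has_vector_derivative_transform_within_open[OF H[OF J(1)] J(2) J(1)] FH J(1) by metis
  qed
  have "open I"
    using assms smooth_on_open[where f=f] by (subst open_subopen) blast
  then show ?thesis
    by (rule smooth_on_realI[where F=F]) (use * in \<open>auto simp: F_def\<close>)
qed

lemma smooth_on_compose_curve:
  fixes \<gamma> :: "real \<Rightarrow> 'a::real_normed_vector" and f :: "'a \<Rightarrow> 'b::real_normed_vector"
  assumes f: "smooth_on S f" and \<gamma>: "smooth_on I \<gamma>" and sub: "\<gamma> ` I \<subseteq> S"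
  shows "smooth_on I (\<lambda>t. f (\<gamma> t))"
proof -
  obtain D where D: "jet_on S D" "\<And>x. x \<in> S \<Longrightarrow> D x [] = f x"
    using smooth_onE[OF f] by metis
  obtain \<Gamma> where I: "open I" and \<Gamma>0: "\<And>t. t \<in> I \<Longrightarrow> \<Gamma> 0 t = \<gamma> t"
    and \<Gamma>: "\<And>n t. t \<in> I \<Longrightarrow> (\<Gamma> n has_vector_derivative \<Gamma> (Suc n) t) (at t)"
    using smooth_on_realE[OF \<gamma>] by metis
  let ?term = "\<lambda>ns t. D (\<Gamma> 0 t) (map (\<lambda>u. u t) (map \<Gamma> ns))"
  define K where "K = range (\<lambda>nss t. \<Sum>ns\<leftarrow>nss. ?term ns t)"
  have der: "(?term ns has_vector_derivative
      ?term (1 # ns) t + (\<Sum>i<length ns. ?term (ns[i := Suc (ns ! i)]) t)) (at t)" if "t \<in> I" for ns t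
  proof -
    define d where "d = (\<lambda>u :: real \<Rightarrow> 'a. \<lambda>t. vector_derivative u (at t))"
    have d: "d (\<Gamma> n) t = \<Gamma> (Suc n) t" for n
      using \<Gamma>[OF that] by (simp add: d_def vector_derivative_at)
    have "(?term ns has_vector_derivative
      D (\<Gamma> 0 t) (map (\<lambda>u. u t) (\<Gamma> 1 # map \<Gamma> ns)) + (\<Sum>i<length (map \<Gamma> ns).
        D (\<Gamma> 0 t) (map (\<lambda>u. u t) ((map \<Gamma> ns)[i := d (map \<Gamma> ns ! i)])))) (at t)"
      using D(1) \<Gamma> that d sub \<Gamma>0 by (intro jet_on_curve_has_vector_derivative) auto
    moreover have "map (\<lambda>u. u t) ((map \<Gamma> ns)[i := d (map \<Gamma> ns ! i)]) = map (\<lambda>u. u t) (map \<Gamma> (ns[i := Suc (ns ! i)]))"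
      if "i < length ns" for i
      using that d by (simp add: map_update)
    ultimately show ?thesis by simp
  qed
  have "\<exists>g'\<in>K. \<forall>t\<in>I. (g has_vector_derivative g' t) (at t)" if gK: "g \<in> K" for g
  proof -
    obtain nss where g: "g = (\<lambda>t. \<Sum>ns\<leftarrow>nss. ?term ns t)"
      using gK unfolding K_def by (rule imageE)
    have "\<exists>mss. \<forall>t\<in>I. ((\<lambda>t. \<Sum>ns\<leftarrow>nss. ?term ns t) has_vector_derivative (\<Sum>ns\<leftarrow>mss. ?term ns t)) (at t)"
    proof (induction nss)
      case Nil
      show ?case by (rule exI[of _ "[]"]) simp
    next
      case (Cons ns nss)
      then obtain mss where mss: "\<And>t. t \<in> I \<Longrightarrow> ((\<lambda>t. \<Sum>ns\<leftarrow>nss. ?term ns t) has_vector_derivative (\<Sum>ns\<leftarrow>mss. ?term ns t)) (at t)"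
        by blast
      let ?new = "(1 # ns) # map (\<lambda>i. ns[i := Suc (ns ! i)]) [0..<length ns] @ mss"
      have "((\<lambda>t. ?term ns t + (\<Sum>ns\<leftarrow>nss. ?term ns t)) has_vector_derivative (\<Sum>ns\<leftarrow>?new. ?term ns t)) (at t)" if "t \<in> I" for t
        using has_vector_derivative_add[OF der[OF that] mss[OF that], of ns]
        by (simp add: o_def interv_sum_list_conv_sum_set_nat atLeast0LessThan add.assoc)
      then show ?case by (intro exI[of _ ?new]) simp
    qed
    then obtain mss where "\<forall>t\<in>I. (g has_vector_derivative (\<Sum>ns\<leftarrow>mss. ?term ns t)) (at t)"
      unfolding g by (rule exE)
    moreover have "(\<lambda>t. \<Sum>ns\<leftarrow>mss. ?term ns t) \<in> K"
      unfolding K_def by (rule image_eqI[of _ _ mss]) (rule refl, rule UNIV_I)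
    ultimately show ?thesis
      by (intro bexI[of _ "\<lambda>t. \<Sum>ns\<leftarrow>mss. ?term ns t"])
  qed
  moreover have "(\<lambda>t. ?term [] t) \<in> K"
    unfolding K_def by (rule image_eqI[of _ _ "[[]]"]) auto
  ultimately have "smooth_on I (?term [])"
    by (intro smooth_on_derivative_closed[OF I]) auto
  then show ?thesis
    using D(2) sub \<Gamma>0 by (subst smooth_on_cong[where g="?term []"]) auto
qed

inductive_set ode_terms :: "('a::real_normed_vector \<Rightarrow> 'a list \<Rightarrow> 'a) \<Rightarrow> (real \<Rightarrow> 'a) \<Rightarrow> (real \<Rightarrow> 'a) set"
  for D \<gamma> where
  jet: "\<forall>u\<in>set us. u \<in> ode_terms D \<gamma> \<Longrightarrow> (\<lambda>t. D (\<gamma> t) (map (\<lambda>u. u t) us)) \<in> ode_terms D \<gamma>"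
| zero: "(\<lambda>t. 0) \<in> ode_terms D \<gamma>"
| add: "f \<in> ode_terms D \<gamma> \<Longrightarrow> g \<in> ode_terms D \<gamma> \<Longrightarrow> (\<lambda>t. f t + g t) \<in> ode_terms D \<gamma>"

lemma ode_terms_sum:
  assumes "finite A" "\<And>i. i \<in> A \<Longrightarrow> f i \<in> ode_terms D \<gamma>"
  shows "(\<lambda>t. \<Sum>i\<in>A. f i t) \<in> ode_terms D \<gamma>"
  using assms by (induction A rule: finite_induct) (auto intro: ode_terms.zero ode_terms.add)

lemma smooth_on_integral_curve:
  fixes \<gamma> :: "real \<Rightarrow> 'a::real_normed_vector"
  assumes f: "smooth_on S f" and I: "open I" and sub: "\<gamma> ` I \<subseteq> S"
    and \<gamma>: "\<And>t. t \<in> I \<Longrightarrow> (\<gamma> has_vector_derivative f (\<gamma> t)) (at t)"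
  shows "smooth_on I \<gamma>"
proof -
  obtain D where D: "jet_on S D" "\<And>x. x \<in> S \<Longrightarrow> D x [] = f x"
    using smooth_onE[OF f] by metis
  define \<gamma>' where "\<gamma>' = (\<lambda>t. D (\<gamma> t) [])"
  have \<gamma>'_in: "\<gamma>' \<in> ode_terms D \<gamma>"
    using ode_terms.jet[of "[]"] by (simp add: \<gamma>'_def)
  have \<gamma>': "(\<gamma> has_vector_derivative \<gamma>' t) (at t)" if "t \<in> I" for t
    using \<gamma>[OF that] D(2) sub that by (auto simp: \<gamma>'_def)
  have step: "\<exists>g'\<in>ode_terms D \<gamma>. \<forall>t\<in>I. (g has_vector_derivative g' t) (at t)" if "g \<in> ode_terms D \<gamma>" for g
    using that
  proof induction
    case (jet us)
    then obtain d where d: "\<And>u. u \<in> set us \<Longrightarrow> d u \<in> ode_terms D \<gamma> \<and> (\<forall>t\<in>I. (u has_vector_derivative d u t) (at t))"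
      by metis
    let ?g' = "\<lambda>t. D (\<gamma> t) (map (\<lambda>u. u t) (\<gamma>' # us)) + (\<Sum>i<length us. D (\<gamma> t) (map (\<lambda>u. u t) (us[i := d (us ! i)])))"
    have "set (us[i := d (us ! i)]) \<subseteq> ode_terms D \<gamma>" if "i < length us" for i
      using set_update_subset_insert[of us i] jet d that by (meson insert_subset nth_mem order_trans subsetI)
    then have "?g' \<in> ode_terms D \<gamma>"
      using jet \<gamma>'_in by (intro ode_terms.add ode_terms_sum ode_terms.jet) auto
    moreover have "\<forall>t\<in>I. ((\<lambda>t. D (\<gamma> t) (map (\<lambda>u. u t) us)) has_vector_derivative ?g' t) (at t)"
      using D(1) sub \<gamma>' d by (intro ballI jet_on_curve_has_vector_derivative) auto
    ultimately show ?case by (intro bexI[of _ ?g'])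
  next
    case zero
    show ?case by (rule bexI[OF _ ode_terms.zero]) auto
  next
    case (add f g)
    then obtain f' g' where "f' \<in> ode_terms D \<gamma>" "g' \<in> ode_terms D \<gamma>"
      "\<forall>t\<in>I. (f has_vector_derivative f' t) (at t)" "\<forall>t\<in>I. (g has_vector_derivative g' t) (at t)"
      by blast
    then show ?case
      by (intro bexI[of _ "\<lambda>t. f' t + g' t"]) (auto intro: ode_terms.add has_vector_derivative_add)
  qed
  have "\<exists>g'\<in>insert \<gamma> (ode_terms D \<gamma>). \<forall>t\<in>I. (g has_vector_derivative g' t) (at t)"
    if "g \<in> insert \<gamma> (ode_terms D \<gamma>)" for g
    using that step \<gamma>' \<gamma>'_in by (metis insert_iff)
  then show ?thesis
    by (intro smooth_on_derivative_closed[OF I, of _ "insert \<gamma> (ode_terms D \<gamma>)"]) auto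
qed

lemma smooth_on_Pair_curve:
  fixes \<gamma> :: "real \<Rightarrow> 'a::real_normed_vector" and \<delta> :: "real \<Rightarrow> 'b::real_normed_vector"
  assumes "smooth_on I \<gamma>" "smooth_on I \<delta>"
  shows "smooth_on I (\<lambda>t. (\<gamma> t, \<delta> t))"
proof -
  obtain F where F: "open I" "\<And>t. t \<in> I \<Longrightarrow> F 0 t = \<gamma> t"
    "\<And>n t. t \<in> I \<Longrightarrow> (F n has_vector_derivative F (Suc n) t) (at t)"
    using smooth_on_realE[OF assms(1)] by metis
  obtain G where G: "\<And>t. t \<in> I \<Longrightarrow> G 0 t = \<delta> t"
    "\<And>n t. t \<in> I \<Longrightarrow> (G n has_vector_derivative G (Suc n) t) (at t)"
    using smooth_on_realE[OF assms(2)] by metis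
  show ?thesis
    by (rule smooth_on_realI[where F="\<lambda>n t. (F n t, G n t)"])
      (simp_all add: F G has_vector_derivative_Pair)
qed

lemma smooth_on_const: "open S \<Longrightarrow> smooth_on S (\<lambda>x::real. a)"
  by (rule smooth_on_realI[where F="\<lambda>n t. if n = 0 then a else 0"]) auto

text \<open>Both mixed derivatives approximate the same second difference of \<open>f\<close> over a small parallelogram.\<close>

lemma jet_on_second_difference:
  fixes D :: "'a::real_normed_vector \<Rightarrow> 'a list \<Rightarrow> 'b::real_normed_vector"
  assumes D: "jet_on S D" "x \<in> S" and S: "open S" and e: "e > 0"
  shows "\<exists>d>0. \<forall>h k. norm h + norm k < d \<longrightarrow>
    norm (D (x + h + k) [] - D (x + h) [] - D (x + k) [] + D x [] - D x [h, k])
      \<le> e * (norm h + norm k)^2"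
proof -
  obtain d1 where d1: "d1 > 0" "ball x d1 \<subseteq> S"
    using S D(2) openE by metis
  have inS: "x + u \<in> S" if "norm u < d1" for u
    using d1(2) that by (auto simp: subset_iff dist_norm)
  have "\<forall>\<^sub>F y in nhds x. \<forall>vs. length vs = 1 \<longrightarrow>
          norm (D y vs - D x vs - D x ((y - x) # vs)) \<le> e / 2 * norm (y - x) * prod_list (map norm vs)"
    using e by (intro jet_on_approx[OF D]) simp
  then obtain d2 where d2: "d2 > 0" and "\<And>y vs. dist y x < d2 \<Longrightarrow> length vs = 1 \<Longrightarrow>
          norm (D y vs - D x vs - D x ((y - x) # vs)) \<le> e / 2 * norm (y - x) * prod_list (map norm vs)"
    unfolding eventually_nhds_metric by auto
  from this(2)[of _ "[_]"] have approx: "norm (D y [v] - D x [v] - D x [y - x, v]) \<le> e / 2 * norm (y - x) * norm v"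
    if "norm (y - x) < d2" for y v
    using that by (simp add: dist_norm)
  have lin: "linear (\<lambda>u. D x [u, v])" for v
    using bounded_multilinear_linear_Cons[OF jet_on_multilinear[OF D, of "Suc 1"], of "[v]"] by simp
  have "norm (D (x + h + k) [] - D (x + h) [] - D (x + k) [] + D x [] - D x [h, k])
      \<le> e * (norm h + norm k)^2" if hk: "norm h + norm k < min d1 d2" for h k
  proof -
    let ?g = "\<lambda>t. D (x + h + t *\<^sub>R k) [] - D (x + t *\<^sub>R k) [] - t *\<^sub>R D x [h, k]"
    let ?g' = "\<lambda>t. D (x + h + t *\<^sub>R k) [k] - D (x + t *\<^sub>R k) [k] - D x [h, k]"
    have n: "norm (h + t *\<^sub>R k) \<le> norm h + norm k" "norm (t *\<^sub>R k) \<le> norm h + norm k" if "t \<in> {0..1}" for t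
      using that norm_triangle_ineq[of h "t *\<^sub>R k"] mult_right_mono[of t 1 "norm k"] norm_ge_zero[of h] norm_ge_zero[of k]
      by (simp_all del: norm_ge_zero)
    have der: "((\<lambda>t. D (y + t *\<^sub>R k) []) has_vector_derivative D (y + t *\<^sub>R k) [k]) (at t within {0..1})"
      if "y + t *\<^sub>R k \<in> S" for y t
    proof -
      have "((\<lambda>t. y + t *\<^sub>R k) has_vector_derivative k) (at t)"
        by (auto intro!: derivative_eq_intros)
      from jet_on_curve_has_vector_derivative[where us="[]" and \<gamma>'="\<lambda>_. k", OF D(1) that this]
      show ?thesis by (simp add: has_vector_derivative_at_within)
    qed
    have "x + h + t *\<^sub>R k \<in> S" "x + t *\<^sub>R k \<in> S" if "t \<in> {0..1}" for t
      using inS[of "h + t *\<^sub>R k"] inS[of "t *\<^sub>R k"] n[OF that] hk by (auto simp: add.assoc)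
    then have "(?g has_vector_derivative ?g' t) (at t within {0..1})" if "t \<in> {0..1}" for t
      using that by (intro has_vector_derivative_diff der) (auto intro!: derivative_eq_intros)
    then have deriv: "(?g has_derivative (\<lambda>s. s *\<^sub>R ?g' t)) (at t within {0..1})" if "t \<in> {0..1}" for t
      using that by (simp add: has_vector_derivative_def)
    have bound: "norm (?g' t) \<le> e * (norm h + norm k)^2" if t: "t \<in> {0..1}" for t
    proof -
      have a1: "norm (D (x + h + t *\<^sub>R k) [k] - D x [k] - D x [h + t *\<^sub>R k, k]) \<le> e / 2 * norm (h + t *\<^sub>R k) * norm k"
        using approx[of "x + h + t *\<^sub>R k" k] n[OF t] hk by (simp add: add.assoc)
      have a2: "norm (D (x + t *\<^sub>R k) [k] - D x [k] - D x [t *\<^sub>R k, k]) \<le> e / 2 * norm (t *\<^sub>R k) * norm k"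
        using approx[of "x + t *\<^sub>R k" k] n[OF t] hk by simp
      have "D x [h, k] = D x [h + t *\<^sub>R k, k] - D x [t *\<^sub>R k, k]"
        using linear_add[OF lin, of h "t *\<^sub>R k" k] by simp
      then have "?g' t = (D (x + h + t *\<^sub>R k) [k] - D x [k] - D x [h + t *\<^sub>R k, k])
          - (D (x + t *\<^sub>R k) [k] - D x [k] - D x [t *\<^sub>R k, k])"
        by simp
      also have "norm \<dots> \<le> e / 2 * norm (h + t *\<^sub>R k) * norm k + e / 2 * norm (t *\<^sub>R k) * norm k"
        by (rule order_trans[OF norm_triangle_ineq4 add_mono[OF a1 a2]])
      also have "\<dots> \<le> e / 2 * (norm h + norm k) * (norm h + norm k) + e / 2 * (norm h + norm k) * (norm h + norm k)"
        using n[OF t] e by (intro add_mono mult_mono) auto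
      finally show ?thesis by (simp add: power2_eq_square algebra_simps)
    qed
    have "norm (?g 1 - ?g 0) \<le> e * (norm h + norm k)^2 * norm (1 - 0 :: real)"
    proof (rule differentiable_bound[OF _ deriv])
      fix t :: real assume "t \<in> {0..1}"
      then show "onorm (\<lambda>s. s *\<^sub>R ?g' t) \<le> e * (norm h + norm k)^2"
        using bound by (simp add: onorm_scaleR_left onorm_id)
    qed auto
    then show ?thesis by (simp add: algebra_simps)
  qed
  then show ?thesis using d1(1) d2(1) by (intro exI[of _ "min d1 d2"]) simp
qed

lemma jet_on_symmetric:
  fixes D :: "'a::real_normed_vector \<Rightarrow> 'a list \<Rightarrow> 'b::real_normed_vector"
  assumes D: "jet_on S D" "x \<in> S" and S: "open S"
  shows "D x [h, k] = D x [k, h]"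
proof -
  have scale: "D x [t *\<^sub>R u, t *\<^sub>R v] = t^2 *\<^sub>R D x [u, v]" for t u v
    using linear_scale[OF bounded_multilinear_linear[OF jet_on_multilinear[OF D, of 2], of "[]" "[t *\<^sub>R v]"], of t u]
      linear_scale[OF bounded_multilinear_linear[OF jet_on_multilinear[OF D, of 2], of "[u]" "[]"], of t v]
    by (simp add: power2_eq_square)
  let ?N = "(norm h + norm k)^2"
  have "norm (D x [h, k] - D x [k, h]) \<le> 0 + e" if e: "e > 0" for e
  proof -
    define e' where "e' = e / (2 * ?N + 1)"
    have N: "2 * ?N + 1 > 0" by (simp add: add_nonneg_pos)
    then have "e' > 0" using e by (simp add: e'_def)
    from jet_on_second_difference[OF D S this]
    obtain d where "d > 0" and d: "\<And>h k. norm h + norm k < d \<Longrightarrow>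
      norm (D (x + h + k) [] - D (x + h) [] - D (x + k) [] + D x [] - D x [h, k]) \<le> e' * (norm h + norm k)^2"
      by blast
    define t where "t = d / (2 * (norm h + norm k + 1))"
    have pos: "norm h + norm k + 1 > 0" by (simp add: add_nonneg_pos)
    have t: "t > 0" using \<open>d > 0\<close> pos by (simp add: t_def)
    have "t * (norm h + norm k) < t * (norm h + norm k + 1)"
      using t by simp
    also have "\<dots> = d / 2"
      using pos by (simp add: t_def field_simps)
    also have "\<dots> < d" using \<open>d > 0\<close> by simp
    finally have small: "norm (t *\<^sub>R h) + norm (t *\<^sub>R k) < d"
      using t by (simp add: algebra_simps)
    let ?a = "D (x + t *\<^sub>R h + t *\<^sub>R k) [] - D (x + t *\<^sub>R h) [] - D (x + t *\<^sub>R k) [] + D x []"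
    have 1: "norm (?a - D x [t *\<^sub>R h, t *\<^sub>R k]) \<le> e' * (norm (t *\<^sub>R h) + norm (t *\<^sub>R k))^2"
      by (rule d[OF small])
    have 2: "norm (?a - D x [t *\<^sub>R k, t *\<^sub>R h]) \<le> e' * (norm (t *\<^sub>R h) + norm (t *\<^sub>R k))^2"
      using d[of "t *\<^sub>R k" "t *\<^sub>R h"] small by (simp add: algebra_simps)
    have "t^2 * norm (D x [h, k] - D x [k, h]) = norm (D x [t *\<^sub>R h, t *\<^sub>R k] - D x [t *\<^sub>R k, t *\<^sub>R h])"
      by (simp add: scale flip: scaleR_diff_right)
    also have "\<dots> \<le> 2 * (e' * (norm (t *\<^sub>R h) + norm (t *\<^sub>R k))^2)"
      using norm_triangle_le_diff[OF add_mono[OF 2 1]] by simp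
    also have "norm (t *\<^sub>R h) + norm (t *\<^sub>R k) = t * (norm h + norm k)"
      using t by (simp add: algebra_simps)
    finally have "t^2 * norm (D x [h, k] - D x [k, h]) \<le> t^2 * (2 * e' * ?N)"
      by (simp only: power_mult_distrib mult_ac)
    then have "norm (D x [h, k] - D x [k, h]) \<le> 2 * e' * ?N"
      using t by simp
    also have "\<dots> = e * (2 * ?N / (2 * ?N + 1))"
      by (simp add: e'_def)
    also have "\<dots> \<le> e * 1"
      using e N by (intro mult_left_mono) (auto simp: divide_le_eq)
    finally show ?thesis by simp
  qed
  then have "norm (D x [h, k] - D x [k, h]) \<le> 0"
    by (rule field_le_epsilon)
  then show ?thesis by simp
qed

section \<open>Picard iteration\<close>

lemma has_vector_derivative_norm_bound:
  fixes f :: "real \<Rightarrow> 'a::real_normed_vector"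
  assumes "convex J" "\<And>t. t \<in> J \<Longrightarrow> (f has_vector_derivative f' t) (at t within J)"
    "\<And>t. t \<in> J \<Longrightarrow> norm (f' t) \<le> B" "s \<in> J" "t \<in> J"
  shows "norm (f t - f s) \<le> B * \<bar>t - s\<bar>"
proof -
  have "norm (f t - f s) \<le> B * norm (t - s)"
  proof (rule differentiable_bound[OF assms(1) _ _ assms(5,4)])
    show "(f has_derivative (\<lambda>x. x *\<^sub>R f' u)) (at u within J)" if "u \<in> J" for u
      using assms(2)[OF that] by (simp add: has_vector_derivative_def)
    show "onorm (\<lambda>x. x *\<^sub>R f' u) \<le> B" if "u \<in> J" for u
      using assms(3)[OF that] by (simp add: onorm_scaleR_left onorm_id)
  qed
  then show ?thesis by simp
qed

lemma continuous_antiderivative: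
  fixes f :: "real \<Rightarrow> 'a::banach"
  assumes "continuous_on {-1..1} f"
  shows "\<exists>F. F 0 = 0 \<and> (\<forall>t\<in>{-1..1}. (F has_vector_derivative f t) (at t within {-1..1}))"
proof (intro exI conjI ballI)
  show "((\<lambda>t. integral {-1..t} f - integral {-1..0} f) has_vector_derivative f t) (at t within {-1..1})"
    if "t \<in> {-1..1}" for t
    using has_vector_derivative_diff[OF integral_has_vector_derivative[OF assms that] has_vector_derivative_const]
    by simp
qed simp

lemma ode_unique:
  fixes L :: "'a::real_normed_vector \<Rightarrow> 'a \<Rightarrow> 'a"
  assumes lip: "\<And>x y. x \<in> S \<Longrightarrow> y \<in> S \<Longrightarrow> norm (L x v - L y v) \<le> K * norm (x - y) * norm v"
    and K: "K \<ge> 0" "K * norm v < 1" and ab: "-1 \<le> a" "a \<le> 0" "0 \<le> b" "b \<le> 1"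
    and init: "c1 0 = c2 0"
    and c1: "\<And>t. t \<in> {a..b} \<Longrightarrow> c1 t \<in> S \<and> (c1 has_vector_derivative L (c1 t) v) (at t within {a..b})"
    and c2: "\<And>t. t \<in> {a..b} \<Longrightarrow> c2 t \<in> S \<and> (c2 has_vector_derivative L (c2 t) v) (at t within {a..b})"
    and t: "t \<in> {a..b}"
  shows "c1 t = c2 t"
proof -
  let ?f = "\<lambda>t. c1 t - c2 t"
  have der: "(?f has_vector_derivative L (c1 t) v - L (c2 t) v) (at t within {a..b})" if "t \<in> {a..b}" for t
    using c1[OF that] c2[OF that] by (intro has_vector_derivative_diff) auto
  then have "continuous_on {a..b} ?f"
    by (metis continuous_on_eq_continuous_within has_vector_derivative_continuous)
  then have "continuous_on {a..b} (\<lambda>t. norm (?f t))"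
    by (rule continuous_on_norm)
  then obtain m where m: "m \<in> {a..b}" "\<And>t. t \<in> {a..b} \<Longrightarrow> norm (?f t) \<le> norm (?f m)"
    using continuous_attains_sup[of "{a..b}" "\<lambda>t. norm (?f t)"] t by fastforce
  have "norm (?f m - ?f 0) \<le> (K * norm v * norm (?f m)) * \<bar>m - 0\<bar>"
  proof (rule has_vector_derivative_norm_bound[OF _ der])
    fix t assume t: "t \<in> {a..b}"
    have "norm (L (c1 t) v - L (c2 t) v) \<le> K * norm (?f t) * norm v"
      using lip c1[OF t] c2[OF t] by simp
    also have "\<dots> \<le> K * norm (?f m) * norm v"
      using m(2)[OF t] K by (intro mult_right_mono mult_left_mono) auto
    finally show "norm (L (c1 t) v - L (c2 t) v) \<le> K * norm v * norm (?f m)"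
      by (simp add: mult_ac)
  qed (use m(1) ab in auto)
  also have "\<dots> \<le> (K * norm v * norm (?f m)) * 1"
    using m(1) ab K by (intro mult_left_mono) auto
  finally have "norm (?f m) \<le> K * norm v * norm (?f m)"
    using init by simp
  then have "(1 - K * norm v) * norm (?f m) \<le> 0"
    by (simp add: algebra_simps)
  then have "norm (?f m) \<le> 0"
    using K by (simp add: mult_le_0_iff)
  with m(2)[OF t] show ?thesis by simp
qed

text \<open>
  The parameter \<open>\<theta>\<close> interpolates between prescribing the velocity (\<open>\<theta> = 0\<close>, so \<open>v = y\<close>) and
  prescribing the end point (\<open>\<theta> = 1\<close>, so \<open>c 1 = p + y\<close>). Writing \<open>c t = p + t v + d t\<close>, the
  unknown of the fixed point problem is \<open>d\<close> alone.
\<close>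

lemma picard:
  fixes L :: "'a::banach \<Rightarrow> 'a \<Rightarrow> 'a"
  assumes lin: "\<And>x. x \<in> cball p r \<Longrightarrow> linear (L x)"
    and lip: "\<And>x y v. x \<in> cball p r \<Longrightarrow> y \<in> cball p r \<Longrightarrow> norm (L x v - L y v) \<le> K * norm (x - y) * norm v"
    and Lp: "\<And>v. L p v = v"
    and K: "K \<ge> 0" and \<eta>: "\<eta> > 0" "3 * \<eta> \<le> r" "14 * K * \<eta> \<le> 1"
    and y: "norm y \<le> \<eta>" and \<theta>: "0 \<le> \<theta>" "\<theta> \<le> 1"
  shows "\<exists>v c. norm v \<le> 2 * \<eta> \<and> c 0 = p \<and> y = v + \<theta> *\<^sub>R (c 1 - p - v) \<and>
    (\<forall>t\<in>{-1..1}. c t \<in> cball p (3 * \<eta>) \<and> (c has_vector_derivative L (c t) v) (at t within {-1..1}))"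
proof -
  define X where "X = cball (0 :: real \<Rightarrow>\<^sub>C 'a) \<eta>"
  define v where "v d = y - \<theta> *\<^sub>R apply_bcontfun d 1" for d :: "real \<Rightarrow>\<^sub>C 'a"
  define x where "x d t = p + t *\<^sub>R v d + apply_bcontfun d t" for d :: "real \<Rightarrow>\<^sub>C 'a" and t
  define f where "f d t = L (x d t) (v d) - v d" for d t
  have dX: "norm (apply_bcontfun d t) \<le> \<eta>" if "d \<in> X" for d t
    using norm_bounded[of d t] that by (simp add: X_def)
  have v: "norm (v d) \<le> 2 * \<eta>" if "d \<in> X" for d
  proof -
    have "\<theta> * norm (apply_bcontfun d 1) \<le> 1 * \<eta>"
      using dX[OF that] \<theta> \<eta> by (intro mult_mono) auto
    then show ?thesis
      unfolding v_def using y \<theta> by (intro norm_triangle_le_diff) auto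
  qed
  have xp: "norm (x d t - p) \<le> 3 * \<eta>" if "d \<in> X" "t \<in> {-1..1}" for d t
  proof -
    have "\<bar>t\<bar> * norm (v d) \<le> 1 * (2 * \<eta>)"
      using v[OF that(1)] that(2) \<eta> by (intro mult_mono) auto
    then show ?thesis
      using dX[OF that(1), of t] norm_triangle_ineq[of "t *\<^sub>R v d" "apply_bcontfun d t"]
      by (simp add: x_def add.assoc)
  qed
  then have xr: "x d t \<in> cball p r" if "d \<in> X" "t \<in> {-1..1}" for d t
    using xp[OF that] \<eta> by (simp add: dist_norm norm_minus_commute)
  have pr: "p \<in> cball p r" using \<eta> by simp
  have near: "norm (L z w - w) \<le> 3 * K * \<eta> * norm w" if "norm (z - p) \<le> 3 * \<eta>" for z w
  proof -
    have "norm (L z w - L p w) \<le> K * norm (z - p) * norm w"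
      using that \<eta> by (intro lip pr) (simp add: dist_norm norm_minus_commute)
    also have "\<dots> \<le> K * (3 * \<eta>) * norm w"
      using that K by (intro mult_right_mono mult_left_mono) auto
    finally show ?thesis by (simp add: Lp mult_ac)
  qed
  have fb: "norm (f d t) \<le> \<eta>" if "d \<in> X" "t \<in> {-1..1}" for d t
  proof -
    have "norm (f d t) \<le> 3 * K * \<eta> * (2 * \<eta>)"
      unfolding f_def using near[OF xp[OF that], of "v d"] v[OF that(1)] K \<eta>
      by (elim order_trans) (intro mult_left_mono, auto)
    also have "\<dots> = (6 * K * \<eta>) * \<eta>" by simp
    also have "\<dots> \<le> 1 * \<eta>"
    proof (rule mult_right_mono)
      have "0 \<le> K * \<eta>" using K \<eta> by simp
      then show "6 * K * \<eta> \<le> 1" using \<eta>(3) by linarith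
    qed (use \<eta> in simp)
    finally show ?thesis by simp
  qed
  have flip: "norm (f d t - f d' t) \<le> 1 / 2 * dist d d'" if "d \<in> X" "d' \<in> X" "t \<in> {-1..1}" for d d' t
  proof -
    let ?\<Delta> = "dist d d'"
    have D: "norm (apply_bcontfun d s - apply_bcontfun d' s) \<le> ?\<Delta>" for s
      using dist_bounded[of d s d'] by (simp add: dist_norm)
    have v\<Delta>: "norm (v d - v d') \<le> ?\<Delta>"
    proof -
      have "v d - v d' = \<theta> *\<^sub>R (apply_bcontfun d' 1 - apply_bcontfun d 1)"
        by (simp add: v_def algebra_simps)
      then have "norm (v d - v d') = \<theta> * norm (apply_bcontfun d 1 - apply_bcontfun d' 1)"
        using \<theta> by (simp add: norm_minus_commute)
      also have "\<dots> \<le> 1 * ?\<Delta>" using \<theta> D by (intro mult_mono) auto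
      finally show ?thesis by simp
    qed
    have x\<Delta>: "norm (x d t - x d' t) \<le> 2 * ?\<Delta>"
    proof -
      have "x d t - x d' t = t *\<^sub>R (v d - v d') + (apply_bcontfun d t - apply_bcontfun d' t)"
        by (simp add: x_def algebra_simps)
      moreover have "\<bar>t\<bar> * norm (v d - v d') \<le> 1 * ?\<Delta>"
        using v\<Delta> that(3) by (intro mult_mono) auto
      ultimately show ?thesis
        using D[of t] norm_triangle_ineq[of "t *\<^sub>R (v d - v d')" "apply_bcontfun d t - apply_bcontfun d' t"]
        by simp
    qed
    have "f d t - f d' t = (L (x d t) (v d) - L (x d' t) (v d)) + (L (x d' t) (v d - v d') - (v d - v d'))"
      using linear_diff[OF lin[OF xr[OF that(2,3)]], of "v d" "v d'"] by (simp add: f_def)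
    also have "norm \<dots> \<le> K * norm (x d t - x d' t) * norm (v d) + 3 * K * \<eta> * norm (v d - v d')"
      by (intro norm_triangle_mono lip xr near xp that)
    also have "\<dots> \<le> K * (2 * ?\<Delta>) * (2 * \<eta>) + 3 * K * \<eta> * ?\<Delta>"
      using x\<Delta> v\<Delta> v[OF that(1)] K \<eta> by (intro add_mono mult_mono) auto
    also have "\<dots> = (7 * K * \<eta>) * ?\<Delta>" by simp
    also have "\<dots> \<le> 1 / 2 * ?\<Delta>"
      using \<eta>(3) by (intro mult_right_mono) auto
    finally show ?thesis .
  qed
  have fcont: "continuous_on {-1..1} (f d)" if d: "d \<in> X" for d
  proof -
    have "continuous_on (cball p r) (\<lambda>z. L z (v d))"
    proof (rule continuous_onI)
      fix z e assume z: "z \<in> cball p r" and e: "e > (0 :: real)"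
      let ?C = "K * norm (v d) + 1"
      have C: "?C > 0" using K by (simp add: add_nonneg_pos)
      have "dist (L z' (v d)) (L z (v d)) < e" if "z' \<in> cball p r" "dist z' z < e / ?C" for z'
      proof -
        have "norm (L z' (v d) - L z (v d)) \<le> K * norm (z' - z) * norm (v d)"
          by (rule lip[OF that(1) z])
        also have "\<dots> \<le> norm (z' - z) * ?C"
          by (simp add: algebra_simps)
        also have "\<dots> < e"
          using that(2) C by (simp add: dist_norm pos_less_divide_eq)
        finally show ?thesis by (simp add: dist_norm)
      qed
      then show "\<exists>\<delta>>0. \<forall>z'\<in>cball p r. dist z' z < \<delta> \<longrightarrow> dist (L z' (v d)) (L z (v d)) \<le> e"
        using e C by (intro exI[of _ "e / ?C"]) (auto intro: less_imp_le)
    qed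
    moreover have "continuous_on {-1..1} (x d)"
      unfolding x_def by (intro continuous_intros continuous_on_apply_bcontfun)
    ultimately have "continuous_on {-1..1} (\<lambda>t. L (x d t) (v d))"
      by (rule continuous_on_compose2) (use xr[OF d] in auto)
    then show ?thesis unfolding f_def by (intro continuous_intros)
  qed
  define F where "F d = (SOME F. F 0 = 0 \<and> (\<forall>t\<in>{-1..1}. (F has_vector_derivative f d t) (at t within {-1..1})))" for d
  have F: "F d 0 = 0" "\<And>t. t \<in> {-1..1} \<Longrightarrow> (F d has_vector_derivative f d t) (at t within {-1..1})" if "d \<in> X" for d
    using someI_ex[OF continuous_antiderivative[OF fcont[OF that]]] unfolding F_def by auto
  define cl where "cl t = max (-1) (min 1 t)" for t :: real
  have cl: "cl t \<in> {-1..1}" "t \<in> {-1..1} \<Longrightarrow> cl t = t" for t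
    by (auto simp: cl_def)
  define \<Phi> where "\<Phi> d = Bcontfun (\<lambda>t. F d (cl t))" for d
  have Fb: "norm (F d t) \<le> \<eta>" if d: "d \<in> X" and t: "t \<in> {-1..1}" for d t
  proof -
    have "norm (F d t - F d 0) \<le> \<eta> * \<bar>t - 0\<bar>"
      by (rule has_vector_derivative_norm_bound[OF _ F(2)[OF d] fb[OF d]]) (use t in auto)
    also have "\<dots> \<le> \<eta> * 1" using t \<eta> by (intro mult_left_mono) auto
    finally show ?thesis using F(1)[OF d] by simp
  qed
  have \<Phi>: "apply_bcontfun (\<Phi> d) = (\<lambda>t. F d (cl t))" if d: "d \<in> X" for d
  proof -
    have "continuous_on {-1..1} (F d)"
      using F(2)[OF d] by (metis continuous_on_eq_continuous_within has_vector_derivative_continuous)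
    then have "continuous_on UNIV (\<lambda>t. F d (cl t))"
      by (rule continuous_on_compose2) (use cl in \<open>auto simp: cl_def intro!: continuous_intros\<close>)
    then show ?thesis
      unfolding \<Phi>_def using Fb[OF d cl(1)] by (intro Bcontfun_inverse bcontfun_normI)
  qed
  have "\<exists>!d. d \<in> X \<and> \<Phi> d = d"
  proof (rule Banach_fix)
    show "complete X" by (simp add: X_def complete_eq_closed)
    show "X \<noteq> {}" using \<eta> by (simp add: X_def)
    show "0 \<le> (1/2 :: real)" "1/2 < (1 :: real)" by auto
    show "\<Phi> ` X \<subseteq> X"
    proof
      fix z assume "z \<in> \<Phi> ` X"
      then obtain d where d: "d \<in> X" "z = \<Phi> d" by blast
      then have "norm z \<le> \<eta>" using Fb[OF d(1) cl(1)] \<Phi>[OF d(1)] by (intro norm_bound) simp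
      then show "z \<in> X" by (simp add: X_def)
    qed
    show "dist (\<Phi> d) (\<Phi> d') \<le> 1/2 * dist d d'" if d: "d \<in> X" "d' \<in> X" for d d'
    proof (rule dist_bound)
      fix t
      let ?g = "\<lambda>t. F d t - F d' t"
      have "norm (?g (cl t) - ?g 0) \<le> (1/2 * dist d d') * \<bar>cl t - 0\<bar>"
      proof (rule has_vector_derivative_norm_bound[where J="{-1..1}" and f'="\<lambda>t. f d t - f d' t"])
        show "(?g has_vector_derivative f d s - f d' s) (at s within {-1..1})" if "s \<in> {-1..1}" for s
          by (intro has_vector_derivative_diff F that d)
      qed (use flip[OF d] cl in auto)
      also have "\<dots> \<le> (1/2 * dist d d') * 1"
        using cl[of t] by (intro mult_left_mono) auto
      finally show "dist (apply_bcontfun (\<Phi> d) t) (apply_bcontfun (\<Phi> d') t) \<le> 1/2 * dist d d'"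
        using d by (simp add: \<Phi> F dist_norm)
    qed
  qed
  then obtain d where d: "d \<in> X" "\<Phi> d = d" by blast
  have dF: "apply_bcontfun d t = F d t" if "t \<in> {-1..1}" for t
    using \<Phi>[OF d(1)] d(2) cl(2)[OF that] by metis
  have "(x d has_vector_derivative L (x d t) (v d)) (at t within {-1..1})" if t: "t \<in> {-1..1}" for t
  proof -
    have "((\<lambda>t. p + t *\<^sub>R v d + F d t) has_vector_derivative v d + f d t) (at t within {-1..1})"
      by (auto intro!: derivative_eq_intros F t d)
    then have "((\<lambda>t. p + t *\<^sub>R v d + F d t) has_vector_derivative L (x d t) (v d)) (at t within {-1..1})"
      by (simp add: f_def)
    then show ?thesis
      by (rule has_vector_derivative_transform[OF t, rotated]) (simp add: x_def dF)
  qed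
  moreover have "x d 0 = p" "y = v d + \<theta> *\<^sub>R (x d 1 - p - v d)"
    using F(1)[OF d(1)] dF[of 0] by (simp_all add: x_def v_def)
  moreover have "x d t \<in> cball p (3 * \<eta>)" if "t \<in> {-1..1}" for t
    using xp[OF d(1) that] by (simp add: dist_norm norm_minus_commute)
  ultimately show ?thesis using v[OF d(1)] by (intro exI[of _ "v d"] exI[of _ "x d"]) auto
qed

section \<open>A connected additive subgroup of the plane without uncountable closed sets\<close>

global_interpretation rat_vector: vector_space "\<lambda>(q::rat) (x::'a::real_vector). of_rat q *\<^sub>R x"
  defines rat_span = rat_vector.span
  by standard (simp_all add: scaleR_add_right scaleR_add_left of_rat_add of_rat_mult)

lemma rat_span_finite_subset:
  assumes "x \<in> rat_span B"
  obtains F where "finite F" "F \<subseteq> B" "x \<in> rat_span F"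
proof -
  have "\<exists>F. finite F \<and> F \<subseteq> B \<and> x \<in> rat_span F"
    using assms unfolding rat_vector.span_explicit
    by (fastforce)
  then show thesis using that by blast
qed

lemma countable_rat_span:
  assumes "countable B"
  shows "countable (rat_span B)"
proof -
  have fin: "countable (rat_span F)" if "finite F" for F :: "'a set"
    using that
  proof (induction F rule: finite_induct)
    case empty
    show ?case by simp
  next
    case (insert a F)
    have "rat_span (insert a F) \<subseteq> (\<lambda>(q, y). of_rat q *\<^sub>R a + y) ` (UNIV \<times> rat_span F)"
    proof
      fix x assume "x \<in> rat_span (insert a F)"
      then obtain q where "x - of_rat q *\<^sub>R a \<in> rat_span F"
        by (auto simp: rat_vector.span_insert)
      then show "x \<in> (\<lambda>(q, y). of_rat q *\<^sub>R a + y) ` (UNIV \<times> rat_span F)"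
        by (intro image_eqI[of _ _ "(q, x - of_rat q *\<^sub>R a)"]) auto
    qed
    moreover have "countable ((\<lambda>(q, y). of_rat q *\<^sub>R a + y) ` ((UNIV :: rat set) \<times> rat_span F))"
      using insert.IH by (intro countable_image countable_SIGMA) auto
    ultimately show ?case by (rule countable_subset)
  qed
  have "rat_span B \<subseteq> (\<Union>F\<in>{F. finite F \<and> F \<subseteq> B}. rat_span F)"
  proof
    fix x assume "x \<in> rat_span B"
    then obtain F where "finite F" "F \<subseteq> B" "x \<in> rat_span F"
      by (rule rat_span_finite_subset)
    then show "x \<in> (\<Union>F\<in>{F. finite F \<and> F \<subseteq> B}. rat_span F)" by auto
  qed
  moreover have "countable {F. finite F \<and> F \<subseteq> B}"
    using countable_Collect_finite_subset[OF assms] by simp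
  then have "countable (\<Union>F\<in>{F. finite F \<and> F \<subseteq> B}. rat_span F)"
    using fin by (intro countable_UN) auto
  ultimately show ?thesis by (rule countable_subset)
qed

lemma closed_sets_lepoll_nat_sets:
  "\<exists>f :: 'a::second_countable_topology set \<Rightarrow> nat set. inj_on f {K. closed K}"
proof -
  obtain B :: "'a set set" where B: "countable B" "topological_basis B"
    using ex_countable_basis by blast
  obtain g :: "'a set \<Rightarrow> nat" where g: "inj_on g B"
    using B(1) unfolding countable_def by (rule exE)
  let ?f = "\<lambda>K. g ` {U \<in> B. U \<subseteq> - K}"
  have "inj_on ?f {K. closed K}"
  proof (rule inj_onI)
    fix K K' :: "'a set" assume K: "K \<in> {K. closed K}" "K' \<in> {K. closed K}" and eq: "?f K = ?f K'"
    then have sub: "{U \<in> B. U \<subseteq> - K} = {U \<in> B. U \<subseteq> - K'}"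
      using g by (subst (asm) inj_on_image_eq_iff[of g B]) auto
    have union: "- C = \<Union>{U \<in> B. U \<subseteq> - C}" if "closed C" for C :: "'a set"
      using topological_basisE[OF B(2), of "- C"] that by (blast intro: open_Compl)
    show "K = K'" using union[of K] union[of K'] K sub by auto
  qed
  then show ?thesis by blast
qed

context
  includes cardinal_syntax
begin

text \<open>The continuum hypothesis enters only through this well-order with countable initial segments.\<close>

lemma continuum_hypothesis_well_order:
  fixes S :: "'a::second_countable_topology set set"
  assumes CH: continuum_hypothesis and S: "\<And>K. K \<in> S \<Longrightarrow> closed K"
  shows "\<exists>r. Well_order r \<and> Field r = S \<and> (\<forall>K\<in>S. countable (underS r K))"
proof -
  obtain f :: "'a set \<Rightarrow> nat set" where "inj_on f {K. closed K}"
    using closed_sets_lepoll_nat_sets by blast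
  then have "inj_on f S" using S by (auto intro: inj_on_subset)
  then have "|S| \<le>o |UNIV :: nat set set|"
    by (intro card_of_ordLeqI) auto
  also have "|UNIV :: nat set set| =o BNF_Cardinal_Arithmetic.cexp BNF_Cardinal_Arithmetic.ctwo natLeq"
    unfolding BNF_Cardinal_Arithmetic.cexp_def BNF_Cardinal_Arithmetic.ctwo_def Field_card_of Field_natLeq
    using card_of_Pow_Func[of "UNIV :: nat set"] by simp
  also have "BNF_Cardinal_Arithmetic.cexp BNF_Cardinal_Arithmetic.ctwo natLeq =o cardSuc natLeq"
    using CH unfolding continuum_hypothesis_def by (rule ordIso_symmetric)
  finally have S: "|S| \<le>o cardSuc natLeq" .
  have "countable (underS (card_of S) K)" if "K \<in> S" for K
  proof -
    have "|underS (card_of S) K| <o |S|"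
      using that by (intro card_of_underS) (auto simp: card_of_Card_order Field_card_of card_of_card_order_on)
    then have "|underS (card_of S) K| <o cardSuc natLeq"
      using S by (rule ordLess_ordLeq_trans)
    then have "|underS (card_of S) K| \<le>o natLeq"
      by (simp add: cardSuc_ordLeq_ordLess natLeq_Card_order card_of_Card_order)
    then have "|underS (card_of S) K| \<le>o |UNIV :: nat set|"
      using ordIso_symmetric[OF card_of_nat] by (rule ordLeq_ordIso_trans)
    then obtain g :: "'a set \<Rightarrow> nat" where "inj_on g (underS (card_of S) K)"
      unfolding card_of_ordLeq[symmetric] by auto
    then show ?thesis by (rule countableI')
  qed
  then show ?thesis
    by (intro exI[of _ "|S|"]) (simp add: card_of_well_order_on Field_card_of)
qed

end

lemma bernstein_rat_subspace:
  fixes \<Lambda> :: "'a::{real_normed_vector, second_countable_topology} set"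
  assumes CH: continuum_hypothesis and \<Lambda>: "countable \<Lambda>"
  shows "\<exists>X. (\<forall>K. closed K \<longrightarrow> uncountable K \<longrightarrow> (\<exists>x\<in>K \<inter> X. x \<notin> \<Lambda>)) \<and>
    (\<forall>K. closed K \<longrightarrow> uncountable K \<longrightarrow> (\<exists>y\<in>K. y \<notin> rat_span (X \<union> \<Lambda>)))"
proof -
  define S where "S = {K :: 'a set. closed K \<and> uncountable K}"
  obtain r where r: "Well_order r" "Field r = S" "\<And>K. K \<in> S \<Longrightarrow> countable (underS r K)"
    using continuum_hypothesis_well_order[OF CH, of S] by (auto simp: S_def)
  have tot: "K = M \<or> K \<in> underS r M \<or> M \<in> underS r K" if "K \<in> S" "M \<in> S" for K M
    using that r(1,2) unfolding order_on_defs total_on_def underS_def by auto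
  have trans: "underS r K \<subseteq> underS r M" if "K \<in> underS r M" for K M
    using that r(1) unfolding order_on_defs underS_def trans_def antisym_def by blast
  define old where "old f K = \<Lambda> \<union> fst ` f ` underS r K \<union> snd ` f ` underS r K" for f :: "'a set \<Rightarrow> 'a \<times> 'a" and K
  define P where "P f K z \<longleftrightarrow> (K \<in> S \<longrightarrow> fst z \<in> K \<and> snd z \<in> K \<and>
      fst z \<notin> rat_span (old f K) \<and> snd z \<notin> rat_span (insert (fst z) (old f K)))" for f K z
  have "\<exists>f. \<forall>K. P f K (f K)"
  proof (rule dependent_wf_choice[of "r - Id"])
    show "wf (r - Id)" using r(1) by (simp add: well_order_on_def)
    show "P f K z = P g K z" if "\<And>M. (M, K) \<in> r - Id \<Longrightarrow> f M = g M" for f g K z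
    proof -
      have "f ` underS r K = g ` underS r K"
        using that by (intro image_cong) (auto simp: underS_def)
      then show ?thesis by (simp add: P_def old_def)
    qed
    show "\<exists>z. P f K z" for f K
    proof (cases "K \<in> S")
      case True
      have c: "countable (old f K)"
        using r(3)[OF True] \<Lambda> by (simp add: old_def)
      have pick: "\<exists>x\<in>K. x \<notin> rat_span C" if "countable C" for C
      proof -
        have "\<not> K \<subseteq> rat_span C"
          using True countable_rat_span[OF that] countable_subset by (auto simp: S_def)
        then show ?thesis by blast
      qed
      obtain x where x: "x \<in> K" "x \<notin> rat_span (old f K)"
        using pick[OF c] by blast
      obtain y where "y \<in> K" "y \<notin> rat_span (insert x (old f K))"
        using pick[of "insert x (old f K)"] c by auto
      with x show ?thesis by (intro exI[of _ "(x, y)"]) (simp add: P_def)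
    qed (simp add: P_def)
  qed
  then obtain f where f: "\<And>K. P f K (f K)" by blast
  define a b where "a K = fst (f K)" and "b K = snd (f K)" for K
  have ab: "a K \<in> K" "b K \<in> K" "a K \<notin> rat_span (\<Lambda> \<union> a ` underS r K \<union> b ` underS r K)"
    "b K \<notin> rat_span (insert (a K) (\<Lambda> \<union> a ` underS r K \<union> b ` underS r K))" if "K \<in> S" for K
    using f[of K] that by (auto simp: P_def old_def a_def b_def image_image)
  have notin: "b K \<notin> rat_span (a ` S \<union> \<Lambda>)" if K: "K \<in> S" for K
  proof
    assume "b K \<in> rat_span (a ` S \<union> \<Lambda>)"
    then obtain F where F: "finite F" "F \<subseteq> a ` S \<union> \<Lambda>" "b K \<in> rat_span F"
      by (rule rat_span_finite_subset)
    have low: "b K \<notin> rat_span (a ` insert K (underS r K) \<union> \<Lambda>)"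
    proof -
      have "a ` insert K (underS r K) \<union> \<Lambda> \<subseteq> insert (a K) (\<Lambda> \<union> a ` underS r K \<union> b ` underS r K)"
        by auto
      from rat_vector.span_mono[OF this] ab(4)[OF K] show ?thesis
        by blast
    qed
    have "b K \<notin> rat_span (a ` M \<union> \<Lambda>)" if "finite M" "M \<subseteq> S" for M
      using that
    proof (induction "card M" arbitrary: M)
      case 0
      then have "a ` M \<union> \<Lambda> \<subseteq> a ` insert K (underS r K) \<union> \<Lambda>" by auto
      from rat_vector.span_mono[OF this] low show ?case by blast
    next
      case (Suc n)
      show ?case
      proof (cases "M \<subseteq> insert K (underS r K)")
        case True
        then have "a ` M \<union> \<Lambda> \<subseteq> a ` insert K (underS r K) \<union> \<Lambda>" by auto
        from rat_vector.span_mono[OF this] low show ?thesis by blast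
      next
        case False
        have "M \<noteq> {}" using False by auto
        obtain m where m: "m \<in> M" "\<And>M'. M' \<in> M \<Longrightarrow> M' = m \<or> M' \<in> underS r m"
        proof -
          have "\<exists>m\<in>M. \<forall>M'\<in>M. M' = m \<or> M' \<in> underS r m"
            using Suc.prems(1) \<open>M \<noteq> {}\<close> Suc.prems(2)
          proof (induction M rule: finite_ne_induct)
            case (singleton x)
            then show ?case by simp
          next
            case (insert x N)
            then obtain m where m: "m \<in> N" "\<forall>M'\<in>N. M' = m \<or> M' \<in> underS r m" by auto
            have "x = m \<or> x \<in> underS r m \<or> m \<in> underS r x"
              using tot insert.prems m(1) by auto
            then show ?case using m trans by (metis insert_iff subsetD)
          qed
          then show thesis using that by blast
        qed
        have mS: "m \<in> S" using m(1) Suc.prems by auto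
        have Km: "K \<in> underS r m"
        proof -
          obtain M' where "M' \<in> M" "M' \<noteq> K" "M' \<notin> underS r K" using False by auto
          then have "K \<in> underS r M'" using tot[OF K, of M'] Suc.prems by auto
          then show ?thesis using m(2)[OF \<open>M' \<in> M\<close>] trans by blast
        qed
        let ?M = "M - {m}"
        have M: "a ` M \<union> \<Lambda> = insert (a m) (a ` ?M \<union> \<Lambda>)" using m(1) by auto
        have "b K \<notin> rat_span (a ` ?M \<union> \<Lambda>)"
          using Suc m(1) by (intro Suc.hyps(1)) auto
        moreover have False if "b K \<in> rat_span (insert (a m) (a ` ?M \<union> \<Lambda>))" "b K \<notin> rat_span (a ` ?M \<union> \<Lambda>)"
        proof -
          have "a m \<in> rat_span (insert (b K) (a ` ?M \<union> \<Lambda>))"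
            using that by (rule rat_vector.in_span_insert)
          moreover have "insert (b K) (a ` ?M \<union> \<Lambda>) \<subseteq> \<Lambda> \<union> a ` underS r m \<union> b ` underS r m"
            using m(2) Km by auto
          ultimately show False
            using ab(3)[OF mS] rat_vector.span_mono by blast
        qed
        ultimately show ?thesis unfolding M by blast
      qed
    qed
    moreover have "F - \<Lambda> \<subseteq> a ` S" using F(2) by auto
    then obtain M where "finite M" "M \<subseteq> S" "F - \<Lambda> = a ` M"
      using finite_subset_image[of "F - \<Lambda>" a S] F(1) by auto
    moreover have "F \<subseteq> a ` M \<union> \<Lambda>" using \<open>F - \<Lambda> = a ` M\<close> by auto
    ultimately show False
      using F(3) rat_vector.span_mono[of F "a ` M \<union> \<Lambda>"] by blast
  qed
  have "\<exists>x\<in>K \<inter> a ` S. x \<notin> \<Lambda>" "\<exists>y\<in>K. y \<notin> rat_span (a ` S \<union> \<Lambda>)"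
    if "closed K" "uncountable K" for K :: "'a set"
  proof -
    have K: "K \<in> S" using that by (simp add: S_def)
    have "a K \<notin> \<Lambda>"
    proof
      assume "a K \<in> \<Lambda>"
      then have "a K \<in> rat_span (\<Lambda> \<union> a ` underS r K \<union> b ` underS r K)"
        by (intro rat_vector.span_base) simp
      with ab(3)[OF K] show False by simp
    qed
    then show "\<exists>x\<in>K \<inter> a ` S. x \<notin> \<Lambda>" using ab(1)[OF K] K by blast
    show "\<exists>y\<in>K. y \<notin> rat_span (a ` S \<union> \<Lambda>)" using ab(2)[OF K] notin[OF K] by blast
  qed
  then show ?thesis
    by (intro exI[of _ "a ` S"] conjI allI impI)
qed

lemma connected_if_meets_uncountable_closed:
  fixes H :: "'a::euclidean_space set"
  assumes dim: "2 \<le> DIM('a)" and H: "\<And>K. closed K \<Longrightarrow> uncountable K \<Longrightarrow> K \<inter> H \<noteq> {}"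
  shows "connected H"
proof (rule ccontr)
  assume "\<not> connected H"
  then obtain U V where UV: "open U" "open V" "H \<subseteq> U \<union> V" "U \<inter> V \<inter> H = {}" "U \<inter> H \<noteq> {}" "V \<inter> H \<noteq> {}"
    unfolding connected_def by blast
  have disj: "U \<inter> V = {}"
  proof (rule ccontr)
    assume "U \<inter> V \<noteq> {}"
    then obtain x e where e: "e > 0" "cball x e \<subseteq> U \<inter> V"
      using UV(1,2) by (metis open_Int open_contains_cball ex_in_conv)
    have "uncountable (cball x e)" using e(1) by (simp add: uncountable_cball)
    from H[OF closed_cball this] e(2) UV(4) show False by blast
  qed
  have "closed (- (U \<union> V))" using UV by auto
  then have "countable (- (U \<union> V))"
    using H[of "- (U \<union> V)"] UV(3) by blast
  then have "connected (- (- (U \<union> V)))"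
    using path_connected_complement_countable[OF dim] path_connected_imp_connected by blast
  then have "connected (U \<union> V)" by simp
  then show False
    using UV disj unfolding connected_def by blast
qed

section \<open>Smooth curves in a Banach-Lie group\<close>

context banach_lie_group
begin

lemma continuous_map_mult:
  assumes "continuous_map X T f" "continuous_map X T g"
  shows "continuous_map X T (\<lambda>x. f x \<otimes> g x)"
proof -
  have "continuous_map X (prod_topology T T) (\<lambda>x. (f x, g x))"
    using assms by (simp add: continuous_map_pairedI)
  moreover have "continuous_map (prod_topology T T) T (\<lambda>(x, y). x \<otimes> y)"
    using smooth_mult by (simp add: smooth_map_def)
  ultimately have "continuous_map X T ((\<lambda>(x, y). x \<otimes> y) \<circ> (\<lambda>x. (f x, g x)))"
    by (rule continuous_map_compose)
  then show ?thesis by (simp add: o_def)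
qed

lemma continuous_map_inv:
  assumes "continuous_map X T f"
  shows "continuous_map X T (\<lambda>x. inv (f x))"
proof -
  have "continuous_map T T (\<lambda>x. inv x)"
    using smooth_inv by (simp add: smooth_map_def)
  from continuous_map_compose[OF assms this] show ?thesis by (simp add: o_def)
qed

lemma chart_openin: "(U, \<phi>) \<in> A \<Longrightarrow> openin T U"
  and chart_image_open: "(U, \<phi>) \<in> A \<Longrightarrow> open (\<phi> ` U)"
  and chart_homeomorphic: "(U, \<phi>) \<in> A \<Longrightarrow> homeomorphic_map (subtopology T U) (top_of_set (\<phi> ` U)) \<phi>"
  and chart_transition: "(U, \<phi>) \<in> A \<Longrightarrow> (V, \<psi>) \<in> A \<Longrightarrow> smooth_on (\<phi> ` (U \<inter> V)) (\<psi> \<circ> inv_into U \<phi>)"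
  using atlas unfolding banach_atlas_def by fastforce+

lemma chart_subset: "(U, \<phi>) \<in> A \<Longrightarrow> U \<subseteq> carrier G"
  using chart_openin openin_subset topspace_eq by blast

lemma chart_ex:
  assumes "g \<in> carrier G"
  obtains U \<phi> where "(U, \<phi>) \<in> A" "g \<in> U"
proof -
  have "g \<in> (\<Union>(U, \<phi>)\<in>A. U)"
    using assms atlas topspace_eq unfolding banach_atlas_def by simp
  then show thesis using that by auto
qed

lemma chart_inj: "(U, \<phi>) \<in> A \<Longrightarrow> inj_on \<phi> U"
  using homeomorphic_imp_injective_map[OF chart_homeomorphic] chart_subset topspace_eq
  by (metis inf.absorb_iff2 topspace_subtopology)

lemma chart_continuous: "(U, \<phi>) \<in> A \<Longrightarrow> continuous_map (subtopology T U) euclidean \<phi>"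
  using homeomorphic_imp_continuous_map[OF chart_homeomorphic] continuous_map_in_subtopology by blast

lemma chart_inverse_continuous:
  assumes "(U, \<phi>) \<in> A"
  shows "continuous_map (top_of_set (\<phi> ` U)) T (inv_into U \<phi>)"
proof -
  from chart_homeomorphic[OF assms] obtain g
    where g: "homeomorphic_maps (subtopology T U) (top_of_set (\<phi> ` U)) \<phi> g"
    unfolding homeomorphic_map_maps by blast
  then have "continuous_map (top_of_set (\<phi> ` U)) T g"
    unfolding homeomorphic_maps_def using continuous_map_in_subtopology by blast
  moreover have "g x = inv_into U \<phi> x" if x: "x \<in> \<phi> ` U" for x
  proof -
    obtain u where "u \<in> U" "x = \<phi> u" using x by blast
    then show ?thesis
      using g chart_inj[OF assms] chart_subset[OF assms] topspace_eq
      unfolding homeomorphic_maps_def by (simp add: Int_absorb1 inv_into_f_f)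
  qed
  ultimately show ?thesis
    by (auto intro: continuous_map_eq)
qed

definition smooth_curve :: "real set \<Rightarrow> (real \<Rightarrow> 'g) \<Rightarrow> bool"
  where "smooth_curve I \<gamma> \<longleftrightarrow> smooth_map (top_of_set I) {(I, \<lambda>t. t)} T A \<gamma>"

lemma smooth_curve_continuous: "smooth_curve I \<gamma> \<Longrightarrow> continuous_map (top_of_set I) T \<gamma>"
  by (simp add: smooth_curve_def smooth_map_def)

lemma inv_into_ident: "t \<in> I \<Longrightarrow> inv_into I (\<lambda>t. t) t = t"
  by (simp add: inv_into_f_eq)

lemma smooth_on_inv_into_ident:
  "J \<subseteq> I \<Longrightarrow> smooth_on J (f \<circ> inv_into I (\<lambda>t. t)) \<longleftrightarrow> smooth_on J f"
  for J :: "real set"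
  by (rule smooth_on_cong) (auto simp: inv_into_ident subset_iff)

lemma smooth_curve_in_chart:
  assumes "smooth_curve I \<gamma>" "(V, \<psi>) \<in> A"
  shows "smooth_on {t \<in> I. \<gamma> t \<in> V} (\<lambda>t. \<psi> (\<gamma> t))"
proof -
  have "smooth_on {t \<in> I. \<gamma> t \<in> V} (\<psi> \<circ> \<gamma> \<circ> inv_into I (\<lambda>t. t))"
    using assms unfolding smooth_curve_def smooth_map_def by auto
  then show ?thesis
    by (subst (asm) smooth_on_inv_into_ident) (auto simp: o_def)
qed

lemma smooth_curveI:
  assumes I: "open I"
    and local: "\<And>t. t \<in> I \<Longrightarrow> \<exists>V \<psi> J. (V, \<psi>) \<in> A \<and> t \<in> J \<and> J \<subseteq> I \<and> \<gamma> ` J \<subseteq> V \<and> smooth_on J (\<lambda>t. \<psi> (\<gamma> t))"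
  shows "smooth_curve I \<gamma>"
proof -
  have "continuous_map (top_of_set I) T \<gamma>"
    unfolding continuous_map_def
  proof (intro conjI allI impI)
    show "\<gamma> \<in> topspace (top_of_set I) \<rightarrow> topspace T"
      using local chart_subset topspace_eq by fastforce
    fix W assume W: "openin T W"
    have "\<exists>J. open J \<and> t \<in> J \<and> J \<subseteq> {x \<in> I. \<gamma> x \<in> W}" if tW: "t \<in> {x \<in> I. \<gamma> x \<in> W}" for t
    proof -
      have "t \<in> I" using tW by simp
      from local[OF this] obtain V \<psi> J where V: "(V, \<psi>) \<in> A" "t \<in> J" "J \<subseteq> I" "\<gamma> ` J \<subseteq> V"
        and sm: "smooth_on J (\<lambda>t. \<psi> (\<gamma> t))" by (elim exE conjE)
      have J: "open J" by (rule smooth_on_open[OF sm])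
      have "openin (top_of_set (\<psi> ` V)) {x \<in> \<psi> ` V. inv_into V \<psi> x \<in> W}"
        using openin_continuous_map_preimage[OF chart_inverse_continuous[OF V(1)] W] by simp
      then have op: "open {x \<in> \<psi> ` V. inv_into V \<psi> x \<in> W}"
        using chart_image_open[OF V(1)] openin_open_trans by blast
      have "open (J \<inter> (\<lambda>t. \<psi> (\<gamma> t)) -` {x \<in> \<psi> ` V. inv_into V \<psi> x \<in> W})"
        using continuous_open_preimage[OF smooth_on_imp_continuous_on[OF sm] J op] .
      moreover have "J \<inter> (\<lambda>t. \<psi> (\<gamma> t)) -` {x \<in> \<psi> ` V. inv_into V \<psi> x \<in> W} = {x \<in> J. \<gamma> x \<in> W}"
      proof (rule Set.set_eqI)
        fix x
        have "\<psi> (\<gamma> x) \<in> \<psi> ` V" "inv_into V \<psi> (\<psi> (\<gamma> x)) = \<gamma> x" if "x \<in> J"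
          using that V(4) chart_inj[OF V(1)] by (auto simp: inv_into_f_f)
        then show "x \<in> J \<inter> (\<lambda>t. \<psi> (\<gamma> t)) -` {x \<in> \<psi> ` V. inv_into V \<psi> x \<in> W} \<longleftrightarrow> x \<in> {x \<in> J. \<gamma> x \<in> W}"
          by (cases "x \<in> J") simp_all
      qed
      ultimately show ?thesis using V(2,3) tW by (intro exI[of _ "{x \<in> J. \<gamma> x \<in> W}"]) auto
    qed
    then have "open {x \<in> I. \<gamma> x \<in> W}"
      by (subst open_subopen) blast
    then show "openin (top_of_set I) {x \<in> topspace (top_of_set I). \<gamma> x \<in> W}"
      by (simp add: openin_open_eq[OF I])
  qed
  moreover have "smooth_on {t \<in> I. \<gamma> t \<in> V'} (\<lambda>t. \<psi>' (\<gamma> t))" if V': "(V', \<psi>') \<in> A" for V' \<psi>'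
  proof (rule smooth_on_locally)
    fix t assume t: "t \<in> {t \<in> I. \<gamma> t \<in> V'}"
    then have "t \<in> I" by simp
    from local[OF this] obtain V \<psi> J where V: "(V, \<psi>) \<in> A" "t \<in> J" "J \<subseteq> I" "\<gamma> ` J \<subseteq> V"
      and sm: "smooth_on J (\<lambda>t. \<psi> (\<gamma> t))" by (elim exE conjE)
    let ?J = "{s \<in> J. \<gamma> s \<in> V'}"
    have J: "open J" by (rule smooth_on_open[OF sm])
    have tr: "smooth_on (\<psi> ` (V \<inter> V')) (\<psi>' \<circ> inv_into V \<psi>)"
      by (rule chart_transition[OF V(1) V'])
    have Jeq: "?J = J \<inter> (\<lambda>t. \<psi> (\<gamma> t)) -` (\<psi> ` (V \<inter> V'))"
      using V(4) chart_inj[OF V(1)] by (auto simp: image_subset_iff inj_on_def)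
    have "open ?J"
      unfolding Jeq
      by (rule continuous_open_preimage[OF smooth_on_imp_continuous_on[OF sm] J smooth_on_open[OF tr]])
    then have "smooth_on ?J (\<lambda>t. \<psi> (\<gamma> t))"
      by (rule smooth_on_subset[OF sm]) auto
    then have "smooth_on ?J (\<lambda>t. (\<psi>' \<circ> inv_into V \<psi>) (\<psi> (\<gamma> t)))"
      by (rule smooth_on_compose_curve[OF tr]) (use V(4) in auto)
    moreover have "(\<psi>' \<circ> inv_into V \<psi>) (\<psi> (\<gamma> s)) = \<psi>' (\<gamma> s)" if "s \<in> ?J" for s
      using that V(4) chart_inj[OF V(1)] by (auto simp: inv_into_f_f)
    ultimately have "smooth_on ?J (\<lambda>t. \<psi>' (\<gamma> t))"
      by (simp only: smooth_on_cong[of ?J "\<lambda>t. (\<psi>' \<circ> inv_into V \<psi>) (\<psi> (\<gamma> t))" "\<lambda>t. \<psi>' (\<gamma> t)"])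
    then show "\<exists>J. t \<in> J \<and> J \<subseteq> {t \<in> I. \<gamma> t \<in> V'} \<and> smooth_on J (\<lambda>t. \<psi>' (\<gamma> t))"
      using V(2,3) t by (intro exI[of _ ?J]) auto
  qed
  then have "smooth_on ((\<lambda>t. t) ` {t \<in> I. \<gamma> t \<in> V'}) (\<psi>' \<circ> \<gamma> \<circ> inv_into I (\<lambda>t. t))" if "(V', \<psi>') \<in> A" for V' \<psi>'
    using that by (subst smooth_on_inv_into_ident) (auto simp: o_def)
  ultimately show ?thesis
    unfolding smooth_curve_def smooth_map_def by blast
qed

lemma smooth_curve_const:
  assumes "open I" "g \<in> carrier G"
  shows "smooth_curve I (\<lambda>t. g)"
proof -
  obtain V \<psi> where "(V, \<psi>) \<in> A" "g \<in> V" using chart_ex[OF assms(2)] .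
  then show ?thesis
    using assms(1) smooth_on_const[OF assms(1)]
    by (intro smooth_curveI exI[of _ V] exI[of _ \<psi>] exI[of _ I]) auto
qed

lemma open_preimage_curve:
  assumes "open I" "continuous_map (top_of_set I) T \<gamma>" "openin T V"
  shows "open {t \<in> I. \<gamma> t \<in> V}"
  using openin_continuous_map_preimage[OF assms(2,3)] assms(1) openin_open_trans by simp

lemma smooth_curve_mult:
  assumes I: "open I" and \<gamma>: "smooth_curve I \<gamma>" and \<delta>: "smooth_curve I \<delta>"
  shows "smooth_curve I (\<lambda>t. \<gamma> t \<otimes> \<delta> t)"
proof (rule smooth_curveI[OF I])
  fix t assume t: "t \<in> I"
  have c: "continuous_map (top_of_set I) T \<gamma>" "continuous_map (top_of_set I) T \<delta>"
    using \<gamma> \<delta> by (auto intro: smooth_curve_continuous)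
  note cm = continuous_map_mult[OF c]
  have car: "\<gamma> s \<in> carrier G" "\<delta> s \<in> carrier G" if "s \<in> I" for s
    using that c topspace_eq by (auto simp: continuous_map_def)
  obtain U \<phi> where U: "(U, \<phi>) \<in> A" "\<gamma> t \<in> U" using chart_ex[OF car(1)[OF t]] .
  obtain V \<psi> where V: "(V, \<psi>) \<in> A" "\<delta> t \<in> V" using chart_ex[OF car(2)[OF t]] .
  obtain W \<theta> where W: "(W, \<theta>) \<in> A" "\<gamma> t \<otimes> \<delta> t \<in> W"
    using chart_ex[of "\<gamma> t \<otimes> \<delta> t"] car[OF t] by blast
  let ?J = "{s \<in> I. \<gamma> s \<in> U} \<inter> {s \<in> I. \<delta> s \<in> V} \<inter> {s \<in> I. \<gamma> s \<otimes> \<delta> s \<in> W}"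
  have J: "open ?J"
    by (intro open_Int open_preimage_curve[OF I] c cm chart_openin[OF U(1)] chart_openin[OF V(1)] chart_openin[OF W(1)])
  have "(U \<times> V, map_prod \<phi> \<psi>) \<in> prod_atlas A A"
    using U(1) V(1) unfolding prod_atlas_def by force
  then have sm: "smooth_on (map_prod \<phi> \<psi> ` {z \<in> U \<times> V. (\<lambda>(x, y). x \<otimes> y) z \<in> W})
      (\<theta> \<circ> (\<lambda>(x, y). x \<otimes> y) \<circ> inv_into (U \<times> V) (map_prod \<phi> \<psi>))"
    using smooth_mult W(1) unfolding smooth_map_def by fast
  have pair: "smooth_on ?J (\<lambda>s. (\<phi> (\<gamma> s), \<psi> (\<delta> s)))"
    using smooth_curve_in_chart[OF \<gamma> U(1)] smooth_curve_in_chart[OF \<delta> V(1)] J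
    by (intro smooth_on_Pair_curve) (auto intro: smooth_on_subset)
  have inj: "inj_on (map_prod \<phi> \<psi>) (U \<times> V)"
    using chart_inj[OF U(1)] chart_inj[OF V(1)] by (rule map_prod_inj_on)
  have "smooth_on ?J (\<lambda>s. (\<theta> \<circ> (\<lambda>(x, y). x \<otimes> y) \<circ> inv_into (U \<times> V) (map_prod \<phi> \<psi>)) (\<phi> (\<gamma> s), \<psi> (\<delta> s)))"
    by (rule smooth_on_compose_curve[OF sm pair]) force
  moreover have "(\<theta> \<circ> (\<lambda>(x, y). x \<otimes> y) \<circ> inv_into (U \<times> V) (map_prod \<phi> \<psi>)) (\<phi> (\<gamma> s), \<psi> (\<delta> s)) = \<theta> (\<gamma> s \<otimes> \<delta> s)"
    if "s \<in> ?J" for s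
    using that inv_into_f_f[OF inj, of "(\<gamma> s, \<delta> s)"] by simp
  ultimately have "smooth_on ?J (\<lambda>s. \<theta> (\<gamma> s \<otimes> \<delta> s))"
    by (simp only: smooth_on_cong[of ?J "\<lambda>s. (\<theta> \<circ> (\<lambda>(x, y). x \<otimes> y) \<circ> inv_into (U \<times> V) (map_prod \<phi> \<psi>)) (\<phi> (\<gamma> s), \<psi> (\<delta> s))" "\<lambda>s. \<theta> (\<gamma> s \<otimes> \<delta> s)"])
  then show "\<exists>V \<psi> J. (V, \<psi>) \<in> A \<and> t \<in> J \<and> J \<subseteq> I \<and> (\<lambda>t. \<gamma> t \<otimes> \<delta> t) ` J \<subseteq> V \<and> smooth_on J (\<lambda>s. \<psi> (\<gamma> s \<otimes> \<delta> s))"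
    using t U V W by (intro exI[of _ W] exI[of _ \<theta>] exI[of _ ?J]) auto
qed

lemma smooth_curve_inv:
  assumes I: "open I" and \<gamma>: "smooth_curve I \<gamma>"
  shows "smooth_curve I (\<lambda>t. inv (\<gamma> t))"
proof (rule smooth_curveI[OF I])
  fix t assume t: "t \<in> I"
  have c: "continuous_map (top_of_set I) T \<gamma>"
    using \<gamma> by (rule smooth_curve_continuous)
  note ci = continuous_map_inv[OF c]
  have car: "\<gamma> s \<in> carrier G" if "s \<in> I" for s
    using that c topspace_eq by (auto simp: continuous_map_def)
  obtain U \<phi> where U: "(U, \<phi>) \<in> A" "\<gamma> t \<in> U" using chart_ex[OF car[OF t]] .
  obtain W \<theta> where W: "(W, \<theta>) \<in> A" "inv (\<gamma> t) \<in> W"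
    using chart_ex[of "inv (\<gamma> t)"] car[OF t] by blast
  let ?J = "{s \<in> I. \<gamma> s \<in> U} \<inter> {s \<in> I. inv (\<gamma> s) \<in> W}"
  have J: "open ?J"
    by (intro open_Int open_preimage_curve[OF I] c ci chart_openin[OF U(1)] chart_openin[OF W(1)])
  have sm: "smooth_on (\<phi> ` {z \<in> U. inv z \<in> W}) (\<theta> \<circ> (\<lambda>x. inv x) \<circ> inv_into U \<phi>)"
    using smooth_inv U(1) W(1) unfolding smooth_map_def by fast
  have "smooth_on ?J (\<lambda>s. \<phi> (\<gamma> s))"
    using smooth_curve_in_chart[OF \<gamma> U(1)] J by (auto intro: smooth_on_subset)
  then have "smooth_on ?J (\<lambda>s. (\<theta> \<circ> (\<lambda>x. inv x) \<circ> inv_into U \<phi>) (\<phi> (\<gamma> s)))"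
    by (rule smooth_on_compose_curve[OF sm]) auto
  moreover have "(\<theta> \<circ> (\<lambda>x. inv x) \<circ> inv_into U \<phi>) (\<phi> (\<gamma> s)) = \<theta> (inv (\<gamma> s))" if "s \<in> ?J" for s
    using that inv_into_f_f[OF chart_inj[OF U(1)], of "\<gamma> s"] by simp
  ultimately have "smooth_on ?J (\<lambda>s. \<theta> (inv (\<gamma> s)))"
    by (simp only: smooth_on_cong[of ?J "\<lambda>s. (\<theta> \<circ> (\<lambda>x. inv x) \<circ> inv_into U \<phi>) (\<phi> (\<gamma> s))" "\<lambda>s. \<theta> (inv (\<gamma> s))"])
  then show "\<exists>V \<psi> J. (V, \<psi>) \<in> A \<and> t \<in> J \<and> J \<subseteq> I \<and> (\<lambda>t. inv (\<gamma> t)) ` J \<subseteq> V \<and> smooth_on J (\<lambda>s. \<psi> (inv (\<gamma> s)))"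
    using t U W by (intro exI[of _ W] exI[of _ \<theta>] exI[of _ ?J]) auto
qed

lemma openin_left_translate:
  assumes "openin T W" "g \<in> carrier G"
  shows "openin T {x \<in> carrier G. inv g \<otimes> x \<in> W}"
proof -
  have "continuous_map T T (\<lambda>x. inv g \<otimes> x)"
    using assms(2) topspace_eq by (intro continuous_map_mult) (auto simp: continuous_map_const)
  from openin_continuous_map_preimage[OF this assms(1)] show ?thesis by (simp add: topspace_eq)
qed

lemma connected_open_subgroup:
  assumes conn: "connected_space T" and S: "subgroup S G" and W: "openin T W" "\<one> \<in> W" "W \<subseteq> S"
  shows "S = carrier G"
proof -
  interpret S: subgroup S G by (rule S)
  have cosets: "\<exists>V. openin T V \<and> g \<in> V \<and> (\<forall>x\<in>V. x \<in> S \<longleftrightarrow> g \<in> S)" if g: "g \<in> carrier G" for g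
  proof (intro exI conjI ballI)
    fix x assume x: "x \<in> {x \<in> carrier G. inv g \<otimes> x \<in> W}"
    then have s: "inv g \<otimes> x \<in> S" "x \<in> carrier G" using W(3) by auto
    have "x = g \<otimes> (inv g \<otimes> x)" using g s(2) by (simp add: m_assoc[symmetric])
    moreover have "g = x \<otimes> inv (inv g \<otimes> x)" using g s(2) by (simp add: inv_mult_group m_assoc[symmetric])
    ultimately show "x \<in> S \<longleftrightarrow> g \<in> S" using s(1) by (metis S.m_closed S.m_inv_closed)
  qed (use g W(2) openin_left_translate[OF W(1) g] in auto)
  have op: "openin T Q" if "Q = S \<or> Q = carrier G - S" for Q
  proof (subst openin_subopen, intro ballI)
    fix g assume "g \<in> Q"
    then have "g \<in> carrier G" using that S.subset by auto
    from cosets[OF this] obtain V where V: "openin T V" "g \<in> V" "\<forall>x\<in>V. x \<in> S \<longleftrightarrow> g \<in> S" by blast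
    then have "V \<subseteq> Q" using that \<open>g \<in> Q\<close> openin_subset[OF V(1)] topspace_eq by auto
    with V show "\<exists>V. openin T V \<and> g \<in> V \<and> V \<subseteq> Q" by blast
  qed
  have "openin T S" using op by simp
  moreover have "openin T (carrier G - S)" using op by simp
  then have "closedin T S"
    using S.subset by (simp add: closedin_def topspace_eq)
  ultimately show ?thesis
    using conn S.one_closed by (metis connected_space_clopen_in empty_iff topspace_eq)
qed

lemma subgroup_commutant:
  assumes g: "g \<in> carrier G"
  shows "subgroup {h \<in> carrier G. g \<otimes> h = h \<otimes> g} G"
proof -
  let ?S = "{h \<in> carrier G. g \<otimes> h = h \<otimes> g}"
  show ?thesis
  proof
    show "x \<otimes> y \<in> ?S" if "x \<in> ?S" "y \<in> ?S" for x y
    proof -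
      have car: "x \<in> carrier G" "y \<in> carrier G" and c: "g \<otimes> x = x \<otimes> g" "g \<otimes> y = y \<otimes> g"
        using that by auto
      have "g \<otimes> (x \<otimes> y) = (g \<otimes> x) \<otimes> y" using car g by (simp add: m_assoc)
      also have "\<dots> = (x \<otimes> g) \<otimes> y" by (simp only: c)
      also have "\<dots> = x \<otimes> (g \<otimes> y)" using car g by (simp add: m_assoc)
      also have "\<dots> = x \<otimes> (y \<otimes> g)" by (simp only: c)
      also have "\<dots> = (x \<otimes> y) \<otimes> g" using car g by (simp add: m_assoc)
      finally have "g \<otimes> (x \<otimes> y) = (x \<otimes> y) \<otimes> g" .
      with that m_closed show ?thesis by blast
    qed
    show "inv x \<in> ?S" if "x \<in> ?S" for x
    proof -
      have car: "x \<in> carrier G" and c: "g \<otimes> x = x \<otimes> g"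
        using that by auto
      have "g \<otimes> inv x = inv x \<otimes> (x \<otimes> g) \<otimes> inv x" using car g by (simp add: m_assoc[symmetric])
      also have "\<dots> = inv x \<otimes> (g \<otimes> x) \<otimes> inv x" by (simp only: c)
      also have "\<dots> = inv x \<otimes> g" using car g by (simp add: m_assoc)
      finally have "g \<otimes> inv x = inv x \<otimes> g" .
      with that inv_closed show ?thesis by blast
    qed
  qed (use g in auto)
qed

lemma central_if_commutes_near_one:
  assumes conn: "connected_space T" and g: "g \<in> carrier G"
    and W: "openin T W" "\<one> \<in> W" "\<And>h. h \<in> W \<Longrightarrow> g \<otimes> h = h \<otimes> g" and h: "h \<in> carrier G"
  shows "g \<otimes> h = h \<otimes> g"
  using connected_open_subgroup[OF conn subgroup_commutant[OF g] W(1,2)] h W openin_subset[OF W(1)] topspace_eq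
  by blast

end

section \<open>The group law in a chart around the unit\<close>

lemma has_derivative_along_curve:
  assumes "(f has_derivative f') (at (c t))" "(c has_vector_derivative c') (at t within S)"
  shows "((\<lambda>t. f (c t)) has_vector_derivative f' c') (at t within S)"
proof -
  have "((\<lambda>t. f (c t)) has_derivative (\<lambda>h. f' (h *\<^sub>R c'))) (at t within S)"
    using assms(2) assms(1) unfolding has_vector_derivative_def by (rule has_derivative_compose)
  moreover have "linear f'"
    using has_derivative_bounded_linear[OF assms(1)] by (rule bounded_linear.linear)
  ultimately show ?thesis
    by (simp add: has_vector_derivative_def linear_scale)
qed

lemma eventually_nhds_continuous:
  assumes "isCont f x" "open S" "f x \<in> S"
  shows "\<forall>\<^sub>F y in nhds x. f y \<in> S"
  using assms topological_tendstoD[of f "f x" "nhds x" S]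
  by (simp add: isCont_def tendsto_at_iff_tendsto_nhds)

lemma has_derivative_eventually_cong:
  assumes "(f has_derivative f') (at x)" "\<forall>\<^sub>F y in nhds x. f y = g y"
  shows "(g has_derivative f') (at x)"
proof -
  obtain S where "open S" "x \<in> S" "\<And>y. y \<in> S \<Longrightarrow> f y = g y"
    using assms(2) unfolding eventually_nhds by auto
  then show ?thesis
    using assms(1) by (metis has_derivative_transform_within_open)
qed

lemma jet_on_near:
  fixes D :: "'a::real_normed_vector \<Rightarrow> 'a list \<Rightarrow> 'b::real_normed_vector"
  assumes D: "jet_on S D" "x \<in> S"
  obtains d B where "d > 0" "B \<ge> 0"
    "\<And>y vs. norm (y - x) < d \<Longrightarrow> length vs = k \<Longrightarrow> norm (D y vs) \<le> B * prod_list (map norm vs)"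
proof -
  obtain C0 where C0: "C0 \<ge> 0" "\<And>vs. length vs = k \<Longrightarrow> norm (D x vs) \<le> C0 * prod_list (map norm vs)"
    using bounded_multilinear_bound[OF jet_on_multilinear[OF D]] by metis
  obtain C1 where C1: "C1 \<ge> 0" "\<And>vs. length vs = Suc k \<Longrightarrow> norm (D x vs) \<le> C1 * prod_list (map norm vs)"
    using bounded_multilinear_bound[OF jet_on_multilinear[OF D]] by metis
  obtain d where d: "d > 0" "\<And>y vs. norm (y - x) < d \<Longrightarrow> length vs = k \<Longrightarrow>
      norm (D y vs - D x vs - D x ((y - x) # vs)) \<le> 1 * norm (y - x) * prod_list (map norm vs)"
    using jet_on_approx[OF D, of 1 k] unfolding eventually_nhds_metric dist_norm by auto
  have "norm (D y vs) \<le> (C0 + C1 + 1) * prod_list (map norm vs)"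
    if y: "norm (y - x) < min d 1" and vs: "length vs = k" for y vs
  proof -
    let ?P = "prod_list (map norm vs)"
    have P: "?P \<ge> 0" by (rule prod_list_norm_nonneg)
    have s: "norm (y - x) * ?P \<le> 1 * ?P"
      using y P by (intro mult_right_mono) auto
    have "D y vs = (D y vs - D x vs - D x ((y - x) # vs)) + D x vs + D x ((y - x) # vs)"
      by simp
    also have "norm \<dots> \<le> norm (y - x) * ?P + C0 * ?P + C1 * (norm (y - x) * ?P)"
      using d(2)[of y vs] C0(2)[OF vs] C1(2)[of "(y - x) # vs"] y vs
      by (intro norm_triangle_le add_mono) auto
    also have "\<dots> \<le> ?P + C0 * ?P + C1 * ?P"
      using s C1(1) by (intro add_mono order_refl mult_left_mono) auto
    finally show ?thesis by (simp add: algebra_simps)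
  qed
  then show thesis using d(1) C0(1) C1(1) that[of "min d 1" "C0 + C1 + 1"] by auto
qed

lemma jet_on_locally_lipschitz:
  fixes D :: "'a::real_normed_vector \<Rightarrow> 'a list \<Rightarrow> 'b::real_normed_vector"
  assumes D: "jet_on S D" "x \<in> S" and S: "open S"
  obtains r K where "r > 0" "K \<ge> 0" "cball x r \<subseteq> S"
    "\<And>y z v. y \<in> cball x r \<Longrightarrow> z \<in> cball x r \<Longrightarrow> norm (D y [v] - D z [v]) \<le> K * norm (y - z) * norm v"
proof -
  obtain d B where d: "d > 0" "B \<ge> 0"
    "\<And>y vs. norm (y - x) < d \<Longrightarrow> length vs = 2 \<Longrightarrow> norm (D y vs) \<le> B * prod_list (map norm vs)"
    using jet_on_near[OF D] by metis
  obtain d' where d': "d' > 0" "cball x d' \<subseteq> S"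
    using S D(2) open_contains_cball by metis
  define r where "r = min (d / 2) d'"
  have r: "r > 0" "r < d" "cball x r \<subseteq> S" using d(1) d' by (auto simp: r_def)
  have "norm (D y [v] - D z [v]) \<le> (B * norm v) * norm (y - z)"
    if "y \<in> cball x r" "z \<in> cball x r" for y z v
  proof (rule differentiable_bound[OF convex_cball _ _ that])
    fix u assume u: "u \<in> cball x r"
    then have uS: "u \<in> S" using r(3) by blast
    show "((\<lambda>y. D y [v]) has_derivative (\<lambda>h. D u [h, v])) (at u within cball x r)"
      by (rule has_derivative_at_withinI[OF jet_on_has_derivative[OF D(1) uS]])
    have "norm (u - x) < d" using u r(2) by (simp add: dist_norm norm_minus_commute)
    then have "norm (D u [h, v]) \<le> B * (norm h * norm v)" for h
      using d(3)[of u "[h, v]"] by simp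
    then show "onorm (\<lambda>h. D u [h, v]) \<le> B * norm v"
      using d(2) by (intro onorm_bound) (auto simp: mult_ac)
  qed
  then show thesis
    using that[of r B] r d(2) by (simp add: mult_ac)
qed

locale lie_chart = banach_lie_group G T A
  for G :: "('g, 'r) monoid_scheme" (structure)
    and T :: "'g topology" and A :: "('g, 'e::banach) chart set" +
  fixes U :: "'g set" and \<phi> :: "'g \<Rightarrow> 'e"
  assumes chart: "(U, \<phi>) \<in> A" and one_in: "\<one> \<in> U"
begin

abbreviation p :: 'e where "p \<equiv> \<phi> \<one>"
abbreviation \<psi> :: "'e \<Rightarrow> 'g" where "\<psi> \<equiv> inv_into U \<phi>"
abbreviation E :: "'e set" where "E \<equiv> \<phi> ` U"

definition m :: "'e \<Rightarrow> 'e \<Rightarrow> 'e" where "m x y = \<phi> (\<psi> x \<otimes> \<psi> y)"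

definition \<Omega> :: "('e \<times> 'e) set" where "\<Omega> = {(x, y). x \<in> E \<and> y \<in> E \<and> \<psi> x \<otimes> \<psi> y \<in> U}"

lemma psi_phi [simp]: "g \<in> U \<Longrightarrow> \<psi> (\<phi> g) = g"
  using chart_inj[OF chart] by (rule inv_into_f_f)

lemma phi_psi: "x \<in> E \<Longrightarrow> \<phi> (\<psi> x) = x"
  by (rule f_inv_into_f)

lemma psi_in: "x \<in> E \<Longrightarrow> \<psi> x \<in> U"
  by (rule inv_into_into)

lemma psi_carrier: "x \<in> E \<Longrightarrow> \<psi> x \<in> carrier G"
  using psi_in chart_subset[OF chart] by blast

lemma p_in: "p \<in> E"
  using one_in by simp

lemma psi_p: "\<psi> p = \<one>"
  using one_in by simp

lemma open_E: "open E"
  by (rule chart_image_open[OF chart])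

lemma psi_inj: "x \<in> E \<Longrightarrow> y \<in> E \<Longrightarrow> \<psi> x = \<psi> y \<Longrightarrow> x = y"
  by (metis phi_psi)

lemma \<Omega>_iff: "(x, y) \<in> \<Omega> \<longleftrightarrow> x \<in> E \<and> y \<in> E \<and> \<psi> x \<otimes> \<psi> y \<in> U"
  by (simp add: \<Omega>_def)

lemma psi_m: "(x, y) \<in> \<Omega> \<Longrightarrow> \<psi> (m x y) = \<psi> x \<otimes> \<psi> y"
  by (simp add: m_def \<Omega>_iff)

lemma m_in: "(x, y) \<in> \<Omega> \<Longrightarrow> m x y \<in> E"
  by (simp add: m_def \<Omega>_iff)

lemma \<Omega>_p: "x \<in> E \<Longrightarrow> (x, p) \<in> \<Omega>" "x \<in> E \<Longrightarrow> (p, x) \<in> \<Omega>"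
  by (simp_all only: \<Omega>_iff psi_p p_in psi_carrier r_one l_one psi_in simp_thms)

lemma m_p: "x \<in> E \<Longrightarrow> m x p = x" "x \<in> E \<Longrightarrow> m p x = x"
  by (simp_all only: m_def psi_p psi_carrier r_one l_one phi_psi)

lemma smooth_m: "smooth_on \<Omega> (\<lambda>z. m (fst z) (snd z))"
proof -
  have "(U \<times> U, map_prod \<phi> \<phi>) \<in> prod_atlas A A"
    using chart unfolding prod_atlas_def by force
  then have "smooth_on (map_prod \<phi> \<phi> ` {z \<in> U \<times> U. (\<lambda>(x, y). x \<otimes> y) z \<in> U})
      (\<phi> \<circ> (\<lambda>(x, y). x \<otimes> y) \<circ> inv_into (U \<times> U) (map_prod \<phi> \<phi>))"
    using smooth_mult chart unfolding smooth_map_def by fast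
  moreover have "map_prod \<phi> \<phi> ` {z \<in> U \<times> U. (\<lambda>(x, y). x \<otimes> y) z \<in> U} = \<Omega>"
    by (force simp: \<Omega>_def)
  moreover have "(\<phi> \<circ> (\<lambda>(x, y). x \<otimes> y) \<circ> inv_into (U \<times> U) (map_prod \<phi> \<phi>)) z = m (fst z) (snd z)" if z: "z \<in> \<Omega>" for z
  proof -
    obtain g h where gh: "g \<in> U" "h \<in> U" "z = (\<phi> g, \<phi> h)"
      using z unfolding \<Omega>_def by blast
    have "inj_on (map_prod \<phi> \<phi>) (U \<times> U)"
      using chart_inj[OF chart] chart_inj[OF chart] by (rule map_prod_inj_on)
    from inv_into_f_f[OF this, of "(g, h)"] gh show ?thesis by (simp add: m_def)
  qed
  ultimately show ?thesis using smooth_on_cong by (metis (no_types, lifting))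
qed

lemma open_\<Omega>: "open \<Omega>"
  by (rule smooth_on_open[OF smooth_m])

definition D :: "'e \<times> 'e \<Rightarrow> ('e \<times> 'e) list \<Rightarrow> 'e"
  where "D = (SOME D. jet_on \<Omega> D \<and> (\<forall>z\<in>\<Omega>. D z [] = m (fst z) (snd z)))"

lemma jet_D: "jet_on \<Omega> D" and D_Nil: "z \<in> \<Omega> \<Longrightarrow> D z [] = m (fst z) (snd z)"
proof -
  have "\<exists>D. jet_on \<Omega> D \<and> (\<forall>z\<in>\<Omega>. D z [] = m (fst z) (snd z))"
    using smooth_m unfolding smooth_on_iff_jet by (rule conjunct2)
  from someI_ex[OF this] show "jet_on \<Omega> D" "z \<in> \<Omega> \<Longrightarrow> D z [] = m (fst z) (snd z)"
    unfolding D_def by auto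
qed

lemma D_linear: "z \<in> \<Omega> \<Longrightarrow> linear (\<lambda>h. D z (h # vs))"
  by (rule bounded_multilinear_linear_Cons[OF jet_on_multilinear[OF jet_D] refl])

definition L :: "'e \<Rightarrow> 'e \<Rightarrow> 'e" where "L x w = D (x, p) [(0, w)]"
definition R :: "'e \<Rightarrow> 'e \<Rightarrow> 'e" where "R x w = D (p, x) [(w, 0)]"

lemma m_has_derivative:
  assumes "z \<in> \<Omega>"
  shows "((\<lambda>z. m (fst z) (snd z)) has_derivative (\<lambda>h. D z [h])) (at z)"
  by (rule has_derivative_transform_within_open[OF jet_on_has_derivative[OF jet_D assms] open_\<Omega> assms])
    (rule D_Nil)

lemma m_has_derivative_right:
  assumes "(x, y) \<in> \<Omega>"
  shows "((\<lambda>y. m x y) has_derivative (\<lambda>w. D (x, y) [(0, w)])) (at y)"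
proof -
  have "((\<lambda>y. (x, y)) has_derivative (\<lambda>w. (0, w))) (at y)"
    by (auto intro!: derivative_eq_intros)
  from has_derivative_compose[OF this m_has_derivative[OF assms]] show ?thesis by simp
qed

lemma m_has_derivative_left:
  assumes "(x, y) \<in> \<Omega>"
  shows "((\<lambda>x. m x y) has_derivative (\<lambda>w. D (x, y) [(w, 0)])) (at x)"
proof -
  have "((\<lambda>x. (x, y)) has_derivative (\<lambda>w. (w, 0))) (at x)"
    by (auto intro!: derivative_eq_intros)
  from has_derivative_compose[OF this m_has_derivative[OF assms]] show ?thesis by simp
qed

lemma m_has_derivative_L: "x \<in> E \<Longrightarrow> ((\<lambda>y. m x y) has_derivative L x) (at p)"
  using m_has_derivative_right[OF \<Omega>_p(1)] unfolding L_def by simp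

lemma m_has_derivative_R: "x \<in> E \<Longrightarrow> ((\<lambda>y. m y x) has_derivative R x) (at p)"
  using m_has_derivative_left[OF \<Omega>_p(2)] unfolding R_def by simp

lemma L_linear: "x \<in> E \<Longrightarrow> linear (L x)"
  using has_derivative_bounded_linear[OF m_has_derivative_L] by (rule bounded_linear.linear)

lemma L_p: "L p w = w" and R_p: "R p w = w"
proof -
  have ev: "\<forall>\<^sub>F y in nhds p. y \<in> E"
    using open_E p_in by (rule eventually_nhds_in_open)
  have id: "((\<lambda>y. y) has_derivative (\<lambda>w. w)) (at p)" by simp
  have "((\<lambda>y. y) has_derivative L p) (at p)"
    by (rule has_derivative_eventually_cong[OF m_has_derivative_L[OF p_in]]) (use ev m_p in \<open>auto elim: eventually_mono\<close>)
  from has_derivative_unique[OF this id] show "L p w = w" by simp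
  have "((\<lambda>y. y) has_derivative R p) (at p)"
    by (rule has_derivative_eventually_cong[OF m_has_derivative_R[OF p_in]]) (use ev m_p in \<open>auto elim: eventually_mono\<close>)
  from has_derivative_unique[OF this id] show "R p w = w" by simp
qed

lemma eventually_\<Omega>_right: "(x, y) \<in> \<Omega> \<Longrightarrow> \<forall>\<^sub>F z in nhds y. (x, z) \<in> \<Omega>"
  using open_\<Omega> by (auto intro!: eventually_nhds_continuous continuous_intros)

lemma isCont_m_right: "(x, y) \<in> \<Omega> \<Longrightarrow> isCont (\<lambda>y. m x y) y"
  using has_derivative_continuous[OF m_has_derivative_right] .

lemma left_invariance:
  assumes xy: "(x, y) \<in> \<Omega>"
  shows "L (m x y) w = D (x, y) [(0, L y w)]"
proof -
  have y: "y \<in> E" "x \<in> E" and xyE: "m x y \<in> E" using xy m_in by (auto simp: \<Omega>_iff)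
  have 1: "((\<lambda>z. m (m x y) z) has_derivative L (m x y)) (at p)"
    by (rule m_has_derivative_L[OF xyE])
  have "((\<lambda>z. m x (m y z)) has_derivative (\<lambda>w. D (x, y) [(0, L y w)])) (at p)"
    using has_derivative_compose[OF m_has_derivative_L[OF y(1)], of "\<lambda>z. m x z"] m_has_derivative_right[OF xy]
    by (simp add: m_p y)
  then have 2: "((\<lambda>z. m (m x y) z) has_derivative (\<lambda>w. D (x, y) [(0, L y w)])) (at p)"
  proof (rule has_derivative_eventually_cong)
    have "\<forall>\<^sub>F z in nhds p. (x, m y z) \<in> \<Omega>"
      using eventually_nhds_continuous[where f="\<lambda>z. (x, m y z)" and x=p and S=\<Omega>] isCont_m_right[OF \<Omega>_p(1)[OF y(1)]] open_\<Omega> xy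
      by (simp add: m_p y isCont_Pair)
    moreover have "\<forall>\<^sub>F z in nhds p. (y, z) \<in> \<Omega>"
      by (rule eventually_\<Omega>_right[OF \<Omega>_p(1)[OF y(1)]])
    ultimately show "\<forall>\<^sub>F z in nhds p. m x (m y z) = m (m x y) z"
    proof eventually_elim
      case (elim z)
      then have "z \<in> E" by (simp add: \<Omega>_iff)
      then have "\<psi> x \<otimes> \<psi> (m y z) = \<psi> (m x y) \<otimes> \<psi> z"
        using y elim by (simp add: psi_m[OF xy] psi_m[OF elim(2)] m_assoc psi_carrier)
      then show ?case by (simp add: m_def[of x "m y z"] m_def[of "m x y" z])
    qed
  qed
  show ?thesis
    using has_derivative_unique[OF 1 2] by (rule fun_cong)
qed

definition conjugate :: "'e \<Rightarrow> 'e \<Rightarrow> 'e" where "conjugate x y = \<phi> (\<psi> x \<otimes> \<psi> y \<otimes> inv (\<psi> x))"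

definition Ad :: "'e \<Rightarrow> 'e \<Rightarrow> 'e" where "Ad x w = D (x, \<phi> (inv (\<psi> x))) [(L x w, 0)]"

lemma conjugate_has_derivative:
  assumes x: "x \<in> E" "inv (\<psi> x) \<in> U"
  shows "(conjugate x has_derivative Ad x) (at p)"
proof -
  let ?x' = "\<phi> (inv (\<psi> x))"
  have x': "(x, ?x') \<in> \<Omega>"
    using x one_in psi_carrier[OF x(1)] by (simp add: \<Omega>_iff)
  have "((\<lambda>y. m (m x y) ?x') has_derivative Ad x) (at p)"
    using has_derivative_compose[OF m_has_derivative_L[OF x(1)], of "\<lambda>z. m z ?x'"] m_has_derivative_left[OF x']
    by (simp add: m_p x Ad_def[abs_def])
  then show ?thesis
  proof (rule has_derivative_eventually_cong)
    show "\<forall>\<^sub>F y in nhds p. m (m x y) ?x' = conjugate x y"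
      using eventually_\<Omega>_right[OF \<Omega>_p(1)[OF x(1)]]
    proof eventually_elim
      case (elim y)
      then show ?case
        using x by (simp add: m_def[of "m x y"] conjugate_def psi_m)
    qed
  qed
qed

lemma conjugate_p: "x \<in> E \<Longrightarrow> conjugate x p = p"
  by (simp add: conjugate_def psi_carrier one_in)

lemma eventually_conjugate_in:
  assumes x: "x \<in> E" "inv (\<psi> x) \<in> U"
  shows "\<forall>\<^sub>F y in nhds p. y \<in> E \<and> \<psi> x \<otimes> \<psi> y \<otimes> inv (\<psi> x) \<in> U"
proof -
  let ?x' = "\<phi> (inv (\<psi> x))"
  have x': "(x, ?x') \<in> \<Omega>"
    using x one_in psi_carrier[OF x(1)] by (simp add: \<Omega>_iff)
  have "\<forall>\<^sub>F y in nhds p. (m x y, ?x') \<in> \<Omega>"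
    using eventually_nhds_continuous[where f="\<lambda>y. (m x y, ?x')" and x=p and S=\<Omega>] isCont_m_right[OF \<Omega>_p(1)[OF x(1)]] open_\<Omega> x'
    by (simp add: m_p x isCont_Pair)
  then show ?thesis
    using eventually_\<Omega>_right[OF \<Omega>_p(1)[OF x(1)]]
    by eventually_elim (use x in \<open>simp add: \<Omega>_iff psi_m\<close>)
qed

lemma R_Ad:
  assumes x: "x \<in> E" "inv (\<psi> x) \<in> U"
  shows "R x (Ad x w) = L x w"
proof -
  have "((\<lambda>y. m (conjugate x y) x) has_derivative (\<lambda>w. R x (Ad x w))) (at p)"
    using has_derivative_compose[OF conjugate_has_derivative[OF x], of "\<lambda>z. m z x"] m_has_derivative_R[OF x(1)]
    by (simp add: conjugate_p x)
  then have 1: "((\<lambda>y. m x y) has_derivative (\<lambda>w. R x (Ad x w))) (at p)"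
  proof (rule has_derivative_eventually_cong)
    show "\<forall>\<^sub>F y in nhds p. m (conjugate x y) x = m x y"
      using eventually_conjugate_in[OF x]
    proof eventually_elim
      case (elim y)
      then have "\<psi> (conjugate x y) \<otimes> \<psi> x = \<psi> x \<otimes> \<psi> y"
        using psi_carrier[OF x(1)] psi_carrier[of y] by (simp add: conjugate_def m_assoc)
      then show ?case by (simp add: m_def)
    qed
  qed
  show ?thesis
    using has_derivative_unique[OF 1 m_has_derivative_L[OF x(1)]] by (rule fun_cong)
qed

lemma Ad_m:
  assumes x: "x \<in> E" "inv (\<psi> x) \<in> U" and y: "y \<in> E" "inv (\<psi> y) \<in> U"
    and xy: "(x, y) \<in> \<Omega>" "inv (\<psi> (m x y)) \<in> U"
  shows "Ad (m x y) w = Ad x (Ad y w)"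
proof -
  have xyE: "m x y \<in> E" using m_in[OF xy(1)] .
  have "((\<lambda>z. conjugate x (conjugate y z)) has_derivative (\<lambda>w. Ad x (Ad y w))) (at p)"
    using has_derivative_compose[OF conjugate_has_derivative[OF y], of "conjugate x"] conjugate_has_derivative[OF x]
    by (simp add: conjugate_p y)
  then have 1: "(conjugate (m x y) has_derivative (\<lambda>w. Ad x (Ad y w))) (at p)"
  proof (rule has_derivative_eventually_cong)
    show "\<forall>\<^sub>F z in nhds p. conjugate x (conjugate y z) = conjugate (m x y) z"
      using eventually_conjugate_in[OF y]
    proof eventually_elim
      case (elim z)
      then show ?case
        using psi_carrier[OF x(1)] psi_carrier[OF y(1)] psi_carrier[of z]
        by (simp add: conjugate_def psi_m[OF xy(1)] m_assoc inv_mult_group)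
    qed
  qed
  show ?thesis
    using has_derivative_unique[OF conjugate_has_derivative[OF xyE xy(2)] 1] by (rule fun_cong)
qed

definition bracket :: "'e \<Rightarrow> 'e \<Rightarrow> 'e"
  where "bracket v w = D (p, p) [(v, 0), (0, w)] - D (p, p) [(w, 0), (0, v)]"

lemma L_has_derivative: "((\<lambda>x. L x w) has_derivative (\<lambda>h. D (p, p) [(h, 0), (0, w)])) (at p)"
proof -
  have "((\<lambda>x. (x, p)) has_derivative (\<lambda>h. (h, 0))) (at p)"
    by (auto intro!: derivative_eq_intros)
  from has_derivative_compose[OF this jet_on_has_derivative[OF jet_D \<Omega>_p(1)[OF p_in]]]
  show ?thesis by (simp add: L_def)
qed

lemma R_has_derivative: "((\<lambda>x. R x w) has_derivative (\<lambda>h. D (p, p) [(w, 0), (0, h)])) (at p)"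
proof -
  have "((\<lambda>x. (p, x)) has_derivative (\<lambda>h. (0, h))) (at p)"
    by (auto intro!: derivative_eq_intros)
  from has_derivative_compose[OF this jet_on_has_derivative[OF jet_D \<Omega>_p(1)[OF p_in]]]
  show ?thesis
    using jet_on_symmetric[OF jet_D \<Omega>_p(1)[OF p_in] open_\<Omega>] by (simp add: R_def)
qed

lemma left_invariant_field_eq: "x \<in> E \<Longrightarrow> left_invariant_field G (U, \<phi>) v x = L x v"
  using frechet_derivative_at[OF m_has_derivative_L, of x]
  by (simp add: left_invariant_field_def m_def[abs_def])

lemma lie_bracket_eq: "lie_bracket G (U, \<phi>) v w = bracket v w"
proof -
  have "(left_invariant_field G (U, \<phi>) u has_derivative (\<lambda>h. D (p, p) [(h, 0), (0, u)])) (at p)" for u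
    by (rule has_derivative_eventually_cong[OF L_has_derivative])
      (use left_invariant_field_eq open_E p_in in \<open>auto simp: eventually_nhds\<close>)
  from frechet_derivative_at[OF this, symmetric] show ?thesis
    by (simp add: lie_bracket_def Let_def left_invariant_field_eq p_in L_p bracket_def)
qed

lemma lie_center_iff: "v \<in> lie_center G (U, \<phi>) \<longleftrightarrow> (\<forall>w. bracket v w = 0)"
  by (simp add: lie_center_def lie_bracket_eq)

lemma bracket_scaleR: "bracket (a *\<^sub>R v) w = a *\<^sub>R bracket v w"
proof -
  have pp: "(p, p) \<in> \<Omega>" using \<Omega>_p(1)[OF p_in] .
  have 1: "D (p, p) [(a *\<^sub>R v, 0), (0, w)] = a *\<^sub>R D (p, p) [(v, 0), (0, w)]"
    using linear_scale[OF D_linear[OF pp, of "[(0, w)]"], of a "(v, 0)"] by simp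
  have 2: "D (p, p) [(w, 0), (0, a *\<^sub>R v)] = a *\<^sub>R D (p, p) [(w, 0), (0, v)]"
    using linear_scale[OF bounded_multilinear_linear[OF jet_on_multilinear[OF jet_D pp, of 2], of "[(w, 0)]" "[]"], of a "(0, v)"]
    by simp
  show ?thesis by (simp add: bracket_def 1 2 scaleR_diff_right)
qed

lemma lie_center_scaleR: "v \<in> lie_center G (U, \<phi>) \<Longrightarrow> a *\<^sub>R v \<in> lie_center G (U, \<phi>)"
  by (simp add: lie_center_iff bracket_scaleR)

lemma smooth_L: "smooth_on E (\<lambda>x. L x v)"
proof (rule smooth_onI[OF open_E, where D="\<lambda>x vs. D (x, p) (map (\<lambda>u. (u, 0)) vs @ [(0, v)])"])
  let ?vs = "\<lambda>vs :: 'e list. map (\<lambda>u. (u, 0 :: 'e)) vs @ [(0, v)]"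
  have norm_vs: "prod_list (map norm (?vs vs)) = norm v * prod_list (map norm vs)" for vs
    by (induction vs) (auto simp: norm_Pair mult_ac)
  show "jet_on E (\<lambda>x vs. D (x, p) (?vs vs))"
    unfolding jet_on_def
  proof (intro ballI allI conjI impI)
    fix x k assume x: "x \<in> E"
    have z: "(x, p) \<in> \<Omega>" by (rule \<Omega>_p(1)[OF x])
    have ml: "bounded_multilinear n (D (x, p))" for n by (rule jet_on_multilinear[OF jet_D z])
    obtain C where C: "\<And>vs. length vs = Suc k \<Longrightarrow> norm (D (x, p) vs) \<le> C * prod_list (map norm vs)"
      using bounded_multilinear_ex_bound[OF ml, of "Suc k"] by auto
    show "bounded_multilinear k (\<lambda>vs. D (x, p) (?vs vs))"
      unfolding bounded_multilinear_def
    proof (intro conjI allI impI exI)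
      fix us ws :: "'e list" assume "Suc (length us + length ws) = k"
      then have "linear (\<lambda>z. D (x, p) (map (\<lambda>u. (u, 0)) us @ z # (?vs ws)))"
        by (intro bounded_multilinear_linear[OF ml[of "Suc k"]]) simp
      moreover have "linear (\<lambda>u::'e. (u, 0 :: 'e))" by (rule linearI) auto
      ultimately have "linear ((\<lambda>z. D (x, p) (map (\<lambda>u. (u, 0)) us @ z # (?vs ws))) \<circ> (\<lambda>u. (u, 0)))"
        by (rule linear_compose[rotated])
      then show "linear (\<lambda>u. D (x, p) (?vs (us @ u # ws)))" by (simp add: o_def)
    next
      fix vs :: "'e list" assume "length vs = k"
      then have "norm (D (x, p) (?vs vs)) \<le> C * prod_list (map norm (?vs vs))"
        by (intro C) simp
      then show "norm (D (x, p) (?vs vs)) \<le> (C * norm v) * prod_list (map norm vs)"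
        by (simp only: norm_vs mult.assoc)
    qed
    fix e :: real assume e: "e > 0"
    let ?e = "e / (norm v + 1)"
    have nv: "norm v + 1 > 0" by (simp add: add_nonneg_pos)
    have "\<forall>\<^sub>F z in nhds (x, p). \<forall>vs. length vs = Suc k \<longrightarrow>
          norm (D z vs - D (x, p) vs - D (x, p) ((z - (x, p)) # vs)) \<le> ?e * norm (z - (x, p)) * prod_list (map norm vs)"
      using e nv by (intro jet_on_approx[OF jet_D z]) simp
    moreover have "((\<lambda>y. (y, p)) \<longlongrightarrow> (x, p)) (nhds x)"
      by (intro tendsto_intros) (simp add: filterlim_def)
    ultimately have "\<forall>\<^sub>F y in nhds x. \<forall>vs. length vs = Suc k \<longrightarrow>
          norm (D (y, p) vs - D (x, p) vs - D (x, p) (((y, p) - (x, p)) # vs)) \<le> ?e * norm ((y, p) - (x, p)) * prod_list (map norm vs)"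
      by (rule eventually_compose_filterlim)
    then show "\<forall>\<^sub>F y in nhds x. \<forall>vs. length vs = k \<longrightarrow>
       norm (D (y, p) (?vs vs) - D (x, p) (?vs vs) - D (x, p) (?vs ((y - x) # vs)))
       \<le> e * norm (y - x) * prod_list (map norm vs)"
    proof (rule eventually_mono, intro allI impI)
      fix y and vs :: "'e list"
      assume *: "\<forall>vs. length vs = Suc k \<longrightarrow>
          norm (D (y, p) vs - D (x, p) vs - D (x, p) (((y, p) - (x, p)) # vs)) \<le> ?e * norm ((y, p) - (x, p)) * prod_list (map norm vs)"
        and k: "length vs = k"
      have "norm (D (y, p) (?vs vs) - D (x, p) (?vs vs) - D (x, p) (((y, p) - (x, p)) # ?vs vs))
          \<le> ?e * norm ((y, p) - (x, p)) * prod_list (map norm (?vs vs))"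
        using *[rule_format, of "?vs vs"] k by simp
      also have "\<dots> = (e * norm (y - x) * prod_list (map norm vs)) * (norm v / (norm v + 1))"
        by (simp only: norm_vs) (simp add: norm_Pair)
      also have "\<dots> \<le> (e * norm (y - x) * prod_list (map norm vs)) * 1"
        using e nv prod_list_norm_nonneg[of vs] by (intro mult_left_mono mult_nonneg_nonneg) auto
      finally show "norm (D (y, p) (?vs vs) - D (x, p) (?vs vs) - D (x, p) (?vs ((y - x) # vs)))
       \<le> e * norm (y - x) * prod_list (map norm vs)" by simp
    qed
  qed
qed (simp add: L_def)

end

section \<open>Local one-parameter subgroups\<close>

context lie_chart
begin

lemma openin_psi_image:
  assumes "open B" "B \<subseteq> E"
  shows "openin T (\<psi> ` B)"
proof -
  have "openin (subtopology T U) {g \<in> topspace (subtopology T U). \<phi> g \<in> B}"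
    using openin_continuous_map_preimage[OF chart_continuous[OF chart]] assms(1) by simp
  then have "openin T {g \<in> topspace (subtopology T U). \<phi> g \<in> B}"
    using chart_openin[OF chart] openin_trans_full by blast
  moreover have "{g \<in> topspace (subtopology T U). \<phi> g \<in> B} = \<psi> ` B"
  proof (rule Set.set_eqI, rule iffI)
    fix g assume "g \<in> {g \<in> topspace (subtopology T U). \<phi> g \<in> B}"
    then show "g \<in> \<psi> ` B" by (intro image_eqI[of _ _ "\<phi> g"]) auto
  next
    fix g assume "g \<in> \<psi> ` B"
    then obtain x where "x \<in> B" "g = \<psi> x" by blast
    then show "g \<in> {g \<in> topspace (subtopology T U). \<phi> g \<in> B}"
      using assms(2) psi_in psi_carrier phi_psi topspace_eq by (simp add: subset_iff)
  qed
  ultimately show ?thesis by simp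
qed

end

locale lie_exp = lie_chart G T A U \<phi>
  for G :: "('g, 'r) monoid_scheme" (structure)
    and T :: "'g topology" and A :: "('g, 'e::banach) chart set"
    and U :: "'g set" and \<phi> :: "'g \<Rightarrow> 'e" +
  fixes r s \<eta> K :: real
  assumes K: "K \<ge> 0" and s: "0 < s" "s \<le> r" "K * s \<le> 1 / 5"
    and \<eta>: "\<eta> > 0" "3 * \<eta> \<le> s" "14 * K * \<eta> \<le> 1"
    and r_in: "cball p r \<subseteq> E"
    and L_lip: "\<And>x y w. x \<in> cball p r \<Longrightarrow> y \<in> cball p r \<Longrightarrow> norm (L x w - L y w) \<le> K * norm (x - y) * norm w"
    and R_near: "\<And>x w. x \<in> cball p r \<Longrightarrow> norm (R x w - w) \<le> K * norm (x - p) * norm w"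
    and s_mult: "\<And>x y. x \<in> cball p s \<Longrightarrow> y \<in> cball p s \<Longrightarrow> (x, y) \<in> \<Omega> \<and> m x y \<in> cball p r"
    and s_inv: "\<And>x. x \<in> cball p s \<Longrightarrow> inv (\<psi> x) \<in> U"
    and s_conj: "\<And>x y. x \<in> cball p s \<Longrightarrow> y \<in> cball p s \<Longrightarrow>
      \<psi> x \<otimes> \<psi> y \<otimes> inv (\<psi> x) \<in> U \<and> conjugate x y \<in> cball p r"
begin

lemma s_sub: "x \<in> cball p s \<Longrightarrow> x \<in> cball p r"
  using s by simp

lemma s_in: "x \<in> cball p s \<Longrightarrow> x \<in> E"
  using s_sub r_in by blast

definition sol :: "'e \<Rightarrow> (real \<Rightarrow> 'e) \<Rightarrow> bool"
  where "sol v c \<longleftrightarrow> c 0 = p \<and>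
    (\<forall>t\<in>{-1..1}. c t \<in> cball p s \<and> (c has_vector_derivative L (c t) v) (at t within {-1..1}))"

lemma sol_0: "sol v c \<Longrightarrow> c 0 = p"
  and sol_s: "sol v c \<Longrightarrow> t \<in> {-1..1} \<Longrightarrow> c t \<in> cball p s"
  and sol_deriv: "sol v c \<Longrightarrow> t \<in> {-1..1} \<Longrightarrow> (c has_vector_derivative L (c t) v) (at t within {-1..1})"
  by (simp_all add: sol_def)

lemma sol_deriv_0: "sol v c \<Longrightarrow> (c has_vector_derivative v) (at 0)"
  using sol_deriv[of v c 0] by (simp add: sol_0 L_p at_within_Icc_at)

lemma sol_picard:
  assumes \<delta>: "0 < \<delta>" "\<delta> \<le> \<eta>" and "norm y \<le> \<delta>" "0 \<le> \<theta>" "\<theta> \<le> 1"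
  obtains v c where "norm v \<le> 2 * \<delta>" "sol v c" "y = v + \<theta> *\<^sub>R (c 1 - p - v)"
proof -
  have "14 * K * \<delta> \<le> 14 * K * \<eta>" using \<delta> K by (intro mult_left_mono) auto
  then have "14 * K * \<delta> \<le> 1" using \<eta>(3) by linarith
  then have "\<exists>v c. norm v \<le> 2 * \<delta> \<and> c 0 = p \<and> y = v + \<theta> *\<^sub>R (c 1 - p - v) \<and>
    (\<forall>t\<in>{-1..1}. c t \<in> cball p (3 * \<delta>) \<and> (c has_vector_derivative L (c t) v) (at t within {-1..1}))"
    using s_in s_sub \<delta> \<eta>(2) by (intro picard[where r=s and K=K] L_linear L_lip L_p K assms) auto
  moreover have "x \<in> cball p s" if "x \<in> cball p (3 * \<delta>)" for x
    using that \<delta> \<eta>(2) by simp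
  ultimately show thesis using that unfolding sol_def by blast
qed

lemma sol_ex:
  assumes "norm v \<le> \<eta>"
  obtains c where "sol v c"
  using sol_picard[OF \<eta>(1) order_refl assms, of 0] by auto

lemma log_ex:
  assumes "0 < \<delta>" "\<delta> \<le> \<eta>" "y \<in> cball p \<delta>"
  obtains v c where "norm v \<le> 2 * \<delta>" "sol v c" "c 1 = y"
proof -
  have "norm (y - p) \<le> \<delta>" using assms(3) by (simp add: dist_norm norm_minus_commute)
  from sol_picard[OF assms(1,2) this, of 1] that show thesis by auto
qed

lemma K_small: "norm v \<le> 2 * \<eta> \<Longrightarrow> K * norm v < 1"
proof -
  assume "norm v \<le> 2 * \<eta>"
  then have "K * norm v \<le> K * (2 * \<eta>)" using K by (rule mult_left_mono)
  also have "\<dots> < 1" using \<eta>(3) by simp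
  finally show ?thesis .
qed

lemma sol_unique:
  assumes v: "norm v \<le> 2 * \<eta>" and c: "sol v c" and q0: "q 0 = p"
    and q: "\<And>t. t \<in> {-1..1} \<Longrightarrow> q t \<in> cball p r \<and> (q has_vector_derivative L (q t) v) (at t within {-1..1})"
    and t: "t \<in> {-1..1}"
  shows "q t = c t"
proof (rule ode_unique[where S="cball p r" and L=L and v=v and K=K and a="-1" and b=1 and ?c1.0=q and ?c2.0=c])
  show "norm (L x v - L y v) \<le> K * norm (x - y) * norm v" if "x \<in> cball p r" "y \<in> cball p r" for x y
    using that by (rule L_lip)
  show "q 0 = c 0" using q0 sol_0[OF c] by simp
  show "c t \<in> cball p r \<and> (c has_vector_derivative L (c t) v) (at t within {-1..1})" if "t \<in> {-1..1}" for t
    using sol_s[OF c that] sol_deriv[OF c that] s_sub by blast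
qed (use K K_small[OF v] q t in auto)

lemma sol_hom:
  assumes v: "norm v \<le> 2 * \<eta>" and c: "sol v c"
    and a: "a \<in> {-1..1}" and t: "t \<in> {-1..1}" "a + t \<in> {-1..1}"
  shows "c (a + t) = m (c a) (c t)"
proof -
  define l u where "l = max (-1) (-1 - a)" and "u = min 1 (1 - a)"
  have sub: "{l..u} \<subseteq> {-1..1}" and shift: "(+) a ` {l..u} \<subseteq> {-1..1}"
    by (auto simp: l_def u_def)
  have ca: "c a \<in> cball p s" by (rule sol_s[OF c a])
  show ?thesis
  proof (rule ode_unique[where S="cball p r" and L=L and v=v and K=K and a=l and b=u
        and ?c1.0="\<lambda>t. c (a + t)" and ?c2.0="\<lambda>t. m (c a) (c t)"])
    show "norm (L x v - L y v) \<le> K * norm (x - y) * norm v" if "x \<in> cball p r" "y \<in> cball p r" for x y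
      using that by (rule L_lip)
    show "c (a + 0) = m (c a) (c 0)"
      using sol_0[OF c] m_p(1)[OF s_in[OF ca]] by simp
    fix t assume t: "t \<in> {l..u}"
    then have t1: "t \<in> {-1..1}" and at: "a + t \<in> {-1..1}" using sub shift by auto
    have "((+) a has_vector_derivative 1) (at t within {l..u})"
      by (auto intro!: derivative_eq_intros)
    from vector_diff_chain_within[OF this has_vector_derivative_within_subset[OF sol_deriv[OF c at] shift]]
    show "c (a + t) \<in> cball p r \<and> ((\<lambda>t. c (a + t)) has_vector_derivative L (c (a + t)) v) (at t within {l..u})"
      using s_sub[OF sol_s[OF c at]] by (simp add: o_def)
    have \<Omega>: "(c a, c t) \<in> \<Omega>" "m (c a) (c t) \<in> cball p r"
      using s_mult[OF ca sol_s[OF c t1]] by auto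
    have "((\<lambda>t. m (c a) (c t)) has_vector_derivative D (c a, c t) [(0, L (c t) v)]) (at t within {l..u})"
      by (rule has_derivative_along_curve[OF m_has_derivative_right[OF \<Omega>(1)]
            has_vector_derivative_within_subset[OF sol_deriv[OF c t1] sub]])
    then show "m (c a) (c t) \<in> cball p r \<and>
        ((\<lambda>t. m (c a) (c t)) has_vector_derivative L (m (c a) (c t)) v) (at t within {l..u})"
      using \<Omega> by (simp add: left_invariance)
  qed (use K K_small[OF v] a t in \<open>auto simp: l_def u_def\<close>)
qed

lemma sol_mult:
  assumes "norm v \<le> 2 * \<eta>" "sol v c" "a \<in> {-1..1}" "t \<in> {-1..1}" "a + t \<in> {-1..1}"
  shows "\<psi> (c (a + t)) = \<psi> (c a) \<otimes> \<psi> (c t)"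
  using sol_hom[OF assms] s_mult[OF sol_s[OF assms(2,3)] sol_s[OF assms(2,4)]] by (simp add: psi_m)

lemma hom_curve_sol:
  assumes qE: "\<And>t. t \<in> {-1..1} \<Longrightarrow> q t \<in> E"
    and hom: "\<And>a t. a \<in> {-1..1} \<Longrightarrow> t \<in> {-1..1} \<Longrightarrow> a + t \<in> {-1..1} \<Longrightarrow> \<psi> (q (a + t)) = \<psi> (q a) \<otimes> \<psi> (q t)"
    and q': "(q has_vector_derivative v) (at 0)" and q0: "q 0 = p" and t: "t \<in> {-1..1}"
  shows "(q has_vector_derivative L (q t) v) (at t within {-1..1})"
proof -
  have "((\<lambda>u. u - t) has_vector_derivative 1) (at t)"
    by (auto intro!: derivative_eq_intros)
  from vector_diff_chain_at[OF this, of q v] q'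
  have "((\<lambda>u. q (u - t)) has_vector_derivative v) (at t)"
    by (simp add: o_def)
  from has_derivative_along_curve[OF _ this, of "m (q t)" "L (q t)"] m_has_derivative_L[OF qE[OF t]] q0
  have "((\<lambda>u. m (q t) (q (u - t))) has_vector_derivative L (q t) v) (at t)"
    by simp
  then have "((\<lambda>u. m (q t) (q (u - t))) has_vector_derivative L (q t) v) (at t within {-1..1})"
    by (rule has_vector_derivative_at_within)
  then show ?thesis
  proof (rule has_vector_derivative_transform_within[where d=1])
    fix u assume u: "u \<in> {-1..1}" "dist u t < 1"
    then have "u - t \<in> {-1..1}" by (auto simp: dist_real_def abs_less_iff)
    then have "\<psi> (q u) = \<psi> (q t) \<otimes> \<psi> (q (u - t))"
      using hom[OF t, of "u - t"] u(1) by simp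
    then show "m (q t) (q (u - t)) = q u"
      using phi_psi[OF qE[OF u(1)]] by (simp add: m_def)
  qed (use t in auto)
qed

lemma Ad_linear: "x \<in> cball p s \<Longrightarrow> bounded_linear (Ad x)"
  using conjugate_has_derivative[OF s_in s_inv] by (rule has_derivative_bounded_linear)

lemma R_linear: "x \<in> E \<Longrightarrow> linear (R x)"
  using has_derivative_bounded_linear[OF m_has_derivative_R] by (rule bounded_linear.linear)

lemma R_near_s:
  assumes "x \<in> cball p s"
  shows "norm (R x w - w) \<le> 1 / 5 * norm w"
proof -
  have "norm (R x w - w) \<le> K * norm (x - p) * norm w"
    by (rule R_near[OF s_sub[OF assms]])
  also have "\<dots> \<le> K * s * norm w"
    using assms K by (intro mult_right_mono mult_left_mono) (auto simp: dist_norm norm_minus_commute)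
  also have "\<dots> \<le> 1 / 5 * norm w"
    using s by (intro mult_right_mono) auto
  finally show ?thesis .
qed

lemma L_near_s:
  assumes "x \<in> cball p s"
  shows "norm (L x w - w) \<le> 1 / 5 * norm w"
proof -
  have "norm (L x w - L p w) \<le> K * norm (x - p) * norm w"
    using s by (intro L_lip s_sub assms) simp
  also have "\<dots> \<le> K * s * norm w"
    using assms K by (intro mult_right_mono mult_left_mono) (auto simp: dist_norm norm_minus_commute)
  also have "\<dots> \<le> 1 / 5 * norm w"
    using s by (intro mult_right_mono) auto
  finally show ?thesis by (simp add: L_p)
qed

lemma Ad_near:
  assumes x: "x \<in> cball p s"
  shows "norm (Ad x w - w) \<le> 1 / 2 * norm w"
proof -
  have "Ad x w - w = (L x w - w) - (R x (Ad x w) - Ad x w)"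
    using R_Ad[OF s_in[OF x] s_inv[OF x]] by simp
  also have "norm \<dots> \<le> 1 / 5 * norm w + 1 / 5 * norm (Ad x w)"
    by (rule order_trans[OF norm_triangle_ineq4 add_mono[OF L_near_s[OF x] R_near_s[OF x]]])
  finally show ?thesis
    using norm_triangle_sub[of "Ad x w" w] by simp
qed

lemma Ad_p: "Ad p w = w"
proof -
  have "p \<in> cball p s" using s by simp
  from R_Ad[OF s_in[OF this] s_inv[OF this]] show ?thesis by (simp add: R_p L_p)
qed

lemma Ad_sol_deriv_0:
  assumes c: "sol v c"
  shows "((\<lambda>t. Ad (c t) w) has_vector_derivative bracket v w) (at 0)"
proof -
  let ?g = "\<lambda>t. L (c t) w - R (c t) w" and ?a = "\<lambda>t. Ad (c t) w - w"
  have g: "(?g has_vector_derivative bracket v w) (at 0)"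
    using has_derivative_along_curve[of "\<lambda>x. L x w" _ c 0 v UNIV] has_derivative_along_curve[of "\<lambda>x. R x w" _ c 0 v UNIV]
      L_has_derivative R_has_derivative sol_deriv_0[OF c] sol_0[OF c]
    unfolding bracket_def by (intro has_vector_derivative_diff) auto
  have g0: "?g 0 = 0" and a0: "?a 0 = 0" by (simp_all add: sol_0[OF c] L_p R_p Ad_p)
  have bound: "norm (?a t - ?g t) \<le> 2 * K * norm (c t - p) * norm (?g t)" if t: "t \<in> {-1..1}" for t
  proof -
    have ct: "c t \<in> cball p s" by (rule sol_s[OF c t])
    have Rg: "R (c t) (?a t) = ?g t"
      using R_Ad[OF s_in[OF ct] s_inv[OF ct]] by (simp add: linear_diff[OF R_linear[OF s_in[OF ct]]])
    have "norm (?a t) \<le> norm (?g t) + norm (?g t - ?a t)"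
      using norm_triangle_sub[of "?a t" "?g t"] by (simp only: norm_minus_commute[of "?a t" "?g t"])
    then have "norm (?a t) \<le> 2 * norm (?g t)"
      using R_near_s[OF ct, of "?a t"] norm_ge_zero[of "?g t"] unfolding Rg by linarith
    have "norm (?a t - ?g t) = norm (R (c t) (?a t) - ?a t)"
      unfolding Rg by (rule norm_minus_commute)
    also have "\<dots> \<le> K * norm (c t - p) * norm (?a t)"
      by (rule R_near[OF s_sub[OF ct]])
    also have "\<dots> \<le> K * norm (c t - p) * (2 * norm (?g t))"
      using K \<open>norm (?a t) \<le> 2 * norm (?g t)\<close> by (intro mult_left_mono) auto
    finally show ?thesis by (simp add: mult_ac)
  qed
  have "((\<lambda>t. (?a t - ?g t) /\<^sub>R t) \<longlongrightarrow> 0) (at 0)"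
  proof (rule Lim_null_comparison)
    have "c \<midarrow>0\<rightarrow> p"
      using has_vector_derivative_continuous[OF sol_deriv_0[OF c]] sol_0[OF c] by (simp add: isCont_def)
    moreover have "(\<lambda>t. ?g t /\<^sub>R t) \<midarrow>0\<rightarrow> bracket v w"
      using g unfolding has_vector_derivative_iff_quotient g0 by simp
    ultimately have "(\<lambda>t. 2 * K * norm (c t - p) * norm (?g t /\<^sub>R t)) \<midarrow>0\<rightarrow> 2 * K * norm (p - p) * norm (bracket v w)"
      by (intro tendsto_intros)
    then show "(\<lambda>t. 2 * K * norm (c t - p) * norm (?g t /\<^sub>R t)) \<midarrow>0\<rightarrow> 0" by simp
    have "\<forall>\<^sub>F t in at (0::real). t \<in> {-1<..<1}"
      by (intro eventually_at_in_open') auto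
    then show "\<forall>\<^sub>F t in at 0. norm ((?a t - ?g t) /\<^sub>R t) \<le> 2 * K * norm (c t - p) * norm (?g t /\<^sub>R t)"
    proof eventually_elim
      case (elim t)
      then have "norm (?a t - ?g t) * \<bar>inverse t\<bar> \<le> 2 * K * norm (c t - p) * norm (?g t) * \<bar>inverse t\<bar>"
        by (intro mult_right_mono bound) auto
      then show ?case by (simp add: mult_ac)
    qed
  qed
  then have "((\<lambda>t. ?a t - ?g t) has_vector_derivative 0) (at 0)"
    unfolding has_vector_derivative_iff_quotient using a0 g0 by simp
  from has_vector_derivative_add[OF has_vector_derivative_add[OF this g] has_vector_derivative_const[of w]]
  show ?thesis by simp
qed

lemma Ad_sol_deriv:
  assumes v: "norm v \<le> 2 * \<eta>" and c: "sol v c" and t: "t \<in> {-1..1}"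
  shows "((\<lambda>u. Ad (c u) w) has_vector_derivative Ad (c t) (bracket v w)) (at t within {-1..1})"
proof -
  have ct: "c t \<in> cball p s" by (rule sol_s[OF c t])
  have "((\<lambda>u. u - t) has_vector_derivative 1) (at t)"
    by (auto intro!: derivative_eq_intros)
  from vector_diff_chain_at[OF this, of "\<lambda>u. Ad (c u) w"] Ad_sol_deriv_0[OF c]
  have "((\<lambda>u. Ad (c (u - t)) w) has_vector_derivative bracket v w) (at t)"
    by (simp add: o_def)
  from has_vector_derivative_at_within[OF bounded_linear.has_vector_derivative[OF Ad_linear[OF ct] this]]
  have "((\<lambda>u. Ad (c t) (Ad (c (u - t)) w)) has_vector_derivative Ad (c t) (bracket v w)) (at t within {-1..1})" .
  then show ?thesis
  proof (rule has_vector_derivative_transform_within[where d=1])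
    fix u assume u: "u \<in> {-1..1}" "dist u t < 1"
    then have ut: "u - t \<in> {-1..1}" by (auto simp: dist_real_def)
    then have cu: "c u = m (c t) (c (u - t))"
      using sol_hom[OF v c t ut] u by simp
    have cut: "c (u - t) \<in> cball p s" and cus: "c u \<in> cball p s"
      using sol_s[OF c] ut u by auto
    have "(c t, c (u - t)) \<in> \<Omega>" using s_mult[OF ct cut] by simp
    from Ad_m[OF s_in[OF ct] s_inv[OF ct] s_in[OF cut] s_inv[OF cut] this] s_inv[OF cus]
    show "Ad (c t) (Ad (c (u - t)) w) = Ad (c u) w"
      by (simp add: cu)
  qed (use t in auto)
qed

lemma Ad_sol_fixed:
  assumes v: "norm v \<le> 2 * \<eta>" "v \<in> lie_center G (U, \<phi>)" and c: "sol v c" and t: "t \<in> {-1..1}"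
  shows "Ad (c t) w = w"
proof -
  have "norm (Ad (c t) w - Ad (c 0) w) \<le> 0 * \<bar>t - 0\<bar>"
  proof (rule has_vector_derivative_norm_bound[OF _ Ad_sol_deriv[OF v(1) c]])
    show "norm (Ad (c u) (bracket v w)) \<le> 0" if "u \<in> {-1..1}" for u
      using v(2) linear_0[OF bounded_linear.linear[OF Ad_linear[OF sol_s[OF c that]]]]
      by (simp add: lie_center_iff)
  qed (use t in auto)
  then show ?thesis by (simp add: sol_0[OF c] Ad_p)
qed

lemma commute_if_Ad_fixed:
  assumes x: "x \<in> cball p s" "\<And>w. Ad x w = w" and y: "y \<in> cball p \<eta>"
  shows "\<psi> x \<otimes> \<psi> y = \<psi> y \<otimes> \<psi> x"
proof -
  obtain v c where v: "norm v \<le> 2 * \<eta>" and c: "sol v c" and cy: "c 1 = y"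
    using log_ex[OF \<eta>(1) order_refl y] .
  let ?q = "\<lambda>t. conjugate x (c t)"
  note car = psi_carrier[OF s_in[OF x(1)]]
  have cc: "\<psi> (c t) \<in> carrier G" if "t \<in> {-1..1}" for t
    using psi_carrier[OF s_in[OF sol_s[OF c that]]] .
  have q: "?q t \<in> cball p r" "\<psi> (?q t) = \<psi> x \<otimes> \<psi> (c t) \<otimes> inv (\<psi> x)" if "t \<in> {-1..1}" for t
    using s_conj[OF x(1) sol_s[OF c that]] by (auto simp: conjugate_def)
  have q0: "?q 0 = p"
    using conjugate_p[OF s_in[OF x(1)]] sol_0[OF c] by simp
  have der: "(?q has_vector_derivative L (?q t) v) (at t within {-1..1})" if t: "t \<in> {-1..1}" for t
  proof (rule hom_curve_sol[where q="?q" and t=t, OF _ _ _ q0 t])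
    show "?q t \<in> E" if "t \<in> {-1..1}" for t using q(1)[OF that] r_in by blast
    show "\<psi> (?q (a + t)) = \<psi> (?q a) \<otimes> \<psi> (?q t)" if "a \<in> {-1..1}" "t \<in> {-1..1}" "a + t \<in> {-1..1}" for a t
    proof -
      have k: "inv (\<psi> x) \<otimes> (\<psi> x \<otimes> g) = g" if "g \<in> carrier G" for g
        using car that by (simp add: m_assoc[symmetric])
      have "\<psi> (?q a) \<otimes> \<psi> (?q t) = \<psi> x \<otimes> (\<psi> (c a) \<otimes> \<psi> (c t)) \<otimes> inv (\<psi> x)"
        unfolding q(2)[OF that(1)] q(2)[OF that(2)] using car cc[OF that(1)] cc[OF that(2)] by (simp add: m_assoc k)
      then show ?thesis
        using sol_mult[OF v c that] by (simp only: q(2)[OF that(3)])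
    qed
    show "(?q has_vector_derivative v) (at 0)"
      using has_derivative_along_curve[of "conjugate x" "Ad x" c 0 v UNIV] conjugate_has_derivative[OF s_in[OF x(1)] s_inv[OF x(1)]]
        sol_deriv_0[OF c] sol_0[OF c] x(2) by simp
  qed
  have "?q 1 = c 1"
    by (rule sol_unique[OF v c]) (use q0 q(1) der in auto)
  then have "\<psi> x \<otimes> \<psi> y \<otimes> inv (\<psi> x) = \<psi> y"
    using q(2)[of 1] cy by simp
  then have "\<psi> y \<otimes> \<psi> x = \<psi> x \<otimes> \<psi> y \<otimes> inv (\<psi> x) \<otimes> \<psi> x" by simp
  also have "\<dots> = \<psi> x \<otimes> \<psi> y"
    using car cc[of 1] cy by (simp add: m_assoc)
  finally show ?thesis by simp
qed

lemma sol_central: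
  assumes conn: "connected_space T" and v: "norm v \<le> 2 * \<eta>" "v \<in> lie_center G (U, \<phi>)"
    and c: "sol v c" and t: "t \<in> {-1..1}" and h: "h \<in> carrier G"
  shows "\<psi> (c t) \<otimes> h = h \<otimes> \<psi> (c t)"
proof (rule central_if_commutes_near_one[OF conn _ _ _ _ h])
  have ct: "c t \<in> cball p s" by (rule sol_s[OF c t])
  then show "\<psi> (c t) \<in> carrier G" by (intro psi_carrier s_in)
  have sub: "ball p \<eta> \<subseteq> E" using s_in \<eta> by (auto simp: subset_iff)
  show "openin T (\<psi> ` ball p \<eta>)" by (rule openin_psi_image[OF open_ball sub])
  show "\<one> \<in> \<psi> ` ball p \<eta>" using \<eta>(1) psi_p by (intro image_eqI[of _ _ p]) auto
  show "\<psi> (c t) \<otimes> g = g \<otimes> \<psi> (c t)" if "g \<in> \<psi> ` ball p \<eta>" for g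
    using that commute_if_Ad_fixed[OF ct Ad_sol_fixed[OF v c t]] by auto
qed

lemma central_imp_lie_center:
  assumes v: "norm v \<le> 2 * \<eta>" and c: "sol v c"
    and central: "\<And>h. h \<in> carrier G \<Longrightarrow> \<psi> (c 1) \<otimes> h = h \<otimes> \<psi> (c 1)"
  shows "v \<in> lie_center G (U, \<phi>)"
  unfolding lie_center_iff
proof
  fix w
  let ?b = "bracket v w"
  have c1: "c 1 \<in> cball p s" by (rule sol_s[OF c]) simp
  have "((\<lambda>y. y) has_derivative Ad (c 1)) (at p)"
  proof (rule has_derivative_eventually_cong[OF conjugate_has_derivative[OF s_in[OF c1] s_inv[OF c1]]])
    have "\<forall>\<^sub>F y in nhds p. y \<in> E" using open_E p_in by (rule eventually_nhds_in_open)
    then show "\<forall>\<^sub>F y in nhds p. conjugate (c 1) y = y"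
    proof eventually_elim
      case (elim y)
      have "\<psi> (c 1) \<otimes> \<psi> y \<otimes> inv (\<psi> (c 1)) = \<psi> y \<otimes> \<psi> (c 1) \<otimes> inv (\<psi> (c 1))"
        using central[OF psi_carrier[OF elim]] by simp
      also have "\<dots> = \<psi> y" using psi_carrier[OF elim] psi_carrier[OF s_in[OF c1]] by (simp add: m_assoc)
      finally show ?case using phi_psi[OF elim] by (simp add: conjugate_def)
    qed
  qed
  from has_derivative_unique[OF this has_derivative_ident] have Ad1: "Ad (c 1) w = w" by simp
  let ?f = "\<lambda>t. Ad (c t) w - t *\<^sub>R ?b"
  have "norm (?f 1 - ?f 0) \<le> (1 / 2 * norm ?b) * \<bar>1 - 0\<bar>"
  proof (rule has_vector_derivative_norm_bound[where J="{-1..1}"])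
    show "(?f has_vector_derivative Ad (c t) ?b - ?b) (at t within {-1..1})" if "t \<in> {-1..1}" for t
      using Ad_sol_deriv[OF v c that] by (auto intro!: derivative_eq_intros)
    show "norm (Ad (c t) ?b - ?b) \<le> 1 / 2 * norm ?b" if "t \<in> {-1..1}" for t
      by (rule Ad_near[OF sol_s[OF c that]])
  qed auto
  then show "?b = 0"
    by (simp add: Ad1 sol_0[OF c] Ad_p)
qed

lemma sol_scaleR:
  assumes c: "sol v c" and a: "\<bar>a\<bar> \<le> 1"
  shows "sol (a *\<^sub>R v) (\<lambda>t. c (a * t))"
  unfolding sol_def
proof (intro conjI ballI)
  have img: "(*) a ` {-1..1} \<subseteq> {-1..1}"
  proof
    fix u assume "u \<in> (*) a ` {-1..1}"
    then obtain t where t: "t \<in> {-1..1}" "u = a * t" by blast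
    have "\<bar>a\<bar> * \<bar>t\<bar> \<le> 1 * 1" using a t by (intro mult_mono) auto
    then show "u \<in> {-1..1}" using t(2) by (simp add: abs_mult[symmetric] abs_le_iff)
  qed
  show "c (a * 0) = p" by (simp add: sol_0[OF c])
  fix t :: real assume "t \<in> {-1..1}"
  then have at: "a * t \<in> {-1..1}" using img by blast
  show "c (a * t) \<in> cball p s" by (rule sol_s[OF c at])
  have "((*) a has_vector_derivative a) (at t within {-1..1})"
    by (auto intro!: derivative_eq_intros)
  from vector_diff_chain_within[OF this has_vector_derivative_within_subset[OF sol_deriv[OF c at] img]]
  show "((\<lambda>t. c (a * t)) has_vector_derivative L (c (a * t)) (a *\<^sub>R v)) (at t within {-1..1})"
    using linear_scale[OF L_linear[OF s_in[OF sol_s[OF c at]]]] by (simp add: o_def)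
qed

lemma sol_smooth_curve:
  assumes c: "sol v c" and I: "open I" "I \<subseteq> {-1<..<1}"
  shows "smooth_curve I (\<lambda>t. \<psi> (c t))"
proof -
  have cE: "c t \<in> E" if "t \<in> I" for t
    using that I(2) by (intro s_in sol_s[OF c]) auto
  have "smooth_on I c"
  proof (rule smooth_on_integral_curve[OF smooth_L])
    show "(c has_vector_derivative L (c t) v) (at t)" if "t \<in> I" for t
      using sol_deriv[OF c, of t] I(2) that by (auto simp: at_within_Icc_at subset_iff)
  qed (use cE I in auto)
  moreover have "\<phi> (\<psi> (c t)) = c t" if "t \<in> I" for t
    using phi_psi[OF cE[OF that]] .
  ultimately have "smooth_on I (\<lambda>t. \<phi> (\<psi> (c t)))"
    by (subst smooth_on_cong[where g=c])
  then show ?thesis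
    using chart psi_in[OF cE] I(1)
    by (intro smooth_curveI exI[of _ U] exI[of _ \<phi>] exI[of _ I]) auto
qed

end

context lie_chart
begin

lemma lie_exp_ex: "\<exists>r s \<eta> K. lie_exp G T A U \<phi> r s \<eta> K"
proof -
  obtain r K where r: "r > 0" and K: "K \<ge> 0" and r\<Omega>: "cball (p, p) r \<subseteq> \<Omega>"
    and lip: "\<And>y z v. y \<in> cball (p, p) r \<Longrightarrow> z \<in> cball (p, p) r \<Longrightarrow> norm (D y [v] - D z [v]) \<le> K * norm (y - z) * norm v"
    using jet_on_locally_lipschitz[OF jet_D \<Omega>_p(1)[OF p_in] open_\<Omega>] by metis
  have in1: "(x, p) \<in> cball (p, p) r" "(p, x) \<in> cball (p, p) r" if "x \<in> cball p r" for x
    using that by (auto simp: dist_Pair_Pair)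
  have rE: "cball p r \<subseteq> E"
  proof
    fix x assume "x \<in> cball p r"
    then have "(x, p) \<in> \<Omega>" using in1(1) r\<Omega> by blast
    then show "x \<in> E" by (simp add: \<Omega>_iff)
  qed
  have ball: "ball p r \<subseteq> E" using rE by auto
  let ?W = "\<psi> ` ball p r"
  have W: "openin T ?W" by (rule openin_psi_image[OF open_ball ball])
  have one_W: "\<one> \<in> ?W" using r psi_p by (intro image_eqI[of _ _ p]) auto
  have "continuous_map (top_of_set (E \<times> E)) (top_of_set E) fst" "continuous_map (top_of_set (E \<times> E)) (top_of_set E) snd"
    by (auto intro!: continuous_on_fst continuous_on_snd continuous_on_id)
  from this[THEN continuous_map_compose[OF _ chart_inverse_continuous[OF chart]]]
  have \<psi>: "continuous_map (top_of_set (E \<times> E)) T (\<lambda>z. \<psi> (fst z))" "continuous_map (top_of_set (E \<times> E)) T (\<lambda>z. \<psi> (snd z))"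
    by (simp_all add: o_def)
  have op: "open {z \<in> E \<times> E. f z \<in> V}" if "continuous_map (top_of_set (E \<times> E)) T f" "openin T V" for f V
    using openin_continuous_map_preimage[OF that] open_Times[OF open_E open_E] openin_open_trans by simp
  let ?O = "{z \<in> E \<times> E. \<psi> (fst z) \<otimes> \<psi> (snd z) \<in> ?W}
    \<inter> {z \<in> E \<times> E. \<psi> (fst z) \<otimes> \<psi> (snd z) \<otimes> inv (\<psi> (fst z)) \<in> ?W} \<inter> {z \<in> E \<times> E. inv (\<psi> (fst z)) \<in> U}"
  have "open ?O"
    by (intro open_Int op continuous_map_mult continuous_map_inv \<psi> W chart_openin[OF chart])
  moreover have "(p, p) \<in> ?O" using one_W one_in p_in by simp
  ultimately obtain d where d: "d > 0" "cball (p, p) d \<subseteq> ?O"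
    by (meson open_contains_cball)
  define s where "s = min r (min (d / 2) (1 / (5 * (K + 1))))"
  define \<eta> where "\<eta> = min (s / 3) (1 / (14 * (K + 1)))"
  have s: "s > 0" "s \<le> r" "s \<le> d / 2" "s \<le> 1 / (5 * (K + 1))"
    using r d(1) K by (auto simp: s_def)
  have \<eta>: "\<eta> > 0" "\<eta> \<le> s / 3" "\<eta> \<le> 1 / (14 * (K + 1))"
    using s(1) K by (auto simp: \<eta>_def)
  have in2: "(x, y) \<in> ?O" if "x \<in> cball p s" "y \<in> cball p s" for x y
  proof -
    have "dist (p, p) (x, y) \<le> dist p x + dist p y"
      unfolding dist_Pair_Pair by (rule sqrt_sum_squares_le_sum) auto
    also have "\<dots> \<le> d" using that s(3) by auto
    finally show ?thesis using d(2) by auto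
  qed
  have W': "g \<in> U" "\<phi> g \<in> cball p r" if "g \<in> ?W" for g
  proof -
    obtain b where "b \<in> ball p r" "g = \<psi> b" using \<open>g \<in> ?W\<close> by blast
    then show "g \<in> U" "\<phi> g \<in> cball p r" using ball psi_in phi_psi by (auto simp: subset_iff)
  qed
  have "lie_exp G T A U \<phi> r s \<eta> K"
  proof (unfold_locales)
    have "K * s \<le> K * (1 / (5 * (K + 1)))" using s(4) K by (rule mult_left_mono)
    also have "\<dots> \<le> 1 / 5" using K by (simp add: field_simps)
    finally show "K * s \<le> 1 / 5" .
    have "14 * K * \<eta> \<le> 14 * K * (1 / (14 * (K + 1)))" using \<eta>(3) K by (intro mult_left_mono) auto
    also have "\<dots> \<le> 1" using K by (simp add: field_simps)
    finally show "14 * K * \<eta> \<le> 1" .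
    show "norm (L x w - L y w) \<le> K * norm (x - y) * norm w" if "x \<in> cball p r" "y \<in> cball p r" for x y w
      using lip[OF in1(1)[OF that(1)] in1(1)[OF that(2)], of "(0, w)"] by (simp add: L_def norm_Pair)
    show "norm (R x w - w) \<le> K * norm (x - p) * norm w" if "x \<in> cball p r" for x w
      using lip[OF in1(2)[OF that] in1(2)[of p], of "(w, 0)"] r R_p[of w] by (simp add: R_def norm_Pair)
    show "(x, y) \<in> \<Omega> \<and> m x y \<in> cball p r" if "x \<in> cball p s" "y \<in> cball p s" for x y
      using in2[OF that] W' by (simp add: \<Omega>_iff m_def)
    show "inv (\<psi> x) \<in> U" if "x \<in> cball p s" for x
      using in2[OF that that] by simp
    show "\<psi> x \<otimes> \<psi> y \<otimes> inv (\<psi> x) \<in> U \<and> conjugate x y \<in> cball p r" if "x \<in> cball p s" "y \<in> cball p s" for x y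
      using in2[OF that] W' by (simp add: conjugate_def)
  qed (use K s \<eta> rE in auto)
  then show ?thesis by blast
qed

end

section \<open>Normal pseudo-discrete subgroups\<close>

context lie_exp
begin

lemma nbhd_one:
  assumes "0 < \<delta>" "\<delta> \<le> \<eta>"
  shows "openin T (\<psi> ` ball p \<delta>)" "\<one> \<in> \<psi> ` ball p \<delta>"
proof -
  have "ball p \<delta> \<subseteq> E" using s_in \<eta> assms by (auto simp: subset_iff)
  then show "openin T (\<psi> ` ball p \<delta>)" by (rule openin_psi_image[OF open_ball])
  show "\<one> \<in> \<psi> ` ball p \<delta>" using assms(1) psi_p by (intro image_eqI[of _ _ p]) auto
qed

lemma sol_carrier: "sol v c \<Longrightarrow> t \<in> {-1..1} \<Longrightarrow> \<psi> (c t) \<in> carrier G"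
  by (intro psi_carrier s_in sol_s)

lemma sol_uminus:
  assumes "norm v \<le> 2 * \<eta>" "sol v c" "t \<in> {-1..1}"
  shows "\<psi> (c (- t)) = inv (\<psi> (c t))"
proof -
  have "\<psi> (c (- t + t)) = \<psi> (c (- t)) \<otimes> \<psi> (c t)"
    using assms by (intro sol_mult) auto
  then have "\<psi> (c (- t)) \<otimes> \<psi> (c t) = \<one>"
    using sol_0[OF assms(2)] psi_p by simp
  then show ?thesis
    using sol_carrier[OF assms(2)] assms(3) by (intro inv_equality[symmetric]) auto
qed

lemma pseudo_discrete_normal_central:
  assumes conn: "connected_space T" and N: "N \<lhd> G" and pd: "pseudo_discrete G T A N"
    and n: "n \<in> N" and h: "h \<in> carrier G"
  shows "n \<otimes> h = h \<otimes> n"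
proof (rule central_if_commutes_near_one[OF conn _ nbhd_one[OF \<eta>(1) order_refl] _ h])
  interpret N: normal N G by (rule N)
  show nG: "n \<in> carrier G" using n by (rule N.mem_carrier)
  fix g assume "g \<in> \<psi> ` ball p \<eta>"
  then obtain y where "y \<in> ball p \<eta>" "g = \<psi> y" by blast
  then have y: "y \<in> cball p \<eta>" "g = \<psi> y" by auto
  obtain v c where v: "norm v \<le> 2 * \<eta>" and c: "sol v c" and cy: "c 1 = y"
    using log_ex[OF \<eta>(1) order_refl y(1)] .
  let ?I = "{-1<..<1} :: real set"
  let ?\<gamma> = "\<lambda>t. \<psi> (c t) \<otimes> n \<otimes> inv (\<psi> (c t))"
  have car: "\<psi> (c t) \<in> carrier G" if "t \<in> ?I" for t
    using that by (intro sol_carrier[OF c]) auto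
  have sc: "smooth_curve ?I (\<lambda>t. \<psi> (c t))"
    by (rule sol_smooth_curve[OF c]) auto
  have "smooth_curve ?I ?\<gamma>"
    using sc nG by (intro smooth_curve_mult smooth_curve_inv smooth_curve_const) auto
  moreover have "?\<gamma> ` ?I \<subseteq> N"
    using n car N.inv_op_closed2 by blast
  moreover have "is_interval ?I" by (simp add: is_interval_1)
  ultimately have "?\<gamma> constant_on ?I"
    using pd open_greaterThanLessThan unfolding pseudo_discrete_def smooth_curve_def by blast
  then obtain k where k: "\<And>t. t \<in> ?I \<Longrightarrow> ?\<gamma> t = k"
    unfolding constant_on_def by blast
  let ?h = "\<psi> (c (1/2))"
  have hG: "?h \<in> carrier G" using car by simp
  have "?h \<otimes> n \<otimes> inv ?h = n"
    using k[of 0] k[of "1/2"] sol_0[OF c] psi_p nG by simp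
  then have "?h \<otimes> n \<otimes> inv ?h \<otimes> ?h = n \<otimes> ?h" by simp
  then have comm: "?h \<otimes> n = n \<otimes> ?h" using hG nG by (simp add: m_assoc)
  have "\<psi> (c (1/2 + 1/2)) = ?h \<otimes> ?h"
    by (rule sol_mult[OF v c]) auto
  then have g: "g = ?h \<otimes> ?h" using cy y(2) by simp
  have "n \<otimes> (?h \<otimes> ?h) = (n \<otimes> ?h) \<otimes> ?h" using hG nG by (simp add: m_assoc)
  also have "\<dots> = (?h \<otimes> n) \<otimes> ?h" by (simp only: comm)
  also have "\<dots> = ?h \<otimes> (n \<otimes> ?h)" using hG nG by (simp add: m_assoc)
  also have "\<dots> = ?h \<otimes> (?h \<otimes> n)" by (simp only: comm)
  also have "\<dots> = (?h \<otimes> ?h) \<otimes> n" using hG nG by (simp add: m_assoc)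
  finally show "n \<otimes> g = g \<otimes> n" by (simp only: g)
qed

lemma sol_eq_p_imp:
  assumes c: "sol v c" and t: "t \<in> {-1..1}" and ct: "c t = p" and v: "v \<noteq> 0"
  shows "t = 0"
proof -
  let ?f = "\<lambda>t. c t - t *\<^sub>R v"
  have "norm (?f t - ?f 0) \<le> (1 / 5 * norm v) * \<bar>t - 0\<bar>"
  proof (rule has_vector_derivative_norm_bound[where J="{-1..1}"])
    show "(?f has_vector_derivative L (c t) v - v) (at t within {-1..1})" if "t \<in> {-1..1}" for t
      using sol_deriv[OF c that] by (auto intro!: derivative_eq_intros)
    show "norm (L (c t) v - v) \<le> 1 / 5 * norm v" if "t \<in> {-1..1}" for t
      by (rule L_near_s[OF sol_s[OF c that]])
  qed (use t in auto)
  then have "\<bar>t\<bar> * norm v \<le> 1 / 5 * (\<bar>t\<bar> * norm v)"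
    by (simp add: ct sol_0[OF c])
  then have "\<bar>t\<bar> * norm v = 0"
    using mult_nonneg_nonneg[OF abs_ge_zero norm_ge_zero, of t v] by linarith
  then show ?thesis using v by simp
qed

lemma sol_inj:
  assumes v: "norm v \<le> 2 * \<eta>" "v \<noteq> 0" and c: "sol v c"
    and st: "a \<in> {-1..1}" "b \<in> {-1..1}" "a - b \<in> {-1..1}" and eq: "\<psi> (c a) = \<psi> (c b)"
  shows "a = b"
proof -
  have "\<psi> (c (a + - b)) = \<psi> (c a) \<otimes> \<psi> (c (- b))"
    using st by (intro sol_mult[OF v(1) c]) auto
  also have "\<dots> = \<one>"
    using sol_uminus[OF v(1) c st(2)] eq sol_carrier[OF c st(2)] by simp
  finally have "\<psi> (c (a - b)) = \<psi> p" using psi_p by simp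
  then have "c (a - b) = p"
    using psi_inj[OF s_in[OF sol_s[OF c st(3)]] p_in] by simp
  from sol_eq_p_imp[OF c st(3) this v(2)] show ?thesis by simp
qed

lemma sol_zero_vector:
  assumes "sol 0 c" "t \<in> {-1..1}"
  shows "c t = p"
proof -
  have "norm (c t - c 0) \<le> 0 * \<bar>t - 0\<bar>"
  proof (rule has_vector_derivative_norm_bound[OF _ sol_deriv[OF assms(1)]])
    show "norm (L (c u) 0) \<le> 0" if "u \<in> {-1..1}" for u
      using linear_0[OF L_linear[OF s_in[OF sol_s[OF assms(1) that]]]] by simp
  qed (use assms in auto)
  then show ?thesis using sol_0[OF assms(1)] by simp
qed

text \<open>
  If \<open>N\<close> lies locally on the one-parameter subgroup \<open>c\<close> but contains no initial piece of it, then
  \<open>N\<close> is cut off by a pair of missing points \<open>c (-a)\<close>, \<open>c a\<close>, and the bounded piece between them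
  contains no nontrivial subgroup.
\<close>

lemma subgroup_of_curve_trivial:
  assumes v: "norm v \<le> 2 * \<eta>" "v \<noteq> 0" and c: "sol v c"
    and N: "subgroup N G" "connectedin T N"
    and local: "\<And>\<epsilon>. \<epsilon> > 0 \<Longrightarrow> \<exists>W. openin T W \<and> \<one> \<in> W \<and> (\<forall>g\<in>N \<inter> W. \<exists>b. \<bar>b\<bar> \<le> \<epsilon> \<and> g = \<psi> (c b))"
    and a: "0 < a" "3 * a \<le> 1" "\<psi> (c a) \<notin> N"
  shows "N = {\<one>}"
proof -
  interpret N: subgroup N G by (rule N(1))
  define P where "P = (\<lambda>t. \<psi> (c t)) ` {-a..a}"
  have a1: "t \<in> {-1<..<1}" if "t \<in> {-a..a}" for t using a that by auto
  have "continuous_map (top_of_set {-1<..<1}) T (\<lambda>t. \<psi> (c t))"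
    by (intro smooth_curve_continuous sol_smooth_curve[OF c]) auto
  then have "continuous_map (subtopology (top_of_set {-1<..<1}) {-a..a}) T (\<lambda>t. \<psi> (c t))"
    by (rule continuous_map_from_subtopology)
  then have "continuous_map (top_of_set {-a..a}) T (\<lambda>t. \<psi> (c t))"
    using a1 by (simp add: subtopology_subtopology Int_absorb1 subset_iff)
  then have "compactin T P"
    unfolding P_def by (intro image_compactin[of "top_of_set {-a..a}"]) (auto simp: compactin_subtopology)
  then have P: "closedin T P" by (rule compactin_imp_closedin[OF Hausdorff])
  have notN: "\<psi> (c t) \<notin> N" if "\<bar>t\<bar> = a" for t
  proof -
    have "a \<in> {-1..1}" using a by simp
    from sol_uminus[OF v(1) c this] a(3) sol_carrier[OF c this] show ?thesis
      using that N.m_inv_closed[of "inv (\<psi> (c a))"] by (auto simp: abs_if split: if_splits)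
  qed
  have "openin (subtopology T N) (N \<inter> P)"
    unfolding openin_subopen[of _ "N \<inter> P"]
  proof
    fix g assume g: "g \<in> N \<inter> P"
    then obtain b where b: "g = \<psi> (c b)" "b \<in> {-a..a}" by (auto simp: P_def)
    have "\<bar>b\<bar> \<noteq> a" using notN[of b] g b(1) by auto
    with b(2) have ba: "a - \<bar>b\<bar> > 0" by auto
    obtain W where W: "openin T W" "\<one> \<in> W" "\<And>h. h \<in> N \<inter> W \<Longrightarrow> \<exists>b'. \<bar>b'\<bar> \<le> a - \<bar>b\<bar> \<and> h = \<psi> (c b')"
      using local[OF ba] by blast
    have gG: "g \<in> carrier G" using g N.mem_carrier by blast
    let ?V = "{x \<in> carrier G. inv g \<otimes> x \<in> W}"
    have "N \<inter> ?V \<subseteq> N \<inter> P"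
    proof
      fix x assume x: "x \<in> N \<inter> ?V"
      then have "inv g \<otimes> x \<in> N \<inter> W" using g by auto
      from W(3)[OF this] obtain b' where b': "\<bar>b'\<bar> \<le> a - \<bar>b\<bar>" "inv g \<otimes> x = \<psi> (c b')" by blast
      have bb: "b + b' \<in> {-a..a}" using b'(1) b(2) by auto
      have "x = g \<otimes> (inv g \<otimes> x)" using x gG by (simp add: m_assoc[symmetric])
      also have "\<dots> = \<psi> (c b) \<otimes> \<psi> (c b')" unfolding b'(2) by (simp only: b(1))
      also have "\<dots> = \<psi> (c (b + b'))"
        using b' b(2) bb a by (intro sol_mult[OF v(1) c, symmetric]) auto
      finally show "x \<in> N \<inter> P" using x bb by (auto simp: P_def)
    qed
    moreover have "openin (subtopology T N) (N \<inter> ?V)"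
      using openin_left_translate[OF W(1) gG] by (rule openin_subtopology_Int2)
    moreover have "g \<in> N \<inter> ?V" using g gG W(2) by simp
    ultimately show "\<exists>V. openin (subtopology T N) V \<and> g \<in> V \<and> V \<subseteq> N \<inter> P" by blast
  qed
  moreover have "closedin (subtopology T N) (N \<inter> P)"
    using P by (rule closedin_subtopology_Int_closed)
  moreover have "\<one> \<in> N \<inter> P"
    using a(1) sol_0[OF c] psi_p by (auto simp: P_def intro!: image_eqI[of _ _ 0])
  moreover have "topspace (subtopology T N) = N"
    using N.subset topspace_eq by auto
  ultimately have "N \<inter> P = N"
    using N(2) unfolding connectedin_def connected_space_clopen_in by blast
  then have NP: "\<exists>b. \<bar>b\<bar> \<le> a \<and> g = \<psi> (c b)" if "g \<in> N" for g
  proof -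
    have "g \<in> P" using \<open>N \<inter> P = N\<close> that by blast
    then obtain b where "g = \<psi> (c b)" "b \<in> {-a..a}" unfolding P_def by (rule imageE)
    then show ?thesis by (intro exI[of _ b]) (auto simp: abs_le_iff)
  qed
  have "g = \<one>" if g: "g \<in> N" for g
  proof -
    obtain b where b: "\<bar>b\<bar> \<le> a" "g = \<psi> (c b)" using NP[OF g] by blast
    have pow: "2 ^ k * \<bar>b\<bar> \<le> a \<and> \<psi> (c (2 ^ k * b)) \<in> N" for k
    proof (induction k)
      case 0
      then show ?case using b g by simp
    next
      case (Suc k)
      define d where "d = 2 ^ k * b"
      have abs: "\<bar>d\<bar> \<le> a" and dN: "\<psi> (c d) \<in> N" using Suc by (simp_all add: abs_mult d_def)
      have "\<psi> (c (d + d)) = \<psi> (c d) \<otimes> \<psi> (c d)"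
        using abs a by (intro sol_mult[OF v(1) c]) (auto simp: abs_le_iff)
      then have inN: "\<psi> (c (d + d)) \<in> N" using dN by simp
      obtain b' where b': "\<bar>b'\<bar> \<le> a" "\<psi> (c (d + d)) = \<psi> (c b')" using NP[OF inN] by blast
      have "d + d = b'"
        using abs a b'(1) by (intro sol_inj[OF v c _ _ _ b'(2)]) (auto simp: abs_le_iff)
      then have "\<bar>d + d\<bar> \<le> a" using b'(1) by simp
      moreover have "2 ^ Suc k * b = d + d" by (simp add: d_def)
      moreover from this have "2 ^ Suc k * \<bar>b\<bar> = \<bar>d + d\<bar>" by (metis abs_mult abs_numeral power_abs)
      ultimately show ?case using inN by (simp del: power_Suc)
    qed
    have "b = 0"
    proof (rule ccontr)
      assume "b \<noteq> 0"
      then obtain k where "a / \<bar>b\<bar> < 2 ^ k" using real_arch_pow[of 2 "a / \<bar>b\<bar>"] by auto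
      then have "a < 2 ^ k * \<bar>b\<bar>" using \<open>b \<noteq> 0\<close> by (simp add: divide_less_eq)
      with pow[of k] show False by simp
    qed
    then show ?thesis using b sol_0[OF c] psi_p by simp
  qed
  then show ?thesis using N.one_closed by auto
qed

lemma pseudo_discrete_normal_trivial:
  assumes conn: "connected_space T" and N: "N \<lhd> G" "connectedin T N" "pseudo_discrete G T A N"
    and dim: "lie_center G (U, \<phi>) \<subseteq> span {e}" and e: "e \<in> lie_center G (U, \<phi>)"
  shows "N = {\<one>}"
proof -
  interpret N: normal N G by (rule N(1))
  have sub: "subgroup N G" by (rule N.is_subgroup)
  note central = pseudo_discrete_normal_central[OF conn N(1,3)]
  have log: "\<exists>v c. norm v \<le> 2 * \<delta> \<and> sol v c \<and> g = \<psi> (c 1) \<and> v \<in> lie_center G (U, \<phi>)"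
    if g: "g \<in> N \<inter> \<psi> ` ball p \<delta>" and \<delta>: "0 < \<delta>" "\<delta> \<le> \<eta>" for g \<delta>
  proof -
    obtain y where "y \<in> ball p \<delta>" "g = \<psi> y" using g by blast
    then have y: "y \<in> cball p \<delta>" "g = \<psi> y" by auto
    obtain v c where v: "norm v \<le> 2 * \<delta>" and c: "sol v c" and cy: "c 1 = y"
      using log_ex[OF \<delta> y(1)] .
    have "v \<in> lie_center G (U, \<phi>)"
      using v \<delta> g central y(2) cy by (intro central_imp_lie_center[OF _ c]) auto
    then show ?thesis using v c cy y(2) by blast
  qed
  show ?thesis
  proof (cases "e = 0")
    case True
    have one: "g = \<one>" if g: "g \<in> N \<inter> \<psi> ` ball p \<eta>" for g
    proof -
      obtain v c where "sol v c" "g = \<psi> (c 1)" "v \<in> lie_center G (U, \<phi>)"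
        using log[OF g \<eta>(1) order_refl] by blast
      moreover from this dim True have "v = 0" by auto
      ultimately show ?thesis using sol_zero_vector[of c 1] psi_p by simp
    qed
    have top: "topspace (subtopology T N) = N"
      using N.subset topspace_eq by auto
    have "N \<inter> \<psi> ` ball p \<eta> = {\<one>}"
      using one N.one_closed nbhd_one(2)[OF \<eta>(1) order_refl] by blast
    then have "openin (subtopology T N) {\<one>}"
      using openin_subtopology_Int2[OF nbhd_one(1)[OF \<eta>(1) order_refl], of N] by simp
    moreover have "closedin (subtopology T N) {\<one>}"
      using closedin_Hausdorff_singleton[OF Hausdorff_space_subtopology[OF Hausdorff], of \<one> N] topspace_eq N.one_closed
      by simp
    ultimately show ?thesis
      using N(2) top unfolding connectedin_def connected_space_clopen_in by blast
  next
    case False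
    define v where "v = (\<eta> / norm e) *\<^sub>R e"
    have nv: "norm v = \<eta>" using False \<eta>(1) by (simp add: v_def)
    then have v: "norm v \<le> 2 * \<eta>" "v \<noteq> 0" using \<eta>(1) by auto
    obtain c where c: "sol v c" using sol_ex[of v] nv by auto
    have local: "\<exists>W. openin T W \<and> \<one> \<in> W \<and> (\<forall>g\<in>N \<inter> W. \<exists>b. \<bar>b\<bar> \<le> \<epsilon> \<and> g = \<psi> (c b))"
      if \<epsilon>: "\<epsilon> > 0" for \<epsilon>
    proof -
      define \<delta> where "\<delta> = min 1 \<epsilon> * \<eta> / 2"
      have \<delta>: "0 < \<delta>" "\<delta> \<le> \<eta>"
        using \<epsilon> \<eta>(1) mult_right_mono[of "min 1 \<epsilon>" 1 \<eta>] by (auto simp: \<delta>_def)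
      have "\<exists>b. \<bar>b\<bar> \<le> \<epsilon> \<and> g = \<psi> (c b)" if g: "g \<in> N \<inter> \<psi> ` ball p \<delta>" for g
      proof -
        obtain w d where w: "norm w \<le> 2 * \<delta>" and d: "sol w d" and gd: "g = \<psi> (d 1)"
          and wz: "w \<in> lie_center G (U, \<phi>)"
          using log[OF g \<delta>] by blast
        obtain k where "w = k *\<^sub>R e" using wz dim by (auto simp: span_singleton)
        then have w_eq: "w = (k * norm e / \<eta>) *\<^sub>R v" using False \<eta>(1) by (simp add: v_def)
        define b where "b = k * norm e / \<eta>"
        have "\<bar>b\<bar> * \<eta> \<le> min 1 \<epsilon> * \<eta>"
          using w nv unfolding w_eq b_def[symmetric] by (simp add: \<delta>_def)
        then have b: "\<bar>b\<bar> \<le> 1" "\<bar>b\<bar> \<le> \<epsilon>" using \<eta>(1) by auto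
        have sb: "sol w (\<lambda>t. c (b * t))"
          using sol_scaleR[OF c b(1)] w_eq b_def by simp
        have w2: "norm w \<le> 2 * \<eta>" using w \<delta>(2) by simp
        have "c (b * 1) = d 1"
          using sol_0[OF sb] sol_s[OF sb] sol_deriv[OF sb] s_sub
          by (intro sol_unique[OF w2 d, of "\<lambda>t. c (b * t)" 1]) auto
        then show ?thesis using b(2) gd by auto
      qed
      then show ?thesis using nbhd_one[OF \<delta>] by blast
    qed
    show ?thesis
    proof (rule ccontr)
      assume nontriv: "N \<noteq> {\<one>}"
      have inN: "\<psi> (c a) \<in> N" if "0 < a" "3 * a \<le> 1" for a
        using subgroup_of_curve_trivial[OF v c sub N(2) local that] nontriv by blast
      let ?I = "{0<..<1/3} :: real set"
      have "smooth_curve ?I (\<lambda>t. \<psi> (c t))"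
        by (rule sol_smooth_curve[OF c]) auto
      moreover have "(\<lambda>t. \<psi> (c t)) ` ?I \<subseteq> N" using inN by auto
      moreover have "is_interval ?I" by (simp add: is_interval_1)
      ultimately have "(\<lambda>t. \<psi> (c t)) constant_on ?I"
        using N(3) open_greaterThanLessThan unfolding pseudo_discrete_def smooth_curve_def by blast
      then have "\<psi> (c (1/9)) = \<psi> (c (2/9))"
        unfolding constant_on_def by fastforce
      then have "1/9 = (2/9 :: real)"
        by (intro sol_inj[OF v c]) auto
      then show False by simp
    qed
  qed
qed

end

section \<open>Two independent central directions\<close>

lemma countable_if_separated:
  fixes S :: "'a::{metric_space, second_countable_topology} set"
  assumes "\<rho> > 0" and sep: "\<And>x y. x \<in> S \<Longrightarrow> y \<in> S \<Longrightarrow> x \<noteq> y \<Longrightarrow> \<rho> \<le> dist x y"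
  shows "countable S"
proof -
  let ?f = "\<lambda>x. ball x (\<rho> / 2)"
  have disj: "disjnt (?f x) (?f y)" if "x \<in> S" "y \<in> S" "x \<noteq> y" for x y
    unfolding disjnt_iff
  proof (intro allI notI, elim conjE)
    fix z assume "z \<in> ?f x" "z \<in> ?f y"
    then have "dist x z + dist z y < \<rho>" by (simp add: dist_commute)
    with sep[OF that] dist_triangle[of x y z] show False by simp
  qed
  have "inj_on ?f S"
  proof (rule inj_onI, rule ccontr)
    fix x y assume "x \<in> S" "y \<in> S" "?f x = ?f y" "x \<noteq> y"
    then show False using disj[of x y] assms(1) by (auto simp: disjnt_def)
  qed
  moreover have "countable (?f ` S)"
    by (rule countable_disjoint_open_subsets) (use disj in \<open>auto simp: pairwise_def\<close>)
  ultimately show ?thesis by (rule countable_image_inj_on[rotated])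
qed

lemma independent_pair_lower_bound:
  fixes e1 e2 :: "'a::real_normed_vector"
  assumes ind: "independent {e1, e2}" and ne: "e1 \<noteq> e2"
  obtains \<delta> where "\<delta> > 0" "\<And>z :: real \<times> real. \<delta> * norm z \<le> norm (fst z *\<^sub>R e1 + snd z *\<^sub>R e2)"
proof -
  let ?f = "\<lambda>z :: real \<times> real. norm (fst z *\<^sub>R e1 + snd z *\<^sub>R e2)"
  have "compact (sphere (0 :: real \<times> real) 1)" by simp
  moreover have "(1, 0) \<in> sphere (0 :: real \<times> real) 1" by (simp add: norm_Pair)
  moreover have "continuous_on (sphere 0 1) ?f" by (intro continuous_intros)
  ultimately obtain z0 where z0: "z0 \<in> sphere 0 1" "\<And>z. z \<in> sphere 0 1 \<Longrightarrow> ?f z0 \<le> ?f z"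
    using continuous_attains_inf[of "sphere 0 1" ?f] by blast
  have "?f z0 > 0"
  proof (rule ccontr)
    assume "\<not> ?f z0 > 0"
    then have eq: "fst z0 *\<^sub>R e1 + snd z0 *\<^sub>R e2 = 0" by simp
    have e1: "e1 \<notin> span {e2}" and e2: "e2 \<noteq> 0"
      using ind ne by (auto simp: independent_insert)
    have "fst z0 = 0"
    proof (rule ccontr)
      assume "fst z0 \<noteq> 0"
      have "fst z0 *\<^sub>R e1 = - (snd z0 *\<^sub>R e2)" using eq by (simp add: eq_neg_iff_add_eq_0)
      then have "(1 / fst z0) *\<^sub>R (fst z0 *\<^sub>R e1) = (- snd z0 / fst z0) *\<^sub>R e2" by simp
      then have "e1 = (- snd z0 / fst z0) *\<^sub>R e2" using \<open>fst z0 \<noteq> 0\<close> by simp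
      then show False using e1 by (metis span_base span_scale singletonI)
    qed
    with eq e2 have "snd z0 = 0" by simp
    with \<open>fst z0 = 0\<close> have "z0 = 0" by (simp add: prod_eq_iff)
    with z0(1) show False by simp
  qed
  moreover have "?f z0 * norm z \<le> ?f z" for z
  proof (cases "z = 0")
    case False
    then have "?f z0 \<le> ?f (z /\<^sub>R norm z)" by (intro z0(2)) simp
    also have "\<dots> = norm (inverse (norm z) *\<^sub>R (fst z *\<^sub>R e1 + snd z *\<^sub>R e2))"
      by (simp add: scaleR_add_right)
    also have "\<dots> = ?f z / norm z" by (simp add: divide_inverse mult.commute)
    finally show ?thesis using False by (simp add: le_divide_eq)
  qed simp
  ultimately show thesis using that by blast
qed

context lie_exp
begin

text \<open>
  The local one-parameter subgroup is extended by \<open>t \<mapsto> (exp v)\<^bsup>\<lfloor>t\<rfloor>\<^esup> exp ((t - \<lfloor>t\<rfloor>) v)\<close>; centrality of the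
  image makes this a homomorphism.
\<close>

lemma central_one_parameter_subgroup:
  assumes conn: "connected_space T" and v: "norm v \<le> \<eta>" "v \<in> lie_center G (U, \<phi>)"
  shows "\<exists>c g. sol v c \<and> (\<forall>t :: real. g t \<in> carrier G) \<and>
    (\<forall>t. \<forall>h\<in>carrier G. g t \<otimes> h = h \<otimes> g t) \<and> (\<forall>a b. g (a + b) = g a \<otimes> g b) \<and>
    (\<forall>t. \<bar>t\<bar> < 1 \<longrightarrow> g t = \<psi> (c t)) \<and> continuous_map euclidean T g"
proof -
  obtain c where c: "sol v c" using sol_ex[OF v(1)] .
  have v2: "norm v \<le> 2 * \<eta>" using v(1) \<eta>(1) by simp
  define Y where "Y t = \<psi> (c t)" for t
  have Yc: "Y t \<in> carrier G" if "t \<in> {-1..1}" for t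
    unfolding Y_def by (rule sol_carrier[OF c that])
  have Yz: "Y t \<otimes> h = h \<otimes> Y t" if "t \<in> {-1..1}" "h \<in> carrier G" for t h
    unfolding Y_def by (rule sol_central[OF conn v2 v(2) c that])
  have Ym: "Y (a + b) = Y a \<otimes> Y b" if "a \<in> {-1..1}" "b \<in> {-1..1}" "a + b \<in> {-1..1}" for a b
    unfolding Y_def by (rule sol_mult[OF v2 c that])
  define x where "x = Y 1"
  have xc: "x \<in> carrier G" using Yc by (simp add: x_def)
  have pc: "x [^] (i::int) \<in> carrier G" for i using xc by (rule int_pow_closed)
  have pz: "x [^] (i::int) \<otimes> h = h \<otimes> x [^] i" if h: "h \<in> carrier G" for i h
  proof -
    have "x \<in> {z \<in> carrier G. h \<otimes> z = z \<otimes> h}"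
      using Yz[of 1 h] h xc by (simp add: x_def)
    from subgroup_int_pow_closed[OF subgroup_commutant[OF h] this, of i] show ?thesis by simp
  qed
  have fr: "frac t \<in> {-1..1}" for t :: real
    by (simp add: order_trans[OF _ frac_ge_0[of t]] less_imp_le[OF frac_lt_1])
  define g where "g t = x [^] \<lfloor>t\<rfloor> \<otimes> Y (frac t)" for t :: real
  have gc: "g t \<in> carrier G" for t
    unfolding g_def using pc Yc[OF fr] by simp
  have gz: "g t \<otimes> h = h \<otimes> g t" if h: "h \<in> carrier G" for t h
  proof -
    have "g t \<otimes> h = x [^] \<lfloor>t\<rfloor> \<otimes> (Y (frac t) \<otimes> h)"
      using pc Yc[OF fr] h by (simp add: g_def m_assoc)
    also have "\<dots> = x [^] \<lfloor>t\<rfloor> \<otimes> (h \<otimes> Y (frac t))" by (simp only: Yz[OF fr h])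
    also have "\<dots> = (x [^] \<lfloor>t\<rfloor> \<otimes> h) \<otimes> Y (frac t)" using pc Yc[OF fr] h by (simp add: m_assoc)
    also have "\<dots> = (h \<otimes> x [^] \<lfloor>t\<rfloor>) \<otimes> Y (frac t)" by (simp only: pz[OF h])
    also have "\<dots> = h \<otimes> g t" using pc Yc[OF fr] h by (simp add: g_def m_assoc)
    finally show ?thesis .
  qed
  have gm: "g (a + b) = g a \<otimes> g b" for a b
  proof -
    have "g a \<otimes> g b = x [^] \<lfloor>a\<rfloor> \<otimes> (Y (frac a) \<otimes> x [^] \<lfloor>b\<rfloor>) \<otimes> Y (frac b)"
      using pc Yc[OF fr] by (simp add: g_def m_assoc)
    also have "\<dots> = x [^] \<lfloor>a\<rfloor> \<otimes> (x [^] \<lfloor>b\<rfloor> \<otimes> Y (frac a)) \<otimes> Y (frac b)"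
      by (simp only: Yz[OF fr pc])
    also have "\<dots> = (x [^] \<lfloor>a\<rfloor> \<otimes> x [^] \<lfloor>b\<rfloor>) \<otimes> (Y (frac a) \<otimes> Y (frac b))"
      using pc Yc[OF fr] by (simp add: m_assoc)
    also have "\<dots> = x [^] (\<lfloor>a\<rfloor> + \<lfloor>b\<rfloor>) \<otimes> (Y (frac a) \<otimes> Y (frac b))"
      using xc by (simp add: int_pow_mult)
    also have "\<dots> = g (a + b)"
    proof (cases "frac a + frac b < 1")
      case True
      then have fl: "\<lfloor>a + b\<rfloor> = \<lfloor>a\<rfloor> + \<lfloor>b\<rfloor>" "frac (a + b) = frac a + frac b"
        by (simp_all add: floor_add frac_add)
      have "frac a + frac b \<in> {-1..1}"
        unfolding atLeastAtMost_iff using True frac_ge_0[of a] frac_ge_0[of b] by linarith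
      then have "Y (frac a + frac b) = Y (frac a) \<otimes> Y (frac b)"
        by (intro Ym fr)
      then show ?thesis by (simp add: g_def fl)
    next
      case False
      then have fl: "\<lfloor>a + b\<rfloor> = \<lfloor>a\<rfloor> + \<lfloor>b\<rfloor> + 1" "frac (a + b) = frac a + frac b - 1"
        by (simp_all add: floor_add frac_add)
      have r1: "frac a + frac b - 1 \<in> {-1..1}" "1 - frac b \<in> {-1..1}"
        unfolding atLeastAtMost_iff
        using frac_ge_0[of a] frac_ge_0[of b] frac_lt_1[of a] frac_lt_1[of b] by linarith+
      have "Y ((frac a + frac b - 1) + (1 - frac b)) = Y (frac a + frac b - 1) \<otimes> Y (1 - frac b)"
        using r1 fr[of a] by (intro Ym) auto
      then have 1: "Y (frac a) = Y (frac (a + b)) \<otimes> Y (1 - frac b)" by (simp add: fl)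
      have "Y ((1 - frac b) + frac b) = Y (1 - frac b) \<otimes> Y (frac b)"
        using r1 fr by (intro Ym) auto
      then have 2: "Y (1 - frac b) \<otimes> Y (frac b) = x" by (simp add: x_def)
      have "Y (frac a) \<otimes> Y (frac b) = Y (frac (a + b)) \<otimes> (Y (1 - frac b) \<otimes> Y (frac b))"
        unfolding 1 using Yc[OF fr] Yc[OF r1(2)] by (simp add: m_assoc)
      also have "\<dots> = x \<otimes> Y (frac (a + b))"
        unfolding 2 using Yz[OF fr xc] by simp
      finally have 3: "Y (frac a) \<otimes> Y (frac b) = x \<otimes> Y (frac (a + b))" .
      have "x [^] (\<lfloor>a\<rfloor> + \<lfloor>b\<rfloor>) \<otimes> (x \<otimes> Y (frac (a + b))) = x [^] (\<lfloor>a\<rfloor> + \<lfloor>b\<rfloor> + 1) \<otimes> Y (frac (a + b))"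
        using xc Yc[OF fr] int_pow_mult[OF xc, of "\<lfloor>a\<rfloor> + \<lfloor>b\<rfloor>" 1] by (simp add: m_assoc int_pow_1)
      then show ?thesis unfolding 3 by (simp add: g_def fl(1))
    qed
    finally show ?thesis by simp
  qed
  have gY: "g t = Y t" if t: "t \<in> {-1<..<1}" for t
  proof (cases "t \<ge> 0")
    case True
    then have "\<lfloor>t\<rfloor> = 0" using t by (simp add: floor_eq_iff)
    then show ?thesis
      using Yc[of t] t by (simp add: g_def frac_def)
  next
    case False
    then have fl: "\<lfloor>t\<rfloor> = -1" using t by (simp add: floor_eq_iff)
    have "Y (t + 1) = Y t \<otimes> x" unfolding x_def using t False by (intro Ym) auto
    also have "\<dots> = x \<otimes> Y t" using Yz[of t x] xc t by auto
    finally have "g t = inv x \<otimes> (x \<otimes> Y t)"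
      using xc by (simp add: g_def frac_def fl int_pow_neg int_pow_1)
    then show ?thesis using xc Yc[of t] t by (simp add: m_assoc[symmetric])
  qed
  have Ycont: "continuous_map (top_of_set {-1<..<1}) T Y"
    unfolding Y_def by (intro smooth_curve_continuous sol_smooth_curve[OF c]) auto
  have "continuous_map euclidean T g"
    unfolding continuous_map_def
  proof (intro conjI allI impI)
    show "g \<in> topspace euclidean \<rightarrow> topspace T" using gc topspace_eq by auto
    fix W assume W: "openin T W"
    have "\<exists>S. open S \<and> t0 \<in> S \<and> S \<subseteq> {t. g t \<in> W}" if t0: "g t0 \<in> W" for t0
    proof -
      have "continuous_map (top_of_set {-1<..<1}) T (\<lambda>t. g t0 \<otimes> Y t)"
        using gc topspace_eq by (intro continuous_map_mult Ycont) (simp add: continuous_map_const)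
      from openin_continuous_map_preimage[OF this W]
      have "open {t \<in> {-1<..<1}. g t0 \<otimes> Y t \<in> W}"
        using openin_open_trans[OF _ open_greaterThanLessThan] by simp
      then have "open ((\<lambda>t. t - t0) -` {t \<in> {-1<..<1}. g t0 \<otimes> Y t \<in> W})"
        by (intro open_vimage continuous_intros)
      moreover have "g t0 \<otimes> Y 0 = g t0" using gc sol_0[OF c] psi_p by (simp add: Y_def)
      moreover have "g t0 \<otimes> Y (t - t0) = g t" if "t - t0 \<in> {-1<..<1}" for t
        using gm[of t0 "t - t0"] gY[of "t - t0"] that by simp
      ultimately show ?thesis
        using t0 by (intro exI[of _ "(\<lambda>t. t - t0) -` {t \<in> {-1<..<1}. g t0 \<otimes> Y t \<in> W}"]) auto
    qed
    then have "open {t. g t \<in> W}" by (subst open_subopen) auto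
    then show "openin euclidean {t \<in> topspace euclidean. g t \<in> W}" by simp
  qed
  moreover have "g t = \<psi> (c t)" if "\<bar>t\<bar> < 1" for t
    using gY[of t] that by (simp add: Y_def abs_less_iff)
  ultimately show ?thesis
    by (intro exI[of _ c] exI[of _ g] conjI allI ballI impI c gc gz gm)
qed

lemma sol_linear_approx:
  assumes "sol v c" "e > 0"
  obtains d where "d > 0" "\<And>t. \<bar>t\<bar> < d \<Longrightarrow> norm (c t - p - t *\<^sub>R v) \<le> e * \<bar>t\<bar>"
proof -
  have "(c has_derivative (\<lambda>h. h *\<^sub>R v)) (at 0)"
    using sol_deriv_0[OF assms(1)] by (simp add: has_vector_derivative_def)
  then obtain d where "d > 0" "\<And>t. norm (t - 0) < d \<Longrightarrow> norm (c t - c 0 - (t - 0) *\<^sub>R v) \<le> e * norm (t - 0)"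
    using assms(2) unfolding has_derivative_at_alt by blast
  then show thesis using that sol_0[OF assms(1)] by simp
qed

lemma central_plane:
  assumes conn: "connected_space T"
    and e: "e1 \<in> lie_center G (U, \<phi>)" "e2 \<in> lie_center G (U, \<phi>)" "e1 \<noteq> e2" "independent {e1, e2}"
  shows "\<exists>F :: real \<times> real \<Rightarrow> 'g. (\<forall>z. F z \<in> carrier G) \<and>
    (\<forall>z. \<forall>h\<in>carrier G. F z \<otimes> h = h \<otimes> F z) \<and> (\<forall>z w. F (z + w) = F z \<otimes> F w) \<and>
    continuous_map euclidean T F \<and> countable {z. F z = \<one>}"
proof -
  define \<kappa> where "\<kappa> = \<eta> / (norm e1 + norm e2)"
  have "e1 \<noteq> 0" using e(4) dependent_zero by auto
  then have pos: "norm e1 + norm e2 > 0" by (simp add: add_pos_nonneg)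
  then have \<kappa>: "\<kappa> > 0" using \<eta>(1) by (simp add: \<kappa>_def)
  define v1 v2 where "v1 = \<kappa> *\<^sub>R e1" and "v2 = \<kappa> *\<^sub>R e2"
  have "\<kappa> * norm e1 \<le> \<kappa> * (norm e1 + norm e2)" "\<kappa> * norm e2 \<le> \<kappa> * (norm e1 + norm e2)"
    using \<kappa> by simp_all
  moreover have "\<kappa> * (norm e1 + norm e2) = \<eta>" using pos by (simp add: \<kappa>_def)
  ultimately have n: "norm v1 \<le> \<eta>" "norm v2 \<le> \<eta>" using \<kappa> by (simp_all add: v1_def v2_def)
  have z: "v1 \<in> lie_center G (U, \<phi>)" "v2 \<in> lie_center G (U, \<phi>)"
    using e lie_center_scaleR by (simp_all add: v1_def v2_def)
  obtain \<delta> where \<delta>: "\<delta> > 0" "\<And>z :: real \<times> real. \<delta> * norm z \<le> norm (fst z *\<^sub>R e1 + snd z *\<^sub>R e2)"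
    using independent_pair_lower_bound[OF e(4,3)] by blast
  obtain c1 g1 where c1: "sol v1 c1" and "\<forall>t :: real. g1 t \<in> carrier G"
    "\<forall>t. \<forall>h\<in>carrier G. g1 t \<otimes> h = h \<otimes> g1 t" "\<forall>a b. g1 (a + b) = g1 a \<otimes> g1 b"
    "\<forall>t. \<bar>t\<bar> < 1 \<longrightarrow> g1 t = \<psi> (c1 t)" "continuous_map euclidean T g1"
    using central_one_parameter_subgroup[OF conn n(1) z(1)] by (elim exE conjE)
  note g1 = this(2-)[rule_format]
  obtain c2 g2 where c2: "sol v2 c2" and "\<forall>t :: real. g2 t \<in> carrier G"
    "\<forall>t. \<forall>h\<in>carrier G. g2 t \<otimes> h = h \<otimes> g2 t" "\<forall>a b. g2 (a + b) = g2 a \<otimes> g2 b"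
    "\<forall>t. \<bar>t\<bar> < 1 \<longrightarrow> g2 t = \<psi> (c2 t)" "continuous_map euclidean T g2"
    using central_one_parameter_subgroup[OF conn n(2) z(2)] by (elim exE conjE)
  note g2 = this(2-)[rule_format]
  define F where "F z = g1 (fst z) \<otimes> g2 (snd z)" for z
  have Fc: "F z \<in> carrier G" for z by (simp add: F_def g1(1) g2(1))
  have Fz: "F z \<otimes> h = h \<otimes> F z" if h: "h \<in> carrier G" for z h
  proof -
    have "F z \<otimes> h = g1 (fst z) \<otimes> (g2 (snd z) \<otimes> h)" using g1(1) g2(1) h by (simp add: F_def m_assoc)
    also have "\<dots> = g1 (fst z) \<otimes> (h \<otimes> g2 (snd z))" by (simp only: g2(2)[OF h])
    also have "\<dots> = (g1 (fst z) \<otimes> h) \<otimes> g2 (snd z)" using g1(1) g2(1) h by (simp add: m_assoc)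
    also have "\<dots> = (h \<otimes> g1 (fst z)) \<otimes> g2 (snd z)" by (simp only: g1(2)[OF h])
    also have "\<dots> = h \<otimes> F z" using g1(1) g2(1) h by (simp add: F_def m_assoc)
    finally show ?thesis .
  qed
  have Fm: "F (z + w) = F z \<otimes> F w" for z w
  proof -
    have "F (z + w) = g1 (fst z) \<otimes> (g1 (fst w) \<otimes> g2 (snd z)) \<otimes> g2 (snd w)"
      using g1(1) g2(1) by (simp add: F_def g1(3) g2(3) m_assoc)
    also have "\<dots> = g1 (fst z) \<otimes> (g2 (snd z) \<otimes> g1 (fst w)) \<otimes> g2 (snd w)"
      by (simp only: g1(2)[OF g2(1)])
    also have "\<dots> = F z \<otimes> F w"
      using g1(1) g2(1) by (simp add: F_def m_assoc)
    finally show ?thesis .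
  qed
  have Fcont: "continuous_map euclidean T F"
    unfolding F_def
    using continuous_map_compose[OF _ g1(5), of euclidean fst] continuous_map_compose[OF _ g2(5), of euclidean snd]
    by (intro continuous_map_mult) (simp_all add: o_def continuous_on_fst continuous_on_snd continuous_on_id)
  define \<epsilon> where "\<epsilon> = \<kappa> * \<delta>"
  have \<epsilon>: "\<epsilon> > 0" "\<epsilon> * norm z \<le> norm (fst z *\<^sub>R v1 + snd z *\<^sub>R v2)" for z :: "real \<times> real"
  proof -
    have "fst z *\<^sub>R v1 + snd z *\<^sub>R v2 = \<kappa> *\<^sub>R (fst z *\<^sub>R e1 + snd z *\<^sub>R e2)"
      by (simp add: v1_def v2_def algebra_simps)
    then show "\<epsilon> * norm z \<le> norm (fst z *\<^sub>R v1 + snd z *\<^sub>R v2)"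
      using \<kappa> mult_left_mono[OF \<delta>(2)[of z], of \<kappa>] by (simp add: \<epsilon>_def mult.assoc)
  qed (use \<kappa> \<delta>(1) in \<open>simp add: \<epsilon>_def\<close>)
  obtain d1 where d1: "d1 > 0" "\<And>t. \<bar>t\<bar> < d1 \<Longrightarrow> norm (c1 t - p - t *\<^sub>R v1) \<le> \<epsilon> / 4 * \<bar>t\<bar>"
    using sol_linear_approx[OF c1, of "\<epsilon> / 4"] \<epsilon>(1) by auto
  obtain d2 where d2: "d2 > 0" "\<And>t. \<bar>t\<bar> < d2 \<Longrightarrow> norm (c2 t - p - t *\<^sub>R v2) \<le> \<epsilon> / 4 * \<bar>t\<bar>"
    using sol_linear_approx[OF c2, of "\<epsilon> / 4"] \<epsilon>(1) by auto
  define \<rho> where "\<rho> = min 1 (min d1 d2)"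
  have \<rho>: "\<rho> > 0" using d1(1) d2(1) by (simp add: \<rho>_def)
  have iso: "z = 0" if Fz1: "F z = \<one>" and zn: "norm z < \<rho>" for z
  proof -
    have ab: "\<bar>fst z\<bar> \<le> norm z" "\<bar>snd z\<bar> \<le> norm z"
      using norm_fst_le[of "fst z" "snd z"] norm_snd_le[of "snd z" "fst z"] by simp_all
    have r: "\<bar>fst z\<bar> < 1" "\<bar>snd z\<bar> < 1" "\<bar>fst z\<bar> < d1" "\<bar>snd z\<bar> < d2"
      using ab zn by (auto simp: \<rho>_def)
    have r': "fst z \<in> {-1..1}" "snd z \<in> {-1..1}" "- snd z \<in> {-1..1}"
      using r by (auto simp: abs_less_iff)
    have "\<psi> (c1 (fst z)) \<otimes> \<psi> (c2 (snd z)) = \<one>"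
      using Fz1 g1(4)[OF r(1)] g2(4)[OF r(2)] by (simp add: F_def)
    then have "\<psi> (c1 (fst z)) = inv (\<psi> (c2 (snd z)))"
      using sol_carrier[OF c1 r'(1)] sol_carrier[OF c2 r'(2)] by (intro inv_equality[symmetric])
    also have "\<dots> = \<psi> (c2 (- snd z))"
      using n(2) \<eta>(1) by (intro sol_uminus[OF _ c2 r'(2), symmetric]) simp
    finally have eq: "c1 (fst z) = c2 (- snd z)"
      by (rule psi_inj[OF s_in[OF sol_s[OF c1 r'(1)]] s_in[OF sol_s[OF c2 r'(3)]]])
    have "fst z *\<^sub>R v1 + snd z *\<^sub>R v2 = (c2 (- snd z) - p - (- snd z) *\<^sub>R v2) - (c1 (fst z) - p - fst z *\<^sub>R v1)"
      by (simp add: eq)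
    also have "norm \<dots> \<le> \<epsilon> / 4 * \<bar>- snd z\<bar> + \<epsilon> / 4 * \<bar>fst z\<bar>"
      using r d1(2)[of "fst z"] d2(2)[of "- snd z"]
      by (intro order_trans[OF norm_triangle_ineq4 add_mono]) auto
    also have "\<dots> \<le> \<epsilon> / 4 * norm z + \<epsilon> / 4 * norm z"
      using ab \<epsilon>(1) by (intro add_mono mult_left_mono) auto
    finally have "\<epsilon> * norm z \<le> \<epsilon> / 2 * norm z"
      using \<epsilon>(2)[of z] by simp
    then have "\<epsilon> * norm z \<le> 0" by simp
    then show "z = 0" using \<epsilon>(1) by (simp add: mult_le_0_iff)
  qed
  have "countable {z. F z = \<one>}"
  proof (rule countable_if_separated[OF \<rho>])
    fix z w assume zw: "z \<in> {z. F z = \<one>}" "w \<in> {z. F z = \<one>}" "z \<noteq> w"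
    have "F ((z - w) + w) = F (z - w) \<otimes> F w" by (rule Fm)
    then have "F (z - w) = \<one>" using zw Fc[of "z - w"] by simp
    with iso[of "z - w"] zw(3) show "\<rho> \<le> dist z w"
      by (auto simp: dist_norm not_less[symmetric])
  qed
  then show ?thesis
    by (intro exI[of _ F] conjI allI ballI Fc Fz Fm Fcont)
qed

lemma uncountable_curve_image:
  assumes \<gamma>: "continuous_map (top_of_set {a..b}) T \<gamma>" and ab: "a \<le> b" "\<gamma> a \<noteq> \<gamma> (b :: real)"
  shows "uncountable (\<gamma> ` {a..b})" "closedin T (\<gamma> ` {a..b})"
proof -
  let ?J = "\<gamma> ` {a..b}" and ?X = "subtopology T (\<gamma> ` {a..b})"
  have comp: "compactin T ?J"
    by (rule image_compactin[OF _ \<gamma>]) (simp add: compactin_subtopology)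
  then show "closedin T ?J" by (rule compactin_imp_closedin[OF Hausdorff])
  have "connectedin T ?J"
    by (rule connectedin_continuous_map_image[OF \<gamma>]) (simp add: connectedin_subtopology)
  then have conn: "connected_space ?X" by (simp add: connectedin_def)
  have H: "Hausdorff_space ?X" by (rule Hausdorff_space_subtopology[OF Hausdorff])
  have "compact_space ?X" using comp by (simp add: compactin_subspace)
  then have normal: "normal_space ?X"
    using H compact_Hausdorff_or_regular_imp_normal_space by blast
  have top: "topspace ?X = ?J" using compactin_subset_topspace[OF comp] by auto
  have cl: "closedin ?X {\<gamma> a}" "closedin ?X {\<gamma> b}"
    using ab(1) top by (auto intro!: closedin_Hausdorff_singleton[OF H])
  have "(UNIV :: real set) \<lesssim> topspace ?X"
    by (rule connected_space_imp_card_ge_gen[OF conn normal cl]) (use ab in auto)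
  then show "uncountable ?J"
    unfolding top using uncountable_UNIV_real countable_lepoll by blast
qed

lemma connected_pseudo_discrete_ex:
  assumes CH: continuum_hypothesis and conn: "connected_space T"
    and dim: "dim_greater (lie_center G (U, \<phi>)) 1"
  shows "\<exists>N. N \<lhd> G \<and> connectedin T N \<and> pseudo_discrete G T A N \<and> N \<noteq> {\<one>}"
proof -
  obtain B where B: "B \<subseteq> lie_center G (U, \<phi>)" "independent B" "infinite B \<or> 1 < card B"
    using dim unfolding dim_greater_def by auto
  obtain e1 e2 where e: "e1 \<in> B" "e2 \<in> B" "e1 \<noteq> e2"
  proof -
    obtain C where C: "C \<subseteq> B" "card C = 2"
    proof (cases "finite B")
      case True
      then have "2 \<le> card B" using B(3) by simp
      then show thesis using that obtain_subset_with_card_n by metis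
    next
      case False
      then show thesis using that infinite_arbitrarily_large by metis
    qed
    then show thesis using that by (auto simp: card_2_iff)
  qed
  have ind: "independent {e1, e2}" using independent_mono[OF B(2)] e by auto
  have ez: "e1 \<in> lie_center G (U, \<phi>)" "e2 \<in> lie_center G (U, \<phi>)" using e B(1) by auto
  obtain F :: "real \<times> real \<Rightarrow> 'g" where "\<forall>z. F z \<in> carrier G"
    "\<forall>z. \<forall>h\<in>carrier G. F z \<otimes> h = h \<otimes> F z" "\<forall>z w. F (z + w) = F z \<otimes> F w"
    "continuous_map euclidean T F" "countable {z. F z = \<one>}"
    using central_plane[OF conn ez e(3) ind] by (elim exE conjE)
  note F = this[rule_format]
  have F0: "F 0 = \<one>"
    using F(3)[of 0 0] F(1)[of 0] by simp
  have Finv: "F (- z) = inv (F z)" for z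
    using F(3)[of "- z" z] F(1) F0 by (intro inv_equality[symmetric]) auto
  let ?\<Lambda> = "{z. F z = \<one>}"
  obtain X where "\<forall>K. closed K \<longrightarrow> uncountable K \<longrightarrow> (\<exists>x\<in>K \<inter> X. x \<notin> ?\<Lambda>)"
    "\<forall>K. closed K \<longrightarrow> uncountable K \<longrightarrow> (\<exists>y\<in>K. y \<notin> rat_span (X \<union> ?\<Lambda>))"
    using bernstein_rat_subspace[OF CH F(5)] by (elim exE conjE)
  note X = this[rule_format]
  define H where "H = rat_span X"
  have XH: "X \<subseteq> H" unfolding H_def using rat_vector.span_base by blast
  have H: "0 \<in> H" "\<And>x y. x \<in> H \<Longrightarrow> y \<in> H \<Longrightarrow> x + y \<in> H" "\<And>x. x \<in> H \<Longrightarrow> - x \<in> H"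
    unfolding H_def by (rule rat_vector.span_zero rat_vector.span_add rat_vector.span_neg; assumption)+
  define N where "N = F ` H"
  have sub: "subgroup N G"
  proof
    show "N \<subseteq> carrier G" using F(1) by (auto simp: N_def)
    show "\<one> \<in> N" unfolding N_def using F0 H(1) by (intro image_eqI[of _ _ 0]) simp_all
    show "x \<otimes> y \<in> N" if xy: "x \<in> N" "y \<in> N" for x y
    proof -
      obtain z w where "z \<in> H" "w \<in> H" "x = F z" "y = F w"
        using xy unfolding N_def by blast
      then show ?thesis unfolding N_def using F(3)[of z w] H(2) by (intro image_eqI[of _ _ "z + w"]) simp_all
    qed
    show "inv x \<in> N" if x: "x \<in> N" for x
    proof -
      obtain z where "z \<in> H" "x = F z"
        using x unfolding N_def by blast
      then show ?thesis unfolding N_def using Finv[of z] H(3) by (intro image_eqI[of _ _ "- z"]) simp_all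
    qed
  qed
  have "N \<lhd> G"
    unfolding normal_inv_iff
  proof (intro conjI ballI sub)
    fix x h assume xh: "x \<in> carrier G" "h \<in> N"
    then obtain z where z: "h = F z" by (auto simp: N_def)
    have "x \<otimes> h \<otimes> inv x = h \<otimes> x \<otimes> inv x" unfolding z using F(2)[OF xh(1)] by simp
    also have "\<dots> = h" using xh(1) F(1) z by (simp add: m_assoc)
    finally show "x \<otimes> h \<otimes> inv x \<in> N" using xh(2) by simp
  qed
  moreover have "connectedin T N"
  proof -
    have "connected H"
    proof (rule connected_if_meets_uncountable_closed)
      show "K \<inter> H \<noteq> {}" if "closed K" "uncountable K" for K
        using X(1)[OF that] XH by blast
    qed simp
    then show ?thesis
      unfolding N_def by (intro connectedin_continuous_map_image[OF F(4)]) simp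
  qed
  moreover have "pseudo_discrete G T A N"
    unfolding pseudo_discrete_def
  proof (intro conjI sub allI impI, elim conjE)
    fix I :: "real set" and \<gamma>
    assume I: "open I" "is_interval I" and sm: "smooth_map (top_of_set I) {(I, \<lambda>t. t)} T A \<gamma>"
      and im: "\<gamma> ` I \<subseteq> N"
    have cont: "continuous_map (top_of_set I) T \<gamma>" using sm by (simp add: smooth_map_def)
    have eq: "\<gamma> a = \<gamma> b" if ab: "a \<in> I" "b \<in> I" "a \<le> b" for a b
    proof (rule ccontr)
      assume ne: "\<gamma> a \<noteq> \<gamma> b"
      have abI: "{a..b} \<subseteq> I" using I(2) ab by (meson is_interval_1 atLeastAtMost_iff subsetI)
      have "continuous_map (top_of_set {a..b}) T \<gamma>"
        using continuous_map_from_subtopology_mono[OF cont abI] .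
      note J = uncountable_curve_image[OF this ab(3) ne]
      let ?K = "{z. F z \<in> \<gamma> ` {a..b}}"
      have JN: "\<gamma> ` {a..b} \<subseteq> N" using im abI by blast
      have "closed ?K"
        using closedin_continuous_map_preimage[OF F(4) J(2)] by simp
      moreover have "uncountable ?K"
      proof
        assume "countable ?K"
        then have "countable (F ` ?K)" by (rule countable_image)
        moreover have "\<gamma> ` {a..b} \<subseteq> F ` ?K"
        proof
          fix x assume x: "x \<in> \<gamma> ` {a..b}"
          then obtain z where "x = F z" using JN unfolding N_def by auto
          with x show "x \<in> F ` ?K" by auto
        qed
        ultimately have "countable (\<gamma> ` {a..b})" by (rule countable_subset[rotated])
        with J(1) show False by simp
      qed
      ultimately obtain y where y: "F y \<in> \<gamma> ` {a..b}" "y \<notin> rat_span (X \<union> ?\<Lambda>)"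
        using X(2)[of ?K] by auto
      from y(1) JN have "F y \<in> F ` H" unfolding N_def by (rule subsetD[rotated])
      then obtain h where h: "h \<in> H" "F y = F h" by auto
      have "F (y - h) = \<one>"
        using F(3)[of y "- h"] Finv[of h] h(2) F(1)[of h] by simp
      then have "y - h \<in> rat_span (X \<union> ?\<Lambda>)"
        by (intro rat_vector.span_base) simp
      moreover have "h \<in> rat_span (X \<union> ?\<Lambda>)"
        using h(1) rat_vector.span_mono[of X "X \<union> ?\<Lambda>"] unfolding H_def by blast
      ultimately have "(y - h) + h \<in> rat_span (X \<union> ?\<Lambda>)" by (rule rat_vector.span_add)
      with y(2) show False by simp
    qed
    have "\<gamma> a = \<gamma> b" if "a \<in> I" "b \<in> I" for a b
      using that eq[of a b] eq[of b a, symmetric] linear[of a b] by blast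
    then show "\<gamma> constant_on I" unfolding constant_on_def by blast
  qed
  moreover have "N \<noteq> {\<one>}"
  proof -
    have "uncountable (UNIV :: (real \<times> real) set)"
      using uncountable_cball[of 1 "0 :: real \<times> real"] countable_subset[OF subset_UNIV] by auto
    from X(1)[OF closed_UNIV this] obtain x where "x \<in> X" "F x \<noteq> \<one>" by auto
    then show ?thesis using XH unfolding N_def by blast
  qed
  ultimately show ?thesis by blast
qed

end

theorem theorem5p21:
  fixes G :: "('g, 'r) monoid_scheme"
    and T :: "'g topology"
    and A :: "('g, 'e::banach) chart set"
    and c :: "('g, 'e) chart"
  assumes "continuum_hypothesis"
    and "banach_lie_group G T A"
    and "connected_space T"
    and "separable_topology T"
    and "c \<in> A" and "\<one>\<^bsub>G\<^esub> \<in> fst c"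
  shows "(\<exists>N. N \<lhd> G \<and> connectedin T N \<and> pseudo_discrete G T A N \<and> N \<noteq> {\<one>\<^bsub>G\<^esub>})
    \<longleftrightarrow> dim_greater (lie_center G c) 1"
proof -
  interpret banach_lie_group G T A by (rule assms(2))
  obtain U \<phi> where c: "c = (U, \<phi>)" by (cases c)
  interpret lie_chart G T A U \<phi>
    by unfold_locales (use assms(5,6) c in auto)
  obtain r s \<eta> K where "lie_exp G T A U \<phi> r s \<eta> K"
    using lie_exp_ex by blast
  then interpret lie_exp G T A U \<phi> r s \<eta> K .
  have "N = {\<one>\<^bsub>G\<^esub>}"
    if N: "N \<lhd> G" "connectedin T N" "pseudo_discrete G T A N" and small: "\<not> dim_greater (lie_center G c) 1" for N
  proof -
    obtain B where B: "B \<subseteq> lie_center G c" "independent B" "lie_center G c \<subseteq> span B"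
      using maximal_independent_subset[of "lie_center G c"] by blast
    then have fin: "finite B" "card B \<le> 1"
      using small unfolding dim_greater_def by (auto simp: not_less)
    have "0 \<in> lie_center G c"
      using bracket_scaleR[of 0] by (simp add: c lie_center_iff)
    moreover have "card B = 0 \<or> card B = 1" using fin(2) by linarith
    then have "B = {} \<or> (\<exists>e. B = {e})"
      using fin(1) by (auto simp: card_1_singleton_iff)
    ultimately have "\<exists>e. e \<in> lie_center G c \<and> lie_center G c \<subseteq> span {e}"
    proof (elim disjE exE)
      assume "B = {}" "0 \<in> lie_center G c"
      then show ?thesis using B(3) span_mono[of "{}" "{0}"] by (intro exI[of _ 0]) auto
    next
      fix e assume "B = {e}"
      then show ?thesis using B(1,3) by (intro exI[of _ e]) auto
    qed
    then obtain e where "e \<in> lie_center G c" "lie_center G c \<subseteq> span {e}"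
      by (elim exE conjE)
    then show ?thesis
      using pseudo_discrete_normal_trivial[OF assms(3) N] by (simp add: c)
  qed
  then show ?thesis
    using connected_pseudo_discrete_ex[OF assms(1,3)] c by blast
qed

end
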